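(* Let $C^*(\mathbb{F}_2)=C^*(U,V)$ be the full C*-algebra of the free group on two generators, i.e. the universal C*-algebra generated by two unitaries $U$ and $V$. Let $\alpha$ be the $*$-automorphism of $C^*(\mathbb{F}_2)$ defined by $\alpha(U)=U^*$ and $\alpha(V)=V^*$. Then $$K_0\left(C^*(\mathbb{F}_2)\rtimes_\alpha\mathbb{Z}_2\right)=\mathbb{Z}^4\quad\text{and}\quad K_1\left(C^*(\mathbb{F}_2)\rtimes_\alpha\mathbb{Z}_2\right)=0.$$
   Context: For an order-two $*$-automorphism $\sigma$ of a unital C*-algebra $A$, the crossed-product $A\rtimes_\sigma\mathbb{Z}_2$ is the universal unital C*-algebra generated by $A$ and a unitary $W$ subject to $W^2=1$ and $WaW^*=\sigma(a)$ for all $a\in A$. $K_0,K_1$ denote the K-theory groups of C*-algebras, and equalities are isomorphisms of abelian groups. *)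

theory Defs
  imports
    Complex_Main
    "HOL-Library.Poly_Mapping"
    "HOL-Algebra.QuotRing"
    "HOL-Algebra.Elementary_Groups"
    "Jordan_Normal_Form.Matrix"
begin

section \<open>Unital C*-algebras\<close>

record 'a cstar = "(complex, 'a) module" +
  star :: "'a \<Rightarrow> 'a"
  cnorm :: "'a \<Rightarrow> real"

locale cstar_algebra = ring A for A :: "('a, 'm) cstar_scheme" (structure) +
  assumes smult_closed: "x \<in> carrier A \<Longrightarrow> c \<odot> x \<in> carrier A"
    and smult_add_left: "x \<in> carrier A \<Longrightarrow> (c + d) \<odot> x = c \<odot> x \<oplus> d \<odot> x"
    and smult_add_right: "\<lbrakk>x \<in> carrier A; y \<in> carrier A\<rbrakk> \<Longrightarrow> c \<odot> (x \<oplus> y) = c \<odot> x \<oplus> c \<odot> y"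
    and smult_smult: "x \<in> carrier A \<Longrightarrow> (c * d) \<odot> x = c \<odot> (d \<odot> x)"
    and smult_one: "x \<in> carrier A \<Longrightarrow> 1 \<odot> x = x"
    and smult_mult_left: "\<lbrakk>x \<in> carrier A; y \<in> carrier A\<rbrakk> \<Longrightarrow> (c \<odot> x) \<otimes> y = c \<odot> (x \<otimes> y)"
    and smult_mult_right: "\<lbrakk>x \<in> carrier A; y \<in> carrier A\<rbrakk> \<Longrightarrow> x \<otimes> (c \<odot> y) = c \<odot> (x \<otimes> y)"
    and star_closed: "x \<in> carrier A \<Longrightarrow> star A x \<in> carrier A"
    and star_add: "\<lbrakk>x \<in> carrier A; y \<in> carrier A\<rbrakk> \<Longrightarrow> star A (x \<oplus> y) = star A x \<oplus> star A y"
    and star_smult: "x \<in> carrier A \<Longrightarrow> star A (c \<odot> x) = cnj c \<odot> star A x"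
    and star_mult: "\<lbrakk>x \<in> carrier A; y \<in> carrier A\<rbrakk> \<Longrightarrow> star A (x \<otimes> y) = star A y \<otimes> star A x"
    and star_star: "x \<in> carrier A \<Longrightarrow> star A (star A x) = x"
    and cnorm_triangle: "\<lbrakk>x \<in> carrier A; y \<in> carrier A\<rbrakk> \<Longrightarrow> cnorm A (x \<oplus> y) \<le> cnorm A x + cnorm A y"
    and cnorm_smult: "x \<in> carrier A \<Longrightarrow> cnorm A (c \<odot> x) = cmod c * cnorm A x"
    and cnorm_mult: "\<lbrakk>x \<in> carrier A; y \<in> carrier A\<rbrakk> \<Longrightarrow> cnorm A (x \<otimes> y) \<le> cnorm A x * cnorm A y"
    and cnorm_eq_0: "x \<in> carrier A \<Longrightarrow> cnorm A x = 0 \<Longrightarrow> x = \<zero>"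
    and cstar_identity: "x \<in> carrier A \<Longrightarrow> cnorm A (star A x \<otimes> x) = (cnorm A x)\<^sup>2"
    and complete: "\<lbrakk>\<And>n::nat. X n \<in> carrier A;
        \<forall>e>0. \<exists>M. \<forall>m\<ge>M. \<forall>n\<ge>M. cnorm A (X m \<ominus> X n) < e\<rbrakk>
      \<Longrightarrow> \<exists>L\<in>carrier A. (\<lambda>n. cnorm A (X n \<ominus> L)) \<longlonglongrightarrow> 0"

text \<open>Unital *-homomorphisms (\<^const>\<open>ring_hom\<close> preserves the unit) and *-automorphisms.\<close>

definition star_hom :: "('a, 'm) cstar_scheme \<Rightarrow> ('b, 'n) cstar_scheme \<Rightarrow> ('a \<Rightarrow> 'b) set" where
  "star_hom A B = {f \<in> Ring.ring_hom A B.
     (\<forall>c. \<forall>x\<in>carrier A. f (c \<odot>\<^bsub>A\<^esub> x) = c \<odot>\<^bsub>B\<^esub> f x) \<and>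
     (\<forall>x\<in>carrier A. f (star A x) = star B (f x))}"

definition star_aut :: "('a, 'm) cstar_scheme \<Rightarrow> ('a \<Rightarrow> 'a) set" where
  "star_aut A = {f \<in> star_hom A A. bij_betw f (carrier A) (carrier A)}"


section \<open>The free unital *-algebra\<close>

text \<open>A letter \<open>(g, False)\<close> stands for the generator \<open>g\<close> and \<open>(g, True)\<close> for its adjoint.\<close>

datatype 'g star_word = Word (letters: "('g \<times> bool) list")

instantiation star_word :: (type) monoid_add
begin
definition zero_star_word :: "'a star_word" where "0 = Word []"
definition plus_star_word :: "'a star_word \<Rightarrow> 'a star_word \<Rightarrow> 'a star_word" where
  "v + w = Word (letters v @ letters w)"
instance by standard (auto simp: zero_star_word_def plus_star_word_def)
end

definition word_star :: "'g star_word \<Rightarrow> 'g star_word" where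
  "word_star w = Word (rev (map (\<lambda>(g, b). (g, \<not> b)) (letters w)))"

lemma word_star_word_star [simp]: "word_star (word_star w) = w"
  by (cases w) (simp add: word_star_def rev_map comp_def case_prod_unfold)

text \<open>Since words form a monoid under concatenation (written \<open>+\<close>), the product of
  \<^typ>\<open>'g star_word \<Rightarrow>\<^sub>0 complex\<close> provided by the library is the one of the monoid algebra,
  i.e. of noncommutative *-polynomials.\<close>

type_synonym 'g free_star = "'g star_word \<Rightarrow>\<^sub>0 complex"

definition gen :: "'g \<Rightarrow> 'g free_star" where
  "gen g = Poly_Mapping.single (Word [(g, False)]) 1"

definition scale :: "complex \<Rightarrow> 'g free_star \<Rightarrow> 'g free_star" where
  "scale c x = Poly_Mapping.single 0 c * x"

lift_definition adjoint :: "'g free_star \<Rightarrow> 'g free_star"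
  is "\<lambda>f w. cnj (f (word_star w))"
proof -
  fix f :: "'g star_word \<Rightarrow> complex"
  assume "finite {w. f w \<noteq> 0}"
  moreover have "{w. cnj (f (word_star w)) \<noteq> 0} \<subseteq> word_star ` {w. f w \<noteq> 0}"
    by (auto intro!: image_eqI[where x = "word_star _"])
  ultimately show "finite {w. cnj (f (word_star w)) \<noteq> 0}"
    using finite_subset by blast
qed


section \<open>Universal C*-algebras given by generators and relations\<close>

text \<open>A set \<open>R\<close> of noncommutative *-polynomials encodes the relations \<open>r = 0\<close> for \<open>r \<in> R\<close>.\<close>

definition cstar_seminorms :: "'g free_star set \<Rightarrow> ('g free_star \<Rightarrow> real) set" where
  "cstar_seminorms R = {p.
     (\<forall>x y. p (x + y) \<le> p x + p y) \<and>
     (\<forall>c x. p (scale c x) = cmod c * p x) \<and>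
     (\<forall>x y. p (x * y) \<le> p x * p y) \<and>
     (\<forall>x. p (adjoint x * x) = (p x)\<^sup>2) \<and>
     (\<forall>r\<in>R. p r = 0)}"

definition universal_seminorm :: "'g free_star set \<Rightarrow> 'g free_star \<Rightarrow> real" where
  "universal_seminorm R x = (SUP p\<in>cstar_seminorms R. p x)"

text \<open>The supremum is finite, and the universal C*-algebra exists, when \<open>R\<close> bounds the
  generators. For the relations used below this is automatic: unitaries have norm at most \<open>1\<close>,
  and C*-seminorms on a C*-algebra are dominated by its norm. The universal property is proved
  at the end of this theory.\<close>

definition admissible :: "'g free_star set \<Rightarrow> bool" where
  "admissible R \<longleftrightarrow> (\<forall>g. bdd_above ((\<lambda>p. p (gen g)) ` cstar_seminorms R))"

text \<open>Hausdorff completion of the free *-algebra: Cauchy sequences modulo null sequences.\<close>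

definition cauchy_seqs :: "('g free_star \<Rightarrow> real) \<Rightarrow> (nat \<Rightarrow> 'g free_star) ring" where
  "cauchy_seqs N =
     \<lparr>carrier = {x. \<forall>e>0. \<exists>M. \<forall>m\<ge>M. \<forall>n\<ge>M. N (x m - x n) < e},
      monoid.mult = (\<lambda>x y n. x n * y n), one = (\<lambda>n. 1), zero = (\<lambda>n. 0), add = (\<lambda>x y n. x n + y n)\<rparr>"

definition null_seqs :: "('g free_star \<Rightarrow> real) \<Rightarrow> (nat \<Rightarrow> 'g free_star) set" where
  "null_seqs N = {x. (\<lambda>n. N (x n)) \<longlonglongrightarrow> 0}"

definition seq_class :: "('g free_star \<Rightarrow> real) \<Rightarrow> (nat \<Rightarrow> 'g free_star) \<Rightarrow> (nat \<Rightarrow> 'g free_star) set" where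
  "seq_class N x = null_seqs N +>\<^bsub>cauchy_seqs N\<^esub> x"

definition completion :: "('g free_star \<Rightarrow> real) \<Rightarrow> (nat \<Rightarrow> 'g free_star) set cstar" where
  "completion N = (let Q = cauchy_seqs N Quot null_seqs N in
     \<lparr>carrier = carrier Q, monoid.mult = monoid.mult Q, one = one Q, zero = zero Q, add = add Q,
      smult = (\<lambda>c X. \<Union>x\<in>X. seq_class N (\<lambda>n. scale c (x n))),
      star = (\<lambda>X. \<Union>x\<in>X. seq_class N (\<lambda>n. adjoint (x n))),
      cnorm = (\<lambda>X. THE l. \<forall>x\<in>X. (\<lambda>n. N (x n)) \<longlonglongrightarrow> l)\<rparr>)"

definition universal_cstar :: "'g free_star set \<Rightarrow> (nat \<Rightarrow> 'g free_star) set cstar" where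
  "universal_cstar R = completion (universal_seminorm R)"

definition universal_gen :: "'g free_star set \<Rightarrow> 'g \<Rightarrow> (nat \<Rightarrow> 'g free_star) set" where
  "universal_gen R g = seq_class (universal_seminorm R) (\<lambda>n. gen g)"


section \<open>The full C*-algebra of the free group on two generators\<close>

datatype f2_gen = U_gen | V_gen

definition free_group_rels :: "f2_gen free_star set" where
  "free_group_rels = (\<Union>g. {adjoint (gen g) * gen g - 1, gen g * adjoint (gen g) - 1})"

definition CstarF2 :: "(nat \<Rightarrow> f2_gen free_star) set cstar" where
  "CstarF2 = universal_cstar free_group_rels"

definition F2_U :: "(nat \<Rightarrow> f2_gen free_star) set" where
  "F2_U = universal_gen free_group_rels U_gen"

definition F2_V :: "(nat \<Rightarrow> f2_gen free_star) set" where
  "F2_V = universal_gen free_group_rels V_gen"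


section \<open>Crossed products by an automorphism of order two\<close>

text \<open>The generators are the elements of \<open>A\<close> and one more symbol \<open>W\<close>; the relations are all
  those that hold between elements of \<open>A\<close>, the unit of \<open>A\<close> being the unit of the crossed product,
  and those imposed on \<open>W\<close>. Values of type \<^typ>\<open>'a\<close> outside the carrier are set to \<open>0\<close>.\<close>

datatype 'a crossed_gen = Elt 'a | W_gen

definition crossed_rels ::
  "('a, 'm) cstar_scheme \<Rightarrow> ('a \<Rightarrow> 'a) \<Rightarrow> 'a crossed_gen free_star set" where
  "crossed_rels A \<sigma> =
     {gen (Elt a) | a. a \<notin> carrier A} \<union>
     {gen (Elt (a \<oplus>\<^bsub>A\<^esub> b)) - (gen (Elt a) + gen (Elt b)) | a b. a \<in> carrier A \<and> b \<in> carrier A} \<union>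
     {gen (Elt (c \<odot>\<^bsub>A\<^esub> a)) - scale c (gen (Elt a)) | c a. a \<in> carrier A} \<union>
     {gen (Elt (a \<otimes>\<^bsub>A\<^esub> b)) - gen (Elt a) * gen (Elt b) | a b. a \<in> carrier A \<and> b \<in> carrier A} \<union>
     {gen (Elt (star A a)) - adjoint (gen (Elt a)) | a. a \<in> carrier A} \<union>
     {gen (Elt \<one>\<^bsub>A\<^esub>) - 1} \<union>
     {adjoint (gen W_gen) * gen W_gen - 1, gen W_gen * adjoint (gen W_gen) - 1, gen W_gen * gen W_gen - 1} \<union>
     {gen W_gen * gen (Elt a) * adjoint (gen W_gen) - gen (Elt (\<sigma> a)) | a. a \<in> carrier A}"

definition crossed_product ::
  "('a, 'm) cstar_scheme \<Rightarrow> ('a \<Rightarrow> 'a) \<Rightarrow> (nat \<Rightarrow> 'a crossed_gen free_star) set cstar" where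
  "crossed_product A \<sigma> = universal_cstar (crossed_rels A \<sigma>)"


section \<open>Matrices over a unital C*-algebra\<close>

definition mats :: "('a, 'm) cstar_scheme \<Rightarrow> nat \<Rightarrow> nat \<Rightarrow> 'a mat set" where
  "mats A m n = {M \<in> carrier_mat m n. elements_mat M \<subseteq> carrier A}"

definition mat_times :: "('a, 'm) cstar_scheme \<Rightarrow> 'a mat \<Rightarrow> 'a mat \<Rightarrow> 'a mat" where
  "mat_times A M N = mat (dim_row M) (dim_col N)
     (\<lambda>(i, j). \<Oplus>\<^bsub>A\<^esub>k\<in>{..<dim_col M}. M $$ (i, k) \<otimes>\<^bsub>A\<^esub> N $$ (k, j))"

definition mat_star :: "('a, 'm) cstar_scheme \<Rightarrow> 'a mat \<Rightarrow> 'a mat" where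
  "mat_star A M = mat (dim_col M) (dim_row M) (\<lambda>(i, j). star A (M $$ (j, i)))"

definition mat_id :: "('a, 'm) cstar_scheme \<Rightarrow> nat \<Rightarrow> 'a mat" where
  "mat_id A n = mat n n (\<lambda>(i, j). if i = j then \<one>\<^bsub>A\<^esub> else \<zero>\<^bsub>A\<^esub>)"

definition mat_zero :: "('a, 'm) cstar_scheme \<Rightarrow> nat \<Rightarrow> nat \<Rightarrow> 'a mat" where
  "mat_zero A m n = mat m n (\<lambda>_. \<zero>\<^bsub>A\<^esub>)"

definition dsum :: "('a, 'm) cstar_scheme \<Rightarrow> 'a mat \<Rightarrow> 'a mat \<Rightarrow> 'a mat" where
  "dsum A M N = four_block_mat M (mat_zero A (dim_row M) (dim_col N))
     (mat_zero A (dim_row N) (dim_col M)) N"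


section \<open>K-theory of a unital C*-algebra\<close>

text \<open>\<open>K\<^sub>0\<close> is the Grothendieck group of the semigroup of Murray--von Neumann classes of
  projections in matrix algebras: a pair \<open>(p, q)\<close> represents the formal difference \<open>[p] - [q]\<close>.
  The empty matrix is admitted; it is equivalent to every zero projection.\<close>

definition projections :: "('a, 'm) cstar_scheme \<Rightarrow> 'a mat set" where
  "projections A = {p. \<exists>n. p \<in> mats A n n \<and> mat_star A p = p \<and> mat_times A p p = p}"

definition mvn_equiv :: "('a, 'm) cstar_scheme \<Rightarrow> 'a mat \<Rightarrow> 'a mat \<Rightarrow> bool" where
  "mvn_equiv A p q \<longleftrightarrow> (\<exists>v\<in>mats A (dim_row q) (dim_row p).
     mat_times A (mat_star A v) v = p \<and> mat_times A v (mat_star A v) = q)"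

definition K0_rel :: "('a, 'm) cstar_scheme \<Rightarrow> (('a mat \<times> 'a mat) \<times> ('a mat \<times> 'a mat)) set" where
  "K0_rel A = {((p, q), (p', q')).
     p \<in> projections A \<and> q \<in> projections A \<and> p' \<in> projections A \<and> q' \<in> projections A \<and>
     (\<exists>r\<in>projections A. mvn_equiv A (dsum A (dsum A p q') r) (dsum A (dsum A p' q) r))}"

definition K0 :: "('a, 'm) cstar_scheme \<Rightarrow> ('a mat \<times> 'a mat) set monoid" where
  "K0 A =
     \<lparr>carrier = (projections A \<times> projections A) // K0_rel A,
      monoid.mult = (\<lambda>X Y. \<Union>(p, q)\<in>X. \<Union>(p', q')\<in>Y. K0_rel A `` {(dsum A p p', dsum A q q')}),
      one = K0_rel A `` {(mat_id A 0, mat_id A 0)}\<rparr>"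

text \<open>For unital \<open>A\<close>, \<open>K\<^sub>1\<close> consists of the unitary matrices over \<open>A\<close> up to stabilisation
  by identity matrices and homotopy. The norm topology on matrices over \<open>A\<close> is the topology of
  entrywise norm convergence, which is how continuity of paths is expressed.\<close>

definition unitaries :: "('a, 'm) cstar_scheme \<Rightarrow> nat \<Rightarrow> 'a mat set" where
  "unitaries A n = {u \<in> mats A n n.
     mat_times A (mat_star A u) u = mat_id A n \<and> mat_times A u (mat_star A u) = mat_id A n}"

definition unitary_path :: "('a, 'm) cstar_scheme \<Rightarrow> nat \<Rightarrow> (real \<Rightarrow> 'a mat) \<Rightarrow> bool" where
  "unitary_path A n \<gamma> \<longleftrightarrow> (\<forall>t\<in>{0..1}. \<gamma> t \<in> unitaries A n) \<and>
     (\<forall>i<n. \<forall>j<n. \<forall>s\<in>{0..1}.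
        ((\<lambda>t. cnorm A (\<gamma> t $$ (i, j) \<ominus>\<^bsub>A\<^esub> \<gamma> s $$ (i, j))) \<longlongrightarrow> 0) (at s within {0..1}))"

definition K1_rel :: "('a, 'm) cstar_scheme \<Rightarrow> ('a mat \<times> 'a mat) set" where
  "K1_rel A = {(u, v). \<exists>m n i j. u \<in> unitaries A m \<and> v \<in> unitaries A n \<and> m + i = n + j \<and>
     (\<exists>\<gamma>. unitary_path A (m + i) \<gamma> \<and>
        \<gamma> 0 = dsum A u (mat_id A i) \<and> \<gamma> 1 = dsum A v (mat_id A j))}"

definition K1 :: "('a, 'm) cstar_scheme \<Rightarrow> 'a mat set monoid" where
  "K1 A =
     \<lparr>carrier = (\<Union>n. unitaries A n) // K1_rel A,
      monoid.mult = (\<lambda>X Y. \<Union>u\<in>X. \<Union>v\<in>Y. K1_rel A `` {dsum A u v}),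
      one = K1_rel A `` {mat_id A 0}\<rparr>"

section \<open>The universal property\<close>

subsection \<open>The free unital *-algebra\<close>

lemma star_poly_induct [case_names single add]:
  fixes x :: "'g free_star"
  assumes "\<And>w c. P (Poly_Mapping.single w c)" and "\<And>x y. P x \<Longrightarrow> P y \<Longrightarrow> P (x + y)"
  shows "P x"
proof (induction x rule: update_induct)
  case const then show ?case using assms(1)[of _ 0] by simp
next
  case (update f a b)
  have "Poly_Mapping.update a b f = f + Poly_Mapping.single a b"
    using update(1) by (intro poly_mapping_eqI)
      (auto simp: lookup_update lookup_add lookup_single in_keys_iff when_def)
  then show ?case using update assms by simp
qed

lemma word_star_add: "word_star (v + w) = word_star w + word_star v"
  by (simp add: word_star_def plus_star_word_def)

lemma word_star_zero [simp]: "word_star 0 = 0"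
  by (simp add: word_star_def zero_star_word_def)

lemma lookup_adjoint: "Poly_Mapping.lookup (adjoint x) w = cnj (Poly_Mapping.lookup x (word_star w))"
  by transfer simp

lemma adjoint_add: "adjoint (x + y) = adjoint x + adjoint y"
  by (intro poly_mapping_eqI) (simp add: lookup_adjoint lookup_add)

lemma adjoint_adjoint [simp]: "adjoint (adjoint x) = x"
  by (intro poly_mapping_eqI) (simp add: lookup_adjoint)

lemma adjoint_single [simp]:
  "adjoint (Poly_Mapping.single w c) = Poly_Mapping.single (word_star w) (cnj c)"
proof (intro poly_mapping_eqI)
  fix v
  have "w = word_star v \<longleftrightarrow> word_star w = v" by (metis word_star_word_star)
  then show "Poly_Mapping.lookup (adjoint (Poly_Mapping.single w c)) v
      = Poly_Mapping.lookup (Poly_Mapping.single (word_star w) (cnj c)) v"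
    by (simp add: lookup_adjoint lookup_single when_def)
qed

lemma adjoint_mult: "adjoint (x * y) = adjoint y * adjoint x"
proof (induction x rule: star_poly_induct)
  case (single w c)
  show ?case
    by (induction y rule: star_poly_induct)
      (simp_all add: mult_single word_star_add distrib_left distrib_right adjoint_add mult.commute)
qed (simp add: adjoint_add distrib_left distrib_right)

lemma adjoint_one [simp]: "adjoint 1 = 1"
  by (metis adjoint_single complex_cnj_one single_one word_star_zero)

lemma scale_single [simp]: "scale c (Poly_Mapping.single w d) = Poly_Mapping.single w (c * d)"
  by (simp add: scale_def mult_single)

lemma scale_add_left: "scale (c + d) x = scale c x + scale d x"
  by (simp add: scale_def single_add distrib_right)

lemma scale_add_right: "scale c (x + y) = scale c x + scale c y"
  by (simp add: scale_def distrib_left)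

lemma scale_one [simp]: "scale 1 x = x"
  by (simp add: scale_def)

lemma scale_scale: "scale c (scale d x) = scale (c * d) x"
  by (simp add: scale_def mult_single flip: mult.assoc)

lemma scale_mult_left: "scale c x * y = scale c (x * y)"
  by (simp add: scale_def mult.assoc)

lemma scale_mult_right: "x * scale c y = scale c (x * y)"
proof -
  have "x * Poly_Mapping.single 0 c = Poly_Mapping.single 0 c * x"
    by (induction x rule: star_poly_induct)
      (simp_all add: mult_single mult.commute distrib_left distrib_right)
  then show ?thesis by (simp add: scale_def flip: mult.assoc)
qed

lemma scale_minus_one: "scale (- 1) x = - x"
  using scale_add_left[of "-1" 1 x] by (simp add: scale_def eq_neg_iff_add_eq_0)

lemma adjoint_scale: "adjoint (scale c x) = scale (cnj c) (adjoint x)"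
  by (induction x rule: star_poly_induct) (simp_all add: adjoint_add scale_add_right)

lemma adjoint_minus: "adjoint (- x) = - adjoint x"
  by (metis adjoint_scale complex_cnj_minus complex_cnj_one scale_minus_one)

lemma adjoint_diff: "adjoint (x - y) = adjoint x - adjoint y"
  by (simp only: diff_conv_add_uminus adjoint_add adjoint_minus)

lemma scale_diff_right: "scale c (x - y) = scale c x - scale c y"
  by (simp add: scale_def right_diff_distrib)

subsection \<open>The completion is a C*-algebra\<close>

locale cstar_seminorm =
  fixes N :: "'g free_star \<Rightarrow> real"
  assumes N: "N \<in> cstar_seminorms {}"
begin

lemma tri: "N (x + y) \<le> N x + N y" using N by (simp add: cstar_seminorms_def)
lemma N_scale: "N (scale c x) = cmod c * N x" using N by (simp add: cstar_seminorms_def)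
lemma N_mult: "N (x * y) \<le> N x * N y" using N by (simp add: cstar_seminorms_def)
lemma N_cstar: "N (adjoint x * x) = (N x)\<^sup>2" using N by (simp add: cstar_seminorms_def)

lemma N_zero [simp]: "N 0 = 0"
  using N_scale[of 0 0] by (simp add: scale_def)
lemma N_minus [simp]: "N (- x) = N x"
  using N_scale[of "-1" x] by (simp add: scale_minus_one)
lemma N_nonneg [simp]: "0 \<le> N x"
  using tri[of x "-x"] by simp
lemma N_diff_commute: "N (x - y) = N (y - x)"
  using N_minus[of "x - y"] by simp
lemma tri_diff: "N (x - y) \<le> N x + N y"
  using tri[of x "-y"] by simp
lemma N_diff_tri: "N (x - z) \<le> N (x - y) + N (y - z)"
  using tri[of "x-y" "y-z"] by simp
lemma N_abs_diff: "\<bar>N x - N y\<bar> \<le> N (x - y)"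
  using tri[of "x-y" y] tri[of "y-x" x] N_diff_commute[of x y] by simp

lemma N_adjoint [simp]: "N (adjoint x) = N x"
proof -
  have *: "N x \<le> N (adjoint x)" for x
  proof (cases "N x = 0")
    case False
    have "N x * N x \<le> N (adjoint x) * N x"
      using N_mult[of "adjoint x" x] N_cstar[of x] by (simp add: power2_eq_square)
    then show ?thesis using False N_nonneg[of x] by (simp add: mult_le_cancel_right)
  qed simp
  show ?thesis using *[of x] *[of "adjoint x"] by simp
qed

lemma tri_le: "N x \<le> a \<Longrightarrow> N y \<le> b \<Longrightarrow> N (x + y) \<le> a + b"
  using tri[of x y] by linarith

abbreviation "C \<equiv> cauchy_seqs N"
abbreviation "Z \<equiv> null_seqs N"

lemma cauchyI: "(\<And>e. e > 0 \<Longrightarrow> \<exists>M. \<forall>m\<ge>M. \<forall>n\<ge>M. N (x m - x n) < e) \<Longrightarrow> x \<in> carrier C"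
  by (simp add: cauchy_seqs_def)
lemma cauchyD: "x \<in> carrier C \<Longrightarrow> e > 0 \<Longrightarrow> \<exists>M. \<forall>m\<ge>M. \<forall>n\<ge>M. N (x m - x n) < e"
  by (simp add: cauchy_seqs_def)

lemma C_simps [simp]:
  "x \<oplus>\<^bsub>C\<^esub> y = (\<lambda>n. x n + y n)" "x \<otimes>\<^bsub>C\<^esub> y = (\<lambda>n. x n * y n)"
  "\<zero>\<^bsub>C\<^esub> = (\<lambda>n. 0)" "\<one>\<^bsub>C\<^esub> = (\<lambda>n. 1)"
  by (simp_all add: cauchy_seqs_def)

lemma cauchy_const [simp]: "(\<lambda>n. x) \<in> carrier C"
  by (rule cauchyI) auto

lemma cauchy_add:
  assumes "x \<in> carrier C" "y \<in> carrier C" shows "(\<lambda>n. x n + y n) \<in> carrier C"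
proof (rule cauchyI)
  fix e :: real assume "e > 0"
  then have e: "e/2 > 0" by simp
  obtain K where K: "\<forall>m\<ge>K. \<forall>n\<ge>K. N (x m - x n) < e/2" using cauchyD[OF assms(1) e] by blast
  obtain L where L: "\<forall>m\<ge>L. \<forall>n\<ge>L. N (y m - y n) < e/2" using cauchyD[OF assms(2) e] by blast
  have "N (x m + y m - (x n + y n)) < e" if "m \<ge> max K L" "n \<ge> max K L" for m n
  proof -
    have "N (x m + y m - (x n + y n)) \<le> N (x m - x n) + N (y m - y n)"
      using tri[of "x m - x n" "y m - y n"] by (simp add: algebra_simps)
    moreover have "N (x m - x n) < e/2" "N (y m - y n) < e/2" using K L that by auto
    ultimately show ?thesis by linarith
  qed
  then show "\<exists>M. \<forall>m\<ge>M. \<forall>n\<ge>M. N (x m + y m - (x n + y n)) < e" by blast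
qed

lemma cauchy_dominated:
  assumes x: "x \<in> carrier C" and y: "\<And>m n. N (y m - y n) \<le> K * N (x m - x n)" and K: "K \<ge> 0"
  shows "y \<in> carrier C"
proof (rule cauchyI)
  fix e :: real assume "e > 0"
  then have e: "e/(K+1) > 0" using K by (simp add: add_nonneg_pos)
  obtain M where M: "\<forall>m\<ge>M. \<forall>n\<ge>M. N (x m - x n) < e / (K + 1)"
    using cauchyD[OF x e] by blast
  have "N (y m - y n) < e" if mn: "m \<ge> M" "n \<ge> M" for m n
  proof -
    have "N (x m - x n) < e/(K+1)" using M mn by blast
    then have "(K+1) * N (x m - x n) < e" using K by (simp add: pos_less_divide_eq mult.commute)
    moreover have "(K+1) * N (x m - x n) = K * N (x m - x n) + N (x m - x n)"
      by (simp add: distrib_right)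
    ultimately show ?thesis using y[of m n] N_nonneg[of "x m - x n"] by linarith
  qed
  then show "\<exists>M. \<forall>m\<ge>M. \<forall>n\<ge>M. N (y m - y n) < e" by blast
qed

lemma cauchy_minus: "x \<in> carrier C \<Longrightarrow> (\<lambda>n. - x n) \<in> carrier C"
proof (erule cauchy_dominated[where K = 1])
  show "N (- x m - - x n) \<le> 1 * N (x m - x n)" for m n
    using N_minus[of "x m - x n"] by (simp add: algebra_simps)
qed simp

lemma cauchy_diff: "x \<in> carrier C \<Longrightarrow> y \<in> carrier C \<Longrightarrow> (\<lambda>n. x n - y n) \<in> carrier C"
  using cauchy_add[OF _ cauchy_minus] by fastforce

lemma cauchy_scale: "x \<in> carrier C \<Longrightarrow> (\<lambda>n. scale c (x n)) \<in> carrier C"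
  by (erule cauchy_dominated[where K = "cmod c"]) (simp_all add: N_scale flip: scale_diff_right)

lemma cauchy_adjoint: "x \<in> carrier C \<Longrightarrow> (\<lambda>n. adjoint (x n)) \<in> carrier C"
  by (erule cauchy_dominated[where K = 1]) (simp_all flip: adjoint_diff)

lemma cauchy_Cauchy_N: 
  assumes "x \<in> carrier C" shows "convergent (\<lambda>n. N (x n))"
proof (rule Cauchy_convergent, rule metric_CauchyI)
  fix e :: real assume "e > 0"
  then obtain M where "\<forall>m\<ge>M. \<forall>n\<ge>M. N (x m - x n) < e" using cauchyD[OF assms] by blast
  then have "\<forall>m\<ge>M. \<forall>n\<ge>M. dist (N (x m)) (N (x n)) < e"
    unfolding dist_real_def using le_less_trans[OF N_abs_diff] by blast
  then show "\<exists>M. \<forall>m\<ge>M. \<forall>n\<ge>M. dist (N (x m)) (N (x n)) < e" by blast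
qed

lemma cauchy_bounded:
  assumes "x \<in> carrier C" shows "\<exists>K>0. \<forall>n. N (x n) \<le> K"
  using Bseq_def[of "\<lambda>n. N (x n)"] convergent_imp_Bseq[OF cauchy_Cauchy_N[OF assms]] by auto

lemma mult_diff_bound: "N (a * b - c * d) \<le> N (a - c) * N b + N c * N (b - d)"
proof -
  have "a * b - c * d = (a - c) * b + c * (b - d)" by (simp add: algebra_simps)
  then show ?thesis by (simp only: tri_le[OF N_mult N_mult])
qed

lemma cauchy_mult:
  assumes x: "x \<in> carrier C" and y: "y \<in> carrier C" shows "(\<lambda>n. x n * y n) \<in> carrier C"
proof (rule cauchyI)
  fix e :: real assume e: "e > 0"
  obtain K where K: "K > 0" "\<And>n. N (x n) \<le> K" using cauchy_bounded[OF x] by auto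
  obtain L where L: "L > 0" "\<And>n. N (y n) \<le> L" using cauchy_bounded[OF y] by auto
  have eL: "e/(2*L) > 0" and eK: "e/(2*K) > 0" using e K(1) L(1) by simp_all
  obtain A where A: "\<forall>m\<ge>A. \<forall>n\<ge>A. N (x m - x n) < e/(2*L)" using cauchyD[OF x eL] by blast
  obtain B where B: "\<forall>m\<ge>B. \<forall>n\<ge>B. N (y m - y n) < e/(2*K)" using cauchyD[OF y eK] by blast
  have "N (x m * y m - x n * y n) < e" if mn: "m \<ge> max A B" "n \<ge> max A B" for m n
  proof -
    have "N (x m - x n) * N (y m) \<le> N (x m - x n) * L"
      by (intro mult_left_mono L) simp
    also have "\<dots> < e/(2*L) * L" using A mn L by (intro mult_strict_right_mono) auto
    finally have 1: "N (x m - x n) * N (y m) < e/2" using L by simp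
    have "N (x n) * N (y m - y n) \<le> K * N (y m - y n)"
      by (intro mult_right_mono K) simp
    also have "\<dots> < K * (e/(2*K))" using B mn K by (intro mult_strict_left_mono) auto
    finally have 2: "N (x n) * N (y m - y n) < e/2" using K by simp
    show ?thesis using mult_diff_bound[of "x m" "y m" "x n" "y n"] 1 2 by linarith
  qed
  then show "\<exists>M. \<forall>m\<ge>M. \<forall>n\<ge>M. N (x m * y m - x n * y n) < e" by blast
qed

lemma ring_C: "ring C"
proof (rule ringI)
  show "abelian_group C"
  proof (rule abelian_groupI)
    fix x assume "x \<in> carrier C"
    then show "\<exists>y\<in>carrier C. y \<oplus>\<^bsub>C\<^esub> x = \<zero>\<^bsub>C\<^esub>"
      by (intro bexI[OF _ cauchy_minus[of x]]) auto
  qed (auto simp: cauchy_add algebra_simps)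
  show "Group.monoid C" by (rule monoidI) (auto simp: cauchy_mult mult.assoc)
qed (auto simp: algebra_simps)

lemma null_dominated:
  assumes "x \<in> Z" "\<And>n. N (y n) \<le> K * N (x n)" shows "y \<in> Z"
  unfolding null_seqs_def mem_Collect_eq
proof (rule tendsto_sandwich[OF _ _ tendsto_const])
  show "(\<lambda>n. K * N (x n)) \<longlonglongrightarrow> 0"
    using assms(1) tendsto_mult_right_zero unfolding null_seqs_def by blast
qed (use assms in auto)

lemma null_add: "x \<in> Z \<Longrightarrow> y \<in> Z \<Longrightarrow> (\<lambda>n. x n + y n) \<in> Z"
  unfolding null_seqs_def mem_Collect_eq
proof (rule tendsto_sandwich[OF _ _ tendsto_const])
  assume "(\<lambda>n. N (x n)) \<longlonglongrightarrow> 0" "(\<lambda>n. N (y n)) \<longlonglongrightarrow> 0"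
  then show "(\<lambda>n. N (x n) + N (y n)) \<longlonglongrightarrow> 0" by (rule tendsto_add_zero)
qed (auto simp: tri)

lemma null_minus: "x \<in> Z \<Longrightarrow> (\<lambda>n. - x n) \<in> Z"
  by (erule null_dominated[where K = 1]) simp

lemma null_cauchy: assumes "x \<in> Z" shows "x \<in> carrier C"
proof (rule cauchyI)
  fix e :: real assume "e > 0"
  then have e: "e/2 > 0" by simp
  have "(\<lambda>n. N (x n)) \<longlonglongrightarrow> 0" using assms by (simp add: null_seqs_def)
  from LIMSEQ_D[OF this e] obtain M where M: "\<forall>n\<ge>M. N (x n) < e/2" by auto
  have "N (x m - x n) < e" if "m \<ge> M" "n \<ge> M" for m n
  proof -
    have "N (x m) < e/2" "N (x n) < e/2" using M that by blast+
    then show ?thesis using tri_diff[of "x m" "x n"] by linarith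
  qed
  then show "\<exists>M. \<forall>m\<ge>M. \<forall>n\<ge>M. N (x m - x n) < e" by blast
qed

lemma C_minus: "x \<in> carrier C \<Longrightarrow> \<ominus>\<^bsub>C\<^esub> x = (\<lambda>n. - x n)"
proof -
  interpret ring C by (rule ring_C)
  assume "x \<in> carrier C"
  then show ?thesis by (intro minus_equality) (auto simp: cauchy_minus)
qed

lemma ideal_Z: "ideal Z C"
proof (rule idealI[OF ring_C])
  interpret ring C by (rule ring_C)
  show "subgroup Z (add_monoid C)"
  proof (rule add.subgroupI)
    fix x assume "x \<in> Z"
    then show "\<ominus>\<^bsub>C\<^esub> x \<in> Z" using C_minus null_cauchy null_minus by auto
  next
    have "(\<lambda>n. 0) \<in> Z" by (simp add: null_seqs_def)
    then show "Z \<noteq> {}" by blast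
  qed (auto simp: null_cauchy null_add)
next
  fix a x assume a: "a \<in> Z" and "x \<in> carrier C"
  then obtain K where K: "\<And>n. N (x n) \<le> K" using cauchy_bounded by blast
  show "x \<otimes>\<^bsub>C\<^esub> a \<in> Z" "a \<otimes>\<^bsub>C\<^esub> x \<in> Z"
    by (auto intro!: null_dominated[OF a, where K = K] order_trans[OF N_mult]
        mult_right_mono K simp: mult.commute[of "N (a _)"])
qed

end

context cstar_seminorm begin

lemma seq_class_eq: "seq_class N x = {y. (\<lambda>n. y n - x n) \<in> Z}"
proof -
  have "seq_class N x = (\<Union>z\<in>Z. {\<lambda>n. z n + x n})"
    by (simp add: seq_class_def a_r_coset_def')
  also have "\<dots> = {y. (\<lambda>n. y n - x n) \<in> Z}" (is "?L = ?R")
  proof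
    show "?L \<subseteq> ?R" by auto
    show "?R \<subseteq> ?L"
    proof
      fix y assume "y \<in> ?R"
      moreover have "y = (\<lambda>n. (y n - x n) + x n)" by simp
      ultimately show "y \<in> ?L" by blast
    qed
  qed
  finally show ?thesis .
qed

lemma self_in_class: "x \<in> seq_class N x"
  by (simp add: seq_class_eq null_seqs_def)

lemma class_eqI: assumes "(\<lambda>n. x n - y n) \<in> Z" shows "seq_class N x = seq_class N y"
proof -
  have a: "(\<lambda>n. z n - y n) \<in> Z" if "(\<lambda>n. z n - x n) \<in> Z" for z
    using null_add[OF that assms] by simp
  have b: "(\<lambda>n. z n - x n) \<in> Z" if "(\<lambda>n. z n - y n) \<in> Z" for z
    using null_add[OF that null_minus[OF assms]] by simp
  show ?thesis using a b by (auto simp: seq_class_eq)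
qed

lemma class_eqD: "seq_class N x = seq_class N y \<Longrightarrow> (\<lambda>n. x n - y n) \<in> Z"
  using self_in_class[of x] by (simp add: seq_class_eq[of y])

abbreviation "A \<equiv> completion N"

lemma carrier_A: "carrier A = seq_class N ` carrier C"
  by (auto simp: completion_def Let_def FactRing_def A_RCOSETS_def' seq_class_def)

lemma carrier_AE:
  assumes "x \<in> carrier A" obtains u where "u \<in> carrier C" "x = seq_class N u"
  using assms carrier_A by blast

lemma class_closed: "x \<in> carrier C \<Longrightarrow> seq_class N x \<in> carrier A"
  by (simp add: carrier_A)

lemma class_add: "x \<in> carrier C \<Longrightarrow> y \<in> carrier C \<Longrightarrow>
    seq_class N x \<oplus>\<^bsub>A\<^esub> seq_class N y = seq_class N (\<lambda>n. x n + y n)"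
  using ideal.a_rcos_sum[OF ideal_Z, of x y]
  by (simp add: completion_def Let_def FactRing_def seq_class_def)

lemma class_mult: "x \<in> carrier C \<Longrightarrow> y \<in> carrier C \<Longrightarrow>
    seq_class N x \<otimes>\<^bsub>A\<^esub> seq_class N y = seq_class N (\<lambda>n. x n * y n)"
  using ideal.rcoset_mult_add[OF ideal_Z, of x y]
  by (simp add: completion_def Let_def FactRing_def seq_class_def)

lemma class_one: "\<one>\<^bsub>A\<^esub> = seq_class N (\<lambda>n. 1)"
  by (simp add: completion_def Let_def FactRing_def seq_class_def)

lemma class_zero: "\<zero>\<^bsub>A\<^esub> = seq_class N (\<lambda>n. 0)"
proof -
  have "\<zero>\<^bsub>A\<^esub> = Z" by (simp add: completion_def Let_def FactRing_def)
  then show ?thesis by (auto simp: seq_class_eq)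
qed

lemma class_smult: "c \<odot>\<^bsub>A\<^esub> seq_class N x = seq_class N (\<lambda>n. scale c (x n))"
proof -
  have "seq_class N (\<lambda>n. scale c (y n)) = seq_class N (\<lambda>n. scale c (x n))"
    if "y \<in> seq_class N x" for y
  proof (rule class_eqI)
    have "(\<lambda>n. y n - x n) \<in> Z" using that by (simp add: seq_class_eq)
    then show "(\<lambda>n. scale c (y n) - scale c (x n)) \<in> Z"
      by (rule null_dominated[where K = "cmod c"]) (simp add: N_scale flip: scale_diff_right)
  qed
  then show ?thesis
    unfolding completion_def Let_def cstar.simps module.simps
    by (intro UN_constant_eq[OF self_in_class[of x]]) blast
qed

lemma class_star: "star A (seq_class N x) = seq_class N (\<lambda>n. adjoint (x n))"
proof -
  have "seq_class N (\<lambda>n. adjoint (y n)) = seq_class N (\<lambda>n. adjoint (x n))"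
    if "y \<in> seq_class N x" for y
  proof (rule class_eqI)
    have "(\<lambda>n. y n - x n) \<in> Z" using that by (simp add: seq_class_eq)
    then show "(\<lambda>n. adjoint (y n) - adjoint (x n)) \<in> Z"
      by (rule null_dominated[where K = 1]) (simp flip: adjoint_diff)
  qed
  then show ?thesis
    unfolding completion_def Let_def cstar.simps module.simps
    by (intro UN_constant_eq[OF self_in_class[of x]]) blast
qed

lemma class_cnorm: assumes "x \<in> carrier C"
  shows "(\<lambda>n. N (x n)) \<longlonglongrightarrow> cnorm A (seq_class N x)"
proof -
  obtain l where l: "(\<lambda>n. N (x n)) \<longlonglongrightarrow> l"
    using cauchy_Cauchy_N[OF assms] by (auto simp: convergent_def)
  have "(\<lambda>n. N (y n)) \<longlonglongrightarrow> l" if "y \<in> seq_class N x" for y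
  proof -
    have "(\<lambda>n. N (y n - x n)) \<longlonglongrightarrow> 0" using that by (simp add: seq_class_eq null_seqs_def)
    then have "(\<lambda>n. N (y n) - N (x n)) \<longlonglongrightarrow> 0"
      by (rule metric_tendsto_imp_tendsto) (simp add: N_abs_diff)
    from tendsto_add[OF this l] show ?thesis by simp
  qed
  then have "cnorm A (seq_class N x) = l"
    using self_in_class[of x] LIMSEQ_unique[OF _ l]
    unfolding completion_def Let_def cstar.simps by (intro the_equality) blast+
  then show ?thesis using l by simp
qed

lemma class_cnorm_eqI: "x \<in> carrier C \<Longrightarrow> (\<lambda>n. N (x n)) \<longlonglongrightarrow> l \<Longrightarrow> cnorm A (seq_class N x) = l"
  using LIMSEQ_unique[OF class_cnorm] by blast

lemma ring_A: "ring A"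
proof -
  have "ring (C Quot Z)" by (rule ideal.quotient_is_ring[OF ideal_Z])
  then interpret Q: ring "C Quot Z" .
  have s: "carrier A = carrier (C Quot Z)" "monoid.mult A = monoid.mult (C Quot Z)" "one A = one (C Quot Z)"
    "zero A = zero (C Quot Z)" "add A = add (C Quot Z)"
    by (simp_all add: completion_def Let_def)
  show ?thesis
  proof (rule ringI)
    show "abelian_group A"
    proof (rule abelian_groupI)
      fix x assume "x \<in> carrier A"
      then show "\<exists>y\<in>carrier A. y \<oplus>\<^bsub>A\<^esub> x = \<zero>\<^bsub>A\<^esub>"
        unfolding s using Q.l_neg Q.a_inv_closed by blast
    qed (auto simp: s Q.a_ac)
    show "Group.monoid A" by (rule monoidI) (auto simp: s Q.m_assoc)
  qed (auto simp: s Q.l_distr Q.r_distr)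
qed

lemma class_uminus: assumes "x \<in> carrier C"
  shows "\<ominus>\<^bsub>A\<^esub> seq_class N x = seq_class N (\<lambda>n. - x n)"
proof -
  interpret ring A by (rule ring_A)
  show ?thesis
    by (rule minus_equality) (simp_all add: assms cauchy_minus class_closed class_add class_zero)
qed

lemma class_minus: assumes "x \<in> carrier C" "y \<in> carrier C"
  shows "seq_class N x \<ominus>\<^bsub>A\<^esub> seq_class N y = seq_class N (\<lambda>n. x n - y n)"
  by (simp add: a_minus_def class_uminus assms class_add cauchy_minus)

lemma class_dist: assumes "x \<in> carrier C" "y \<in> carrier C"
  shows "(\<lambda>n. N (x n - y n)) \<longlonglongrightarrow> cnorm A (seq_class N x \<ominus>\<^bsub>A\<^esub> seq_class N y)"
  using class_cnorm[OF cauchy_diff[OF assms]] by (simp add: class_minus assms)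

lemma class_dist_tri: assumes "x \<in> carrier C" "y \<in> carrier C" "z \<in> carrier C"
  shows "cnorm A (seq_class N x \<ominus>\<^bsub>A\<^esub> seq_class N z) \<le>
    cnorm A (seq_class N x \<ominus>\<^bsub>A\<^esub> seq_class N y) + cnorm A (seq_class N y \<ominus>\<^bsub>A\<^esub> seq_class N z)"
  by (rule LIMSEQ_le[OF class_dist tendsto_add[OF class_dist class_dist]])
    (use assms N_diff_tri in auto)

lemma class_dist_commute: assumes "x \<in> carrier C" "y \<in> carrier C"
  shows "cnorm A (seq_class N x \<ominus>\<^bsub>A\<^esub> seq_class N y) = cnorm A (seq_class N y \<ominus>\<^bsub>A\<^esub> seq_class N x)"
  using class_dist[OF assms] class_dist[OF assms(2,1)] LIMSEQ_unique
  by (simp add: N_diff_commute[of "x _" "y _"]) 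

lemma approx_by_const:
  assumes "x \<in> carrier C" "e > 0"
  shows "\<exists>a. cnorm A (seq_class N x \<ominus>\<^bsub>A\<^esub> seq_class N (\<lambda>n. a)) \<le> e"
proof -
  obtain M where M: "\<forall>m\<ge>M. \<forall>n\<ge>M. N (x m - x n) < e" using cauchyD[OF assms] by blast
  have "cnorm A (seq_class N x \<ominus>\<^bsub>A\<^esub> seq_class N (\<lambda>n. x M)) \<le> e"
    by (rule LIMSEQ_le_const2[OF class_dist]) (use assms M in \<open>auto intro!: exI[of _ M] less_imp_le\<close>)
  then show ?thesis by blast
qed

lemma const_dist: "cnorm A (seq_class N (\<lambda>n. a) \<ominus>\<^bsub>A\<^esub> seq_class N (\<lambda>n. b)) = N (a - b)"
  by (simp add: class_minus class_cnorm_eqI)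

lemma complete_A:
  assumes X: "\<And>n::nat. X n \<in> carrier A"
    and XC: "\<forall>e>0. \<exists>M. \<forall>m\<ge>M. \<forall>n\<ge>M. cnorm A (X m \<ominus>\<^bsub>A\<^esub> X n) < e"
  shows "\<exists>L\<in>carrier A. (\<lambda>n. cnorm A (X n \<ominus>\<^bsub>A\<^esub> L)) \<longlonglongrightarrow> 0"
proof -
  let ?d = "\<lambda>x y. cnorm A (seq_class N x \<ominus>\<^bsub>A\<^esub> seq_class N y)"
  have "\<forall>n. \<exists>x. x \<in> carrier C \<and> X n = seq_class N x" using X carrier_A by blast
  then obtain x where x: "\<And>n. x n \<in> carrier C" "\<And>n. X n = seq_class N (x n)" by metis
  have "\<forall>n. \<exists>a. ?d (x n) (\<lambda>k. a) \<le> inverse (real (Suc n))"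
    using approx_by_const[OF x(1)] by simp
  then obtain y where y: "\<And>n. ?d (x n) (\<lambda>k. y n) \<le> inverse (real (Suc n))" by metis
  have lim: "(\<lambda>n. inverse (real (Suc n))) \<longlonglongrightarrow> 0" by (rule LIMSEQ_inverse_real_of_nat)
  have yC: "y \<in> carrier C"
  proof (rule cauchyI)
    fix e :: real assume "e > 0"
    then have e: "e/3 > 0" by simp
    obtain K where K: "\<forall>m\<ge>K. \<forall>n\<ge>K. cnorm A (X m \<ominus>\<^bsub>A\<^esub> X n) < e/3" using XC e by blast
    from LIMSEQ_D[OF lim e] obtain L where L: "\<forall>n\<ge>L. inverse (real (Suc n)) < e/3" by auto
    have "N (y m - y n) < e" if "m \<ge> max K L" "n \<ge> max K L" for m n
    proof -
      have "N (y m - y n) = ?d (\<lambda>k. y m) (\<lambda>k. y n)" by (rule const_dist[symmetric])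
      also have "\<dots> \<le> ?d (\<lambda>k. y m) (x m) + ?d (x m) (\<lambda>k. y n)"
        by (rule class_dist_tri) (simp_all add: x)
      also have "?d (x m) (\<lambda>k. y n) \<le> ?d (x m) (x n) + ?d (x n) (\<lambda>k. y n)"
        by (rule class_dist_tri) (simp_all add: x)
      also have "?d (\<lambda>k. y m) (x m) = ?d (x m) (\<lambda>k. y m)"
        by (rule class_dist_commute) (simp_all add: x)
      finally have "N (y m - y n) \<le> ?d (x m) (\<lambda>k. y m) + (?d (x m) (x n) + ?d (x n) (\<lambda>k. y n))"
        by simp
      moreover have "?d (x m) (x n) < e/3" using K that x(2) by auto
      moreover have "?d (x m) (\<lambda>k. y m) < e/3"
        by (rule le_less_trans[OF y]) (use L that in auto)
      moreover have "?d (x n) (\<lambda>k. y n) < e/3"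
        by (rule le_less_trans[OF y]) (use L that in auto)
      ultimately show ?thesis by linarith
    qed
    then show "\<exists>M. \<forall>m\<ge>M. \<forall>n\<ge>M. N (y m - y n) < e" by blast
  qed
  have nonneg: "0 \<le> ?d u v" if "u \<in> carrier C" "v \<in> carrier C" for u v
    by (rule LIMSEQ_le_const[OF class_dist[OF that]]) auto
  have "(\<lambda>n. ?d (x n) y) \<longlonglongrightarrow> 0"
  proof (rule LIMSEQ_I)
    fix e :: real assume "e > 0"
    then have e: "e/3 > 0" by simp
    obtain K where K: "\<forall>m\<ge>K. \<forall>n\<ge>K. N (y m - y n) < e/3" using cauchyD[OF yC e] by blast
    from LIMSEQ_D[OF lim e] obtain L where L: "\<forall>n\<ge>L. inverse (real (Suc n)) < e/3" by auto
    have "norm (?d (x n) y - 0) < e" if n: "n \<ge> max K L" for n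
    proof -
      have "?d (x n) y \<le> ?d (x n) (\<lambda>k. y n) + ?d (\<lambda>k. y n) y"
        by (rule class_dist_tri) (simp_all add: x yC)
      moreover have "?d (x n) (\<lambda>k. y n) < e/3"
        by (rule le_less_trans[OF y]) (use L n in auto)
      moreover have "?d (\<lambda>k. y n) y \<le> e/3"
        by (rule LIMSEQ_le_const2[OF class_dist])
          (use K n yC in \<open>auto intro!: exI[of _ K] less_imp_le\<close>)
      ultimately show ?thesis using nonneg[OF x(1)[of n] yC] \<open>e > 0\<close> unfolding real_norm_def by linarith
    qed
    then show "\<exists>no. \<forall>n\<ge>no. norm (?d (x n) y - 0) < e" by blast
  qed
  then show ?thesis using class_closed[OF yC] x(2) by auto
qed

theorem cstar_completion: "cstar_algebra A"
proof (intro cstar_algebra.intro ring_A cstar_algebra_axioms.intro)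
  note simps = class_add class_mult class_smult class_star class_zero cauchy_add cauchy_mult cauchy_scale
    cauchy_adjoint class_closed
  note [simp] = simps
  show "c \<odot>\<^bsub>A\<^esub> x \<in> carrier A" if "x \<in> carrier A" for x c using that by (auto simp: carrier_A)
  show "(c + d) \<odot>\<^bsub>A\<^esub> x = c \<odot>\<^bsub>A\<^esub> x \<oplus>\<^bsub>A\<^esub> d \<odot>\<^bsub>A\<^esub> x" if "x \<in> carrier A" for x c d
    using that by (auto simp: carrier_A scale_add_left)
  show "c \<odot>\<^bsub>A\<^esub> (x \<oplus>\<^bsub>A\<^esub> y) = c \<odot>\<^bsub>A\<^esub> x \<oplus>\<^bsub>A\<^esub> c \<odot>\<^bsub>A\<^esub> y" if "x \<in> carrier A" "y \<in> carrier A" for x c y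
    using that by (auto simp: carrier_A scale_add_right)
  show "(c * d) \<odot>\<^bsub>A\<^esub> x = c \<odot>\<^bsub>A\<^esub> (d \<odot>\<^bsub>A\<^esub> x)" if "x \<in> carrier A" for x c d
    using that by (auto simp: carrier_A scale_scale)
  show "1 \<odot>\<^bsub>A\<^esub> x = x" if "x \<in> carrier A" for x using that by (auto simp: carrier_A)
  show "(c \<odot>\<^bsub>A\<^esub> x) \<otimes>\<^bsub>A\<^esub> y = c \<odot>\<^bsub>A\<^esub> (x \<otimes>\<^bsub>A\<^esub> y)" if "x \<in> carrier A" "y \<in> carrier A" for x c y
    using that by (auto simp: carrier_A scale_mult_left)
  show "x \<otimes>\<^bsub>A\<^esub> (c \<odot>\<^bsub>A\<^esub> y) = c \<odot>\<^bsub>A\<^esub> (x \<otimes>\<^bsub>A\<^esub> y)" if "x \<in> carrier A" "y \<in> carrier A" for x c y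
    using that by (auto simp: carrier_A scale_mult_right)
  show "star A x \<in> carrier A" if "x \<in> carrier A" for x using that by (auto simp: carrier_A)
  show "star A (x \<oplus>\<^bsub>A\<^esub> y) = star A x \<oplus>\<^bsub>A\<^esub> star A y" if "x \<in> carrier A" "y \<in> carrier A" for x y
    using that by (auto simp: carrier_A adjoint_add)
  show "star A (c \<odot>\<^bsub>A\<^esub> x) = cnj c \<odot>\<^bsub>A\<^esub> star A x" if "x \<in> carrier A" for x c
    using that by (auto simp: carrier_A adjoint_scale)
  show "star A (x \<otimes>\<^bsub>A\<^esub> y) = star A y \<otimes>\<^bsub>A\<^esub> star A x" if "x \<in> carrier A" "y \<in> carrier A" for x y
    using that by (auto simp: carrier_A adjoint_mult)
  show "star A (star A x) = x" if "x \<in> carrier A" for x using that by (auto simp: carrier_A)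
  show "cnorm A (x \<oplus>\<^bsub>A\<^esub> y) \<le> cnorm A x + cnorm A y" if xy: "x \<in> carrier A" "y \<in> carrier A" for x y
  proof -
    obtain u v where u: "u \<in> carrier C" "x = seq_class N u" and v: "v \<in> carrier C" "y = seq_class N v"
      using carrier_AE[OF xy(1)] carrier_AE[OF xy(2)] by metis
    have "cnorm A (seq_class N (\<lambda>n. u n + v n)) \<le> cnorm A (seq_class N u) + cnorm A (seq_class N v)"
      by (rule LIMSEQ_le[OF class_cnorm[OF cauchy_add[OF u(1) v(1)]]
            tendsto_add[OF class_cnorm[OF u(1)] class_cnorm[OF v(1)]]]) (simp add: tri)
    then show ?thesis using u v by simp
  qed
  show "cnorm A (c \<odot>\<^bsub>A\<^esub> x) = cmod c * cnorm A x" if x: "x \<in> carrier A" for x c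
  proof -
    obtain u where u: "u \<in> carrier C" "x = seq_class N u" by (rule carrier_AE[OF x])
    have "cnorm A (seq_class N (\<lambda>n. scale c (u n))) = cmod c * cnorm A (seq_class N u)"
      using tendsto_mult_left[OF class_cnorm[OF u(1)], of "cmod c"]
      by (intro class_cnorm_eqI cauchy_scale u) (simp only: N_scale)
    then show ?thesis using u by simp
  qed
  show "cnorm A (x \<otimes>\<^bsub>A\<^esub> y) \<le> cnorm A x * cnorm A y" if xy: "x \<in> carrier A" "y \<in> carrier A" for x y
  proof -
    obtain u v where u: "u \<in> carrier C" "x = seq_class N u" and v: "v \<in> carrier C" "y = seq_class N v"
      using carrier_AE[OF xy(1)] carrier_AE[OF xy(2)] by metis
    have "cnorm A (seq_class N (\<lambda>n. u n * v n)) \<le> cnorm A (seq_class N u) * cnorm A (seq_class N v)"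
      by (rule LIMSEQ_le[OF class_cnorm[OF cauchy_mult[OF u(1) v(1)]]
            tendsto_mult[OF class_cnorm[OF u(1)] class_cnorm[OF v(1)]]]) (simp add: N_mult)
    then show ?thesis using u v by simp
  qed
  show "x = \<zero>\<^bsub>A\<^esub>" if x: "x \<in> carrier A" "cnorm A x = 0" for x
  proof -
    obtain u where u: "u \<in> carrier C" "x = seq_class N u" by (rule carrier_AE[OF x(1)])
    then have "u \<in> Z" using class_cnorm[of u] x by (simp add: null_seqs_def)
    then show ?thesis using u class_eqI[of u "\<lambda>n. 0"] by simp
  qed
  show "cnorm A (star A x \<otimes>\<^bsub>A\<^esub> x) = (cnorm A x)\<^sup>2" if x: "x \<in> carrier A" for x
  proof -
    obtain u where u: "u \<in> carrier C" "x = seq_class N u" by (rule carrier_AE[OF x])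
    have "cnorm A (seq_class N (\<lambda>n. adjoint (u n) * u n)) = (cnorm A (seq_class N u))\<^sup>2"
      using tendsto_power[OF class_cnorm[OF u(1)], of 2]
      by (intro class_cnorm_eqI cauchy_mult cauchy_adjoint u) (simp only: N_cstar)
    then show ?thesis using u by simp
  qed
qed (fact complete_A)

end

subsection \<open>Limits and evaluation of *-polynomials in a C*-algebra\<close>

context cstar_algebra begin

lemma smult_zero_left [simp]: assumes "x \<in> carrier A" shows "0 \<odot> x = \<zero>"
proof -
  have "0 \<odot> x \<oplus> 0 \<odot> x = 0 \<odot> x" using smult_add_left[OF assms, of 0 0] by simp
  then show ?thesis using assms smult_closed by (metis add.r_cancel_one')
qed

lemma cnorm_zero [simp]: "cnorm A \<zero> = 0"
  using cnorm_smult[of \<zero> 0] by simp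

lemma smult_minus_one: assumes "x \<in> carrier A" shows "(-1) \<odot> x = \<ominus> x"
proof -
  have "(-1) \<odot> x \<oplus> x = \<zero>" using smult_add_left[OF assms, of "-1" 1] assms by (simp add: smult_one)
  then show ?thesis using assms smult_closed minus_equality by metis
qed

lemma cnorm_uminus [simp]: "x \<in> carrier A \<Longrightarrow> cnorm A (\<ominus> x) = cnorm A x"
  using cnorm_smult[of x "-1"] by (simp add: smult_minus_one)

lemma cnorm_nonneg [simp]: "x \<in> carrier A \<Longrightarrow> 0 \<le> cnorm A x"
  using cnorm_triangle[of x "\<ominus> x"] by (simp add: r_neg)

lemma cnorm_star [simp]: assumes "x \<in> carrier A" shows "cnorm A (star A x) = cnorm A x"
proof -
  have *: "cnorm A x \<le> cnorm A (star A x)" if x: "x \<in> carrier A" for x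
  proof (cases "cnorm A x = 0")
    case True
    then show ?thesis using cnorm_nonneg[OF star_closed[OF x]] by simp
  next
    case False
    have "cnorm A x * cnorm A x \<le> cnorm A (star A x) * cnorm A x"
      using cnorm_mult[OF star_closed[OF x] x] cstar_identity[OF x] by (simp add: power2_eq_square)
    then show ?thesis using False cnorm_nonneg[OF x] by (simp add: mult_le_cancel_right)
  qed
  show ?thesis using *[OF assms] *[OF star_closed[OF assms]] assms by (simp add: star_star)
qed

lemma star_zero [simp]: "star A \<zero> = \<zero>"
  using cnorm_eq_0[OF star_closed[OF zero_closed]] by simp

lemma smult_zero_right [simp]: "c \<odot> \<zero> = \<zero>"
  using cnorm_eq_0[OF smult_closed[OF zero_closed]] cnorm_smult[OF zero_closed] by simp

lemma star_one [simp]: "star A \<one> = \<one>"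
  using star_mult[of "star A \<one>" \<one>] by (simp add: star_star star_closed)

lemma cnorm_minus_commute: "x \<in> carrier A \<Longrightarrow> y \<in> carrier A \<Longrightarrow> cnorm A (x \<ominus> y) = cnorm A (y \<ominus> x)"
  using cnorm_uminus[of "x \<ominus> y"] by (simp add: a_minus_def minus_add a_comm)

definition lim :: "(nat \<Rightarrow> 'a) \<Rightarrow> 'a \<Rightarrow> bool" where
  "lim a L \<longleftrightarrow> L \<in> carrier A \<and> (\<forall>n. a n \<in> carrier A) \<and> (\<lambda>n. cnorm A (a n \<ominus> L)) \<longlonglongrightarrow> 0"

lemma lim_closed: "lim a L \<Longrightarrow> L \<in> carrier A" "lim a L \<Longrightarrow> a n \<in> carrier A"
  and lim_dist: "lim a L \<Longrightarrow> (\<lambda>n. cnorm A (a n \<ominus> L)) \<longlonglongrightarrow> 0"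
  by (simp_all add: lim_def)

lemma lim_const: "x \<in> carrier A \<Longrightarrow> lim (\<lambda>n. x) x"
  by (simp add: lim_def r_neg a_minus_def)

lemma lim_squeeze:
  assumes "\<And>n. b n \<in> carrier A" "M \<in> carrier A" "\<And>n. cnorm A (b n \<ominus> M) \<le> e n" "e \<longlonglongrightarrow> 0"
  shows "lim b M"
  unfolding lim_def
  by (intro conjI allI assms tendsto_sandwich[OF _ _ tendsto_const assms(4)]) (simp_all add: assms)

lemma lim_add: assumes a: "lim a L" and b: "lim b M" shows "lim (\<lambda>n. a n \<oplus> b n) (L \<oplus> M)"
proof (rule lim_squeeze)
  note [simp] = lim_closed[OF a] lim_closed[OF b]
  show "cnorm A (a n \<oplus> b n \<ominus> (L \<oplus> M)) \<le> cnorm A (a n \<ominus> L) + cnorm A (b n \<ominus> M)" for n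
  proof -
    have "a n \<oplus> b n \<ominus> (L \<oplus> M) = (a n \<ominus> L) \<oplus> (b n \<ominus> M)"
      by (simp add: a_minus_def minus_add a_ac)
    then show ?thesis by (simp add: cnorm_triangle)
  qed
  show "(\<lambda>n. cnorm A (a n \<ominus> L) + cnorm A (b n \<ominus> M)) \<longlonglongrightarrow> 0"
    by (intro tendsto_add_zero lim_dist a b)
qed (simp_all add: lim_closed[OF a] lim_closed[OF b])

lemma lim_mult: assumes a: "lim a L" and b: "lim b M" shows "lim (\<lambda>n. a n \<otimes> b n) (L \<otimes> M)"
proof (rule lim_squeeze)
  note [simp] = lim_closed[OF a] lim_closed[OF b]
  let ?e = "\<lambda>n. cnorm A (a n \<ominus> L) * cnorm A (b n \<ominus> M) + (cnorm A (a n \<ominus> L) * cnorm A M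
     + cnorm A L * cnorm A (b n \<ominus> M))"
  show "cnorm A (a n \<otimes> b n \<ominus> (L \<otimes> M)) \<le> ?e n" for n
  proof -
    let ?x = "a n \<ominus> L" and ?y = "b n \<ominus> M"
    have c: "?x \<in> carrier A" "?y \<in> carrier A" by simp_all
    have "a n = ?x \<oplus> L" "b n = ?y \<oplus> M" by (simp_all add: a_minus_def a_assoc l_neg)
    then have "a n \<otimes> b n = (?x \<oplus> L) \<otimes> (?y \<oplus> M)" by simp
    also have "\<dots> = (?x \<otimes> ?y \<oplus> (?x \<otimes> M \<oplus> L \<otimes> ?y)) \<oplus> L \<otimes> M"
      using c by (simp add: l_distr r_distr a_ac)
    finally have "a n \<otimes> b n \<ominus> (L \<otimes> M) = ?x \<otimes> ?y \<oplus> (?x \<otimes> M \<oplus> L \<otimes> ?y)"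
      using c by (simp add: a_minus_def a_assoc r_neg)
    then show ?thesis
      using cnorm_triangle[of "?x \<otimes> ?y" "?x \<otimes> M \<oplus> L \<otimes> ?y"] cnorm_triangle[of "?x \<otimes> M" "L \<otimes> ?y"]
        cnorm_mult[of ?x ?y] cnorm_mult[of ?x M] cnorm_mult[of L ?y] c by simp
  qed
  have "?e \<longlonglongrightarrow> 0 * 0 + (0 * cnorm A M + cnorm A L * 0)"
    by (intro tendsto_add tendsto_mult tendsto_const lim_dist a b)
  then show "?e \<longlonglongrightarrow> 0" by simp
qed (simp_all add: lim_closed[OF a] lim_closed[OF b])

lemma smult_minus: "x \<in> carrier A \<Longrightarrow> c \<odot> (\<ominus> x) = \<ominus> (c \<odot> x)"
  using smult_smult[of x c "-1"] smult_smult[of x "-1" c] by (simp add: smult_minus_one smult_closed)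

lemma star_minus: "x \<in> carrier A \<Longrightarrow> star A (\<ominus> x) = \<ominus> (star A x)"
  using star_smult[of x "-1"] by (simp add: smult_minus_one star_closed)

lemma lim_smult: assumes a: "lim a L" shows "lim (\<lambda>n. c \<odot> a n) (c \<odot> L)"
proof (rule lim_squeeze)
  note [simp] = lim_closed[OF a]
  show "cnorm A (c \<odot> a n \<ominus> c \<odot> L) \<le> cmod c * cnorm A (a n \<ominus> L)" for n
  proof -
    have "c \<odot> a n \<ominus> c \<odot> L = c \<odot> (a n \<ominus> L)"
      by (simp add: a_minus_def smult_add_right smult_minus)
    then show ?thesis by (simp add: cnorm_smult)
  qed
  show "(\<lambda>n. cmod c * cnorm A (a n \<ominus> L)) \<longlonglongrightarrow> 0"
    by (intro tendsto_mult_right_zero lim_dist a)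
qed (simp_all add: lim_closed[OF a] smult_closed)

lemma lim_star: assumes a: "lim a L" shows "lim (\<lambda>n. star A (a n)) (star A L)"
proof (rule lim_squeeze)
  note [simp] = lim_closed[OF a]
  show "cnorm A (star A (a n) \<ominus> star A L) \<le> cnorm A (a n \<ominus> L)" for n
  proof -
    have "star A (a n) \<ominus> star A L = star A (a n \<ominus> L)"
      by (simp add: a_minus_def star_add star_minus)
    then show ?thesis by simp
  qed
qed (simp_all add: lim_closed[OF a] lim_dist[OF a] star_closed)

lemma lim_unique: assumes a: "lim a L" and b: "lim a M" shows "L = M"
proof -
  note [simp] = lim_closed[OF a] lim_closed[OF b]
  have "cnorm A (L \<ominus> M) \<le> cnorm A (a n \<ominus> L) + cnorm A (a n \<ominus> M)" for n
  proof -
    have "L \<ominus> M = (L \<ominus> a n) \<oplus> (a n \<ominus> M)"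
      by (simp add: a_minus_def a_assoc r_neg1)
    then show ?thesis using cnorm_triangle[of "L \<ominus> a n" "a n \<ominus> M"]
      by (simp add: cnorm_minus_commute[of L])
  qed
  moreover have "(\<lambda>n. cnorm A (a n \<ominus> L) + cnorm A (a n \<ominus> M)) \<longlonglongrightarrow> 0"
    by (intro tendsto_add_zero lim_dist a b)
  ultimately have "cnorm A (L \<ominus> M) \<le> 0"
    by (intro LIMSEQ_le_const) auto
  then have "cnorm A (L \<ominus> M) = 0" by (intro antisym cnorm_nonneg) simp_all
  then have "L \<ominus> M = \<zero>" by (intro cnorm_eq_0) simp_all
  then have "(L \<ominus> M) \<oplus> M = M" by simp
  then show ?thesis by (simp add: a_minus_def a_assoc l_neg)
qed


definition eval_letter :: "('g \<Rightarrow> 'a) \<Rightarrow> 'g \<times> bool \<Rightarrow> 'a" where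
  "eval_letter f l = (if snd l then star A (f (fst l)) else f (fst l))"

definition eval_word :: "('g \<Rightarrow> 'a) \<Rightarrow> 'g star_word \<Rightarrow> 'a" where
  "eval_word f w = foldr (\<lambda>l x. eval_letter f l \<otimes> x) (letters w) \<one>"

definition eval_poly :: "('g \<Rightarrow> 'a) \<Rightarrow> 'g free_star \<Rightarrow> 'a" where
  "eval_poly f x = (\<Oplus>w\<in>Poly_Mapping.keys x. Poly_Mapping.lookup x w \<odot> eval_word f w)"

end

locale cstar_evaluation = cstar_algebra A for A :: "('a, 'm) cstar_scheme" (structure) +
  fixes f :: "'g \<Rightarrow> 'a"
  assumes f_closed [simp]: "f g \<in> carrier A"
begin

lemma eval_letter_closed [simp]: "eval_letter f l \<in> carrier A"
  by (simp add: eval_letter_def star_closed)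

lemma foldr_closed [simp]: "x \<in> carrier A \<Longrightarrow> foldr (\<lambda>l x. eval_letter f l \<otimes> x) ls x \<in> carrier A"
  by (induction ls) auto

lemma eval_word_closed [simp]: "eval_word f w \<in> carrier A"
  by (simp add: eval_word_def)

lemma foldr_mult: "x \<in> carrier A \<Longrightarrow>
   foldr (\<lambda>l x. eval_letter f l \<otimes> x) ls x = foldr (\<lambda>l x. eval_letter f l \<otimes> x) ls \<one> \<otimes> x"
  by (induction ls) (auto simp: m_assoc)

lemma eval_word_add: "eval_word f (v + w) = eval_word f v \<otimes> eval_word f w"
  unfolding eval_word_def plus_star_word_def
  by (simp add: foldr_mult[of "foldr _ (letters w) _"])

lemma eval_word_zero [simp]: "eval_word f 0 = \<one>"
  by (simp add: eval_word_def zero_star_word_def)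

lemma eval_letter_word: "eval_word f (Word [l]) = eval_letter f l"
  by (simp add: eval_word_def)

lemma eval_letter_star: "eval_letter f (fst l, \<not> snd l) = star A (eval_letter f l)"
  by (simp add: eval_letter_def star_star)

lemma eval_word_star: "eval_word f (word_star w) = star A (eval_word f w)"
proof -
  have "eval_word f (word_star (Word ls)) = star A (eval_word f (Word ls))" for ls
  proof (induction ls)
    case Nil
    then show ?case by (simp add: eval_word_def word_star_def)
  next
    case (Cons l ls)
    have 1: "Word (l # ls) = Word [l] + Word ls" by (simp add: plus_star_word_def)
    have 2: "word_star (Word [l]) = Word [(fst l, \<not> snd l)]" by (simp add: word_star_def case_prod_unfold)
    show ?case
      unfolding 1 word_star_add eval_word_add 2 Cons eval_letter_word eval_letter_star
      by (simp add: star_mult)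
  qed
  then show ?thesis by (metis star_word.collapse)
qed

lemma eval_superset:
  assumes "finite S" "Poly_Mapping.keys x \<subseteq> S"
  shows "eval_poly f x = (\<Oplus>w\<in>S. Poly_Mapping.lookup x w \<odot> eval_word f w)"
  unfolding eval_poly_def
  by (rule add.finprod_mono_neutral_cong_left) (use assms in \<open>auto simp: smult_closed in_keys_iff\<close>)

lemma eval_closed [simp]: "eval_poly f x \<in> carrier A"
  unfolding eval_poly_def by (rule finsum_closed) (simp add: smult_closed)

lemma eval_add: "eval_poly f (x + y) = eval_poly f x \<oplus> eval_poly f y"
proof -
  let ?S = "Poly_Mapping.keys x \<union> Poly_Mapping.keys y"
  have "eval_poly f (x + y) = (\<Oplus>w\<in>?S. Poly_Mapping.lookup x w \<odot> eval_word f w \<oplus> Poly_Mapping.lookup y w \<odot> eval_word f w)"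
    by (subst eval_superset[of ?S]) (auto simp: keys_add lookup_add smult_add_left)
  also have "\<dots> = (\<Oplus>w\<in>?S. Poly_Mapping.lookup x w \<odot> eval_word f w) \<oplus> (\<Oplus>w\<in>?S. Poly_Mapping.lookup y w \<odot> eval_word f w)"
    by (rule finsum_addf) (auto simp: smult_closed)
  also have "\<dots> = eval_poly f x \<oplus> eval_poly f y"
    by (simp add: eval_superset[of ?S])
  finally show ?thesis .
qed

lemma eval_single: "eval_poly f (Poly_Mapping.single w c) = c \<odot> eval_word f w"
  by (subst eval_superset[of "{w}"]) (auto simp: smult_closed)

lemma eval_scale: "eval_poly f (scale c x) = c \<odot> eval_poly f x"
  by (induction x rule: star_poly_induct)
    (simp_all add: eval_single smult_smult scale_add_right eval_add smult_add_right)

lemma eval_mult: "eval_poly f (x * y) = eval_poly f x \<otimes> eval_poly f y"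
proof (induction x rule: star_poly_induct)
  case (single w c)
  show ?case
    by (induction y rule: star_poly_induct)
      (simp_all add: mult_single eval_single eval_word_add eval_add r_distr distrib_left
        smult_mult_left smult_mult_right smult_closed mult.commute flip: smult_smult)
qed (simp add: distrib_right eval_add l_distr)

lemma eval_adjoint: "eval_poly f (adjoint x) = star A (eval_poly f x)"
  by (induction x rule: star_poly_induct)
    (simp_all add: eval_single eval_word_star star_smult adjoint_add eval_add star_add smult_closed)

lemma eval_one [simp]: "eval_poly f 1 = \<one>"
  unfolding single_one[symmetric] by (subst eval_single) (simp add: smult_one)

lemma eval_gen [simp]: "eval_poly f (gen g) = f g"
  by (simp add: gen_def eval_single eval_word_def eval_letter_def smult_one)

lemma eval_diff: "eval_poly f (x - y) = eval_poly f x \<ominus> eval_poly f y"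
  using eval_scale[of "-1" y] by (simp add: diff_conv_add_uminus eval_add scale_minus_one smult_minus_one a_minus_def del: add_uminus_conv_diff)

lemma eval_seminorm:
  assumes "\<And>r. r \<in> R \<Longrightarrow> eval_poly f r = \<zero>"
  shows "(\<lambda>x. cnorm A (eval_poly f x)) \<in> cstar_seminorms R"
  unfolding cstar_seminorms_def
  using assms by (simp add: eval_add eval_scale eval_mult eval_adjoint cnorm_triangle cnorm_smult
      cnorm_mult cstar_identity)

end

subsection \<open>Existence and universality\<close>

lemma bdd_above_universal:
  assumes "admissible R"
  shows "bdd_above ((\<lambda>p. p x) ` cstar_seminorms R)"
proof -
  have S: "p \<in> cstar_seminorms R \<Longrightarrow> cstar_seminorm p" for p
    by (simp add: cstar_seminorm_def cstar_seminorms_def)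
  have one: "p 1 \<le> 1" if p: "p \<in> cstar_seminorms R" for p
  proof -
    interpret cstar_seminorm p by (rule S[OF p])
    have "p 1 * p 1 = p 1" using N_cstar[of 1] by (simp add: power2_eq_square)
    then show ?thesis by auto
  qed
  have word: "\<exists>K\<ge>0. \<forall>p\<in>cstar_seminorms R. p (Poly_Mapping.single (Word ls) 1) \<le> K" for ls
  proof (induction ls)
    case Nil
    have "Poly_Mapping.single (Word []) 1 = (1 :: 'a free_star)"
      by (simp flip: zero_star_word_def)
    then show ?case using one by (intro exI[of _ 1]) auto
  next
    case (Cons l ls)
    then obtain K where K: "K \<ge> 0" "\<And>p. p \<in> cstar_seminorms R \<Longrightarrow> p (Poly_Mapping.single (Word ls) 1) \<le> K"
      by auto
    obtain g b where l: "l = (g, b)" by (cases l)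
    obtain L where L: "\<And>p. p \<in> cstar_seminorms R \<Longrightarrow> p (gen g) \<le> L"
      using assms unfolding admissible_def bdd_above_def by (meson imageI)
    have "p (Poly_Mapping.single (Word (l # ls)) 1) \<le> max 0 L * K" if p: "p \<in> cstar_seminorms R" for p
    proof -
      interpret cstar_seminorm p by (rule S[OF p])
      have a: "Poly_Mapping.single (Word [l]) 1 = (if b then adjoint (gen g) else gen g)"
        by (simp add: l gen_def word_star_def)
      have b: "p (Poly_Mapping.single (Word [l]) 1) \<le> max 0 L"
        unfolding a using L[OF p] by simp
      have "Poly_Mapping.single (Word (l # ls)) 1
         = Poly_Mapping.single (Word [l]) 1 * (Poly_Mapping.single (Word ls) 1 :: 'a free_star)"
        by (simp add: mult_single plus_star_word_def)
      then have "p (Poly_Mapping.single (Word (l # ls)) 1)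
          \<le> p (Poly_Mapping.single (Word [l]) 1) * p (Poly_Mapping.single (Word ls) 1)"
        by (simp add: N_mult)
      also have "\<dots> \<le> max 0 L * K" by (intro mult_mono b K(2)[OF p]) simp_all
      finally show ?thesis .
    qed
    then show ?case using K by (intro exI[of _ "max 0 L * K"]) auto
  qed
  have "\<exists>K. \<forall>p\<in>cstar_seminorms R. p x \<le> K"
  proof (induction x rule: star_poly_induct)
    case (single w c)
    obtain ls where w: "w = Word ls" by (cases w)
    obtain K where K: "\<And>p. p \<in> cstar_seminorms R \<Longrightarrow> p (Poly_Mapping.single w 1) \<le> K"
      using word[of ls] w by auto
    have "p (Poly_Mapping.single w c) \<le> cmod c * K" if p: "p \<in> cstar_seminorms R" for p
    proof -
      interpret cstar_seminorm p by (rule S[OF p])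
      show ?thesis using N_scale[of c "Poly_Mapping.single w 1"] K[OF p] by (simp add: mult_left_mono)
    qed
    then show ?case by blast
  next
    case (add x y)
    then obtain K L where "\<And>p. p \<in> cstar_seminorms R \<Longrightarrow> p x \<le> K" "\<And>p. p \<in> cstar_seminorms R \<Longrightarrow> p y \<le> L"
      by blast
    then have "p (x + y) \<le> K + L" if "p \<in> cstar_seminorms R" for p
      using cstar_seminorm.tri_le[OF S] that by blast
    then show ?case by blast
  qed
  then show ?thesis by (auto simp: bdd_above_def)
qed

lemma universal_upper:
  assumes "admissible R" "p \<in> cstar_seminorms R" shows "p x \<le> universal_seminorm R x"
  unfolding universal_seminorm_def using bdd_above_universal[OF assms(1)] assms(2) by (rule cSUP_upper2[OF _ _ order_refl])

lemma zero_seminorm: "(\<lambda>x. 0) \<in> cstar_seminorms R"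
  by (simp add: cstar_seminorms_def)

lemma universal_least:
  assumes "\<And>p. p \<in> cstar_seminorms R \<Longrightarrow> p x \<le> K" shows "universal_seminorm R x \<le> K"
  unfolding universal_seminorm_def using zero_seminorm assms by (intro cSUP_least) blast+

lemma universal_seminorm:
  assumes R: "admissible R" shows "universal_seminorm R \<in> cstar_seminorms R"
proof -
  let ?N = "universal_seminorm R"
  note upper = universal_upper[OF R]
  have S: "p \<in> cstar_seminorms R \<Longrightarrow> cstar_seminorm p" for p
    by (simp add: cstar_seminorm_def cstar_seminorms_def)
  have nn: "0 \<le> ?N x" for x using upper[OF zero_seminorm] by simp
  have 1: "?N (x + y) \<le> ?N x + ?N y" for x y
    by (rule universal_least) (metis cstar_seminorm.tri_le[OF S] upper)
  have 2: "?N (scale c x) \<le> cmod c * ?N x" for c x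
    by (rule universal_least) (simp add: cstar_seminorm.N_scale[OF S] upper mult_left_mono)
  have 3: "cmod c * ?N x \<le> ?N (scale c x)" for c x
  proof (cases "c = 0")
    case False
    have "?N x = ?N (scale (inverse c) (scale c x))" using False by (simp add: scale_scale)
    also have "\<dots> \<le> cmod (inverse c) * ?N (scale c x)" by (rule 2)
    finally show ?thesis using False by (simp add: norm_inverse norm_divide field_simps)
  qed (simp add: nn)
  have 4: "?N (x * y) \<le> ?N x * ?N y" for x y
  proof (rule universal_least)
    fix p assume p: "p \<in> cstar_seminorms R"
    interpret cstar_seminorm p by (rule S[OF p])
    show "p (x * y) \<le> ?N x * ?N y"
      by (rule order_trans[OF N_mult mult_mono]) (simp_all add: upper[OF p] nn)
  qed
  have 5: "?N (adjoint x * x) \<le> (?N x)\<^sup>2" for x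
  proof (rule universal_least)
    fix p assume p: "p \<in> cstar_seminorms R"
    interpret cstar_seminorm p by (rule S[OF p])
    show "p (adjoint x * x) \<le> (?N x)\<^sup>2" by (simp add: N_cstar power_mono upper[OF p])
  qed
  have 6: "(?N x)\<^sup>2 \<le> ?N (adjoint x * x)" for x
  proof -
    have "?N x \<le> sqrt (?N (adjoint x * x))"
    proof (rule universal_least)
      fix p assume p: "p \<in> cstar_seminorms R"
      interpret cstar_seminorm p by (rule S[OF p])
      show "p x \<le> sqrt (?N (adjoint x * x))"
        by (rule real_le_rsqrt) (simp add: upper[OF p] flip: N_cstar)
    qed
    then have "(?N x)\<^sup>2 \<le> (sqrt (?N (adjoint x * x)))\<^sup>2" by (intro power_mono nn)
    then show ?thesis by (simp add: nn)
  qed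
  have 7: "?N r = 0" if "r \<in> R" for r
  proof (rule antisym[OF universal_least nn])
    show "p \<in> cstar_seminorms R \<Longrightarrow> p r \<le> 0" for p using that by (auto simp: cstar_seminorms_def)
  qed
  show ?thesis
    unfolding cstar_seminorms_def mem_Collect_eq
    by (intro conjI allI ballI antisym 1 2 3 4 5 6) (simp_all add: 7)
qed

lemma cstar_seminorm_universal: "admissible R \<Longrightarrow> cstar_seminorm (universal_seminorm R)"
  using universal_seminorm by (fastforce simp: cstar_seminorm_def cstar_seminorms_def)

theorem cstar_algebra_universal: "admissible R \<Longrightarrow> cstar_algebra (universal_cstar R)"
  unfolding universal_cstar_def
  by (rule cstar_seminorm.cstar_completion[OF cstar_seminorm_universal])

theorem universal_property:
  fixes f :: "'g \<Rightarrow> 'b" and B :: "('b, 'm) cstar_scheme"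
  assumes R: "admissible R" and B: "cstar_algebra B"
    and f: "\<And>g. f g \<in> carrier B" and rels: "\<And>r. r \<in> R \<Longrightarrow> cstar_algebra.eval_poly B f r = \<zero>\<^bsub>B\<^esub>"
  shows "\<exists>\<phi>\<in>star_hom (universal_cstar R) B. (\<forall>g. \<phi> (universal_gen R g) = f g) \<and>
    (\<forall>x\<in>carrier (universal_cstar R). cnorm B (\<phi> x) \<le> cnorm (universal_cstar R) x)"
proof -
  interpret B: cstar_algebra B by (rule B)
  interpret B: cstar_evaluation B f by unfold_locales (rule f)
  define N where "N = universal_seminorm R"
  interpret N: cstar_seminorm N unfolding N_def by (rule cstar_seminorm_universal[OF R])
  have le: "cnorm B (B.eval_poly f x) \<le> N x" for x
    unfolding N_def using universal_upper[OF R B.eval_seminorm[OF rels]] .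
  let ?e = "\<lambda>u n. B.eval_poly f (u n)"
  have ex: "\<exists>L. B.lim (?e u) L" if u: "u \<in> carrier N.C" for u
  proof -
    have "\<forall>e>0. \<exists>M. \<forall>m\<ge>M. \<forall>n\<ge>M. cnorm B (?e u m \<ominus>\<^bsub>B\<^esub> ?e u n) < e"
    proof (intro allI impI)
      fix e :: real assume "e > 0"
      then obtain M where "\<forall>m\<ge>M. \<forall>n\<ge>M. N (u m - u n) < e" using N.cauchyD[OF u] by blast
      then have "\<forall>m\<ge>M. \<forall>n\<ge>M. cnorm B (?e u m \<ominus>\<^bsub>B\<^esub> ?e u n) < e"
        unfolding B.eval_diff[symmetric] using le_less_trans[OF le] by blast
      then show "\<exists>M. \<forall>m\<ge>M. \<forall>n\<ge>M. cnorm B (?e u m \<ominus>\<^bsub>B\<^esub> ?e u n) < e" by blast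
    qed
    from B.complete[OF B.eval_closed this] show ?thesis by (auto simp: B.lim_def)
  qed
  have indep: "B.lim (?e v) L" if L: "B.lim (?e u) L" and v: "v \<in> seq_class N u" for u v L
  proof -
    have z: "B.lim (\<lambda>n. B.eval_poly f (v n - u n)) \<zero>\<^bsub>B\<^esub>"
    proof (rule B.lim_squeeze)
      show "(\<lambda>n. N (v n - u n)) \<longlonglongrightarrow> 0" using v by (simp add: N.seq_class_eq null_seqs_def)
    qed (simp_all add: le a_minus_def)
    have "v n = (v n - u n) + u n" for n by simp
    then have "?e v = (\<lambda>n. B.eval_poly f (v n - u n) \<oplus>\<^bsub>B\<^esub> ?e u n)"
      using B.eval_add by metis
    then show ?thesis using B.lim_add[OF z L] B.lim_closed(1)[OF L] by simp
  qed
  define \<phi> where "\<phi> X = (THE L. \<exists>u\<in>X. B.lim (?e u) L)" for X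
  have \<phi>_eqI: "\<phi> (seq_class N u) = L" if L: "B.lim (?e u) L" for u L
    unfolding \<phi>_def
  proof (rule the_equality)
    show "\<exists>u\<in>seq_class N u. B.lim (?e u) L" using N.self_in_class L by blast
    show "M = L" if "\<exists>u\<in>seq_class N u. B.lim (?e u) M" for M
      using that indep[OF L] B.lim_unique by blast
  qed
  have \<phi>: "B.lim (?e u) (\<phi> (seq_class N u))" if "u \<in> carrier N.C" for u
    using ex[OF that] \<phi>_eqI by blast
  have "\<phi> \<in> star_hom N.A B"
    unfolding star_hom_def mem_Collect_eq
  proof (intro conjI ballI allI ring_hom_memI)
    fix x y assume x: "x \<in> carrier N.A" and y: "y \<in> carrier N.A"
    obtain u where u: "u \<in> carrier N.C" "x = seq_class N u" by (rule N.carrier_AE[OF x])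
    obtain v where v: "v \<in> carrier N.C" "y = seq_class N v" by (rule N.carrier_AE[OF y])
    show "\<phi> x \<in> carrier B" using B.lim_closed(1)[OF \<phi>[OF u(1)]] u(2) by simp
    show "\<phi> (x \<otimes>\<^bsub>N.A\<^esub> y) = \<phi> x \<otimes>\<^bsub>B\<^esub> \<phi> y"
      using \<phi>_eqI[of "\<lambda>n. u n * v n"] B.lim_mult[OF \<phi>[OF u(1)] \<phi>[OF v(1)]] u v
      by (simp add: N.class_mult B.eval_mult)
    show "\<phi> (x \<oplus>\<^bsub>N.A\<^esub> y) = \<phi> x \<oplus>\<^bsub>B\<^esub> \<phi> y"
      using \<phi>_eqI[of "\<lambda>n. u n + v n"] B.lim_add[OF \<phi>[OF u(1)] \<phi>[OF v(1)]] u v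
      by (simp add: N.class_add B.eval_add)
  next
    show "\<phi> \<one>\<^bsub>N.A\<^esub> = \<one>\<^bsub>B\<^esub>" by (simp add: N.class_one \<phi>_eqI B.lim_const)
  next
    fix c x assume x: "x \<in> carrier N.A"
    obtain u where u: "u \<in> carrier N.C" "x = seq_class N u" by (rule N.carrier_AE[OF x])
    show "\<phi> (c \<odot>\<^bsub>N.A\<^esub> x) = c \<odot>\<^bsub>B\<^esub> \<phi> x"
      using \<phi>_eqI[of "\<lambda>n. scale c (u n)"] B.lim_smult[OF \<phi>[OF u(1)]] u
      by (simp add: N.class_smult B.eval_scale)
  next
    fix x assume x: "x \<in> carrier N.A"
    obtain u where u: "u \<in> carrier N.C" "x = seq_class N u" by (rule N.carrier_AE[OF x])
    show "\<phi> (star N.A x) = star B (\<phi> x)"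
      using \<phi>_eqI[of "\<lambda>n. adjoint (u n)"] B.lim_star[OF \<phi>[OF u(1)]] u
      by (simp add: N.class_star B.eval_adjoint)
  qed
  moreover have "\<phi> (universal_gen R g) = f g" for g
    unfolding universal_gen_def N_def[symmetric] by (rule \<phi>_eqI) (simp add: B.lim_const)
  moreover have "cnorm B (\<phi> x) \<le> cnorm N.A x" if x: "x \<in> carrier N.A" for x
  proof -
    obtain u where u: "u \<in> carrier N.C" "x = seq_class N u" by (rule N.carrier_AE[OF x])
    note L = \<phi>[OF u(1)]
    have "cnorm B (\<phi> (seq_class N u)) \<le> N (u n) + cnorm B (?e u n \<ominus>\<^bsub>B\<^esub> \<phi> (seq_class N u))" for n
    proof -
      have c: "\<phi> (seq_class N u) \<in> carrier B" "?e u n \<in> carrier B" using B.lim_closed(1)[OF L] by simp_all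
      have "\<phi> (seq_class N u) = ?e u n \<oplus>\<^bsub>B\<^esub> (\<phi> (seq_class N u) \<ominus>\<^bsub>B\<^esub> ?e u n)"
        using c by (simp add: a_minus_def B.a_ac B.r_neg B.r_neg1 B.r_neg2)
      then have "cnorm B (\<phi> (seq_class N u)) \<le> cnorm B (?e u n) + cnorm B (\<phi> (seq_class N u) \<ominus>\<^bsub>B\<^esub> ?e u n)"
        using B.cnorm_triangle[of "?e u n" "\<phi> (seq_class N u) \<ominus>\<^bsub>B\<^esub> ?e u n"] c by simp
      then show ?thesis using le[of "u n"] B.cnorm_minus_commute[OF c] by linarith
    qed
    moreover have "(\<lambda>n. N (u n) + cnorm B (?e u n \<ominus>\<^bsub>B\<^esub> \<phi> (seq_class N u))) \<longlonglongrightarrow> cnorm N.A (seq_class N u) + 0"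
      by (intro tendsto_add N.class_cnorm u B.lim_dist L)
    ultimately show ?thesis using u(2) by (intro LIMSEQ_le_const) auto
  qed
  ultimately show ?thesis unfolding universal_cstar_def N_def[symmetric] by blast
qed

theorem universal_eval:
  assumes "admissible R"
  shows "cstar_algebra.eval_poly (universal_cstar R) (universal_gen R) x = seq_class (universal_seminorm R) (\<lambda>n. x)"
proof -
  define N where "N = universal_seminorm R"
  interpret N: cstar_seminorm N unfolding N_def by (rule cstar_seminorm_universal[OF assms])
  have g: "universal_gen R = (\<lambda>g. seq_class N (\<lambda>n. gen g))"
    by (simp add: fun_eq_iff universal_gen_def N_def)
  interpret A: cstar_algebra N.A by (rule N.cstar_completion)
  interpret A: cstar_evaluation N.A "\<lambda>g. seq_class N (\<lambda>n. gen g)"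
    by unfold_locales (simp add: N.class_closed)
  note [simp] = N.class_add N.class_mult N.class_smult N.class_star N.class_one
  have word: "A.eval_word (\<lambda>g. seq_class N (\<lambda>n. gen g)) (Word ls) = seq_class N (\<lambda>n. Poly_Mapping.single (Word ls) 1)"
    for ls
  proof (induction ls)
    case Nil
    have "Poly_Mapping.single (Word []) 1 = (1 :: 'a free_star)"
      by (simp flip: zero_star_word_def)
    then show ?case by (simp add: A.eval_word_def)
  next
    case (Cons l ls)
    have l: "A.eval_letter (\<lambda>g. seq_class N (\<lambda>n. gen g)) l = seq_class N (\<lambda>n. Poly_Mapping.single (Word [l]) 1)"
      by (cases l) (simp add: A.eval_letter_def gen_def word_star_def)
    have 1: "Word (l # ls) = Word [l] + Word ls" by (simp add: plus_star_word_def)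
    show ?case unfolding 1 A.eval_word_add Cons A.eval_letter_word l by (simp add: mult_single)
  qed
  have "A.eval_poly (\<lambda>g. seq_class N (\<lambda>n. gen g)) x = seq_class N (\<lambda>n. x)"
  proof (induction x rule: star_poly_induct)
    case (single w c)
    obtain ls where "w = Word ls" by (cases w)
    then show ?case by (simp add: A.eval_single word)
  qed (simp add: A.eval_add)
  then show ?thesis unfolding universal_cstar_def g N_def .
qed

theorem universal_relations:
  assumes "admissible R" "r \<in> R"
  shows "cstar_algebra.eval_poly (universal_cstar R) (universal_gen R) r = \<zero>\<^bsub>universal_cstar R\<^esub>"
proof -
  interpret N: cstar_seminorm "universal_seminorm R" by (rule cstar_seminorm_universal[OF assms(1)])
  have "universal_seminorm R r = 0"
    using universal_seminorm[OF assms(1)] assms(2) by (simp add: cstar_seminorms_def)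
  then show ?thesis
    unfolding universal_eval[OF assms(1)] unfolding universal_cstar_def N.class_zero
    by (intro N.class_eqI) (simp add: null_seqs_def)
qed

theorem universal_dense:
  assumes "admissible R" "x \<in> carrier (universal_cstar R)" "e > 0"
  shows "\<exists>y. cnorm (universal_cstar R)
    (x \<ominus>\<^bsub>universal_cstar R\<^esub> cstar_algebra.eval_poly (universal_cstar R) (universal_gen R) y) \<le> e"
proof -
  interpret N: cstar_seminorm "universal_seminorm R" by (rule cstar_seminorm_universal[OF assms(1)])
  obtain u where u: "u \<in> carrier N.C" "x = seq_class (universal_seminorm R) u"
    using assms(2) unfolding universal_cstar_def by (rule N.carrier_AE)
  show ?thesis unfolding universal_eval[OF assms(1)]
    using N.approx_by_const[OF u(1) assms(3)] by (simp add: u universal_cstar_def)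
qed

theorem admissible_free_group_rels: "admissible free_group_rels"
  unfolding admissible_def
proof
  fix g
  have "p (gen g) \<le> 1" if p: "p \<in> cstar_seminorms free_group_rels" for p
  proof -
    interpret cstar_seminorm p using p by (simp add: cstar_seminorm_def cstar_seminorms_def)
    have "adjoint (gen g) * gen g - 1 \<in> free_group_rels" by (auto simp: free_group_rels_def)
    then have "p (adjoint (gen g) * gen g - 1) = 0" using p by (simp add: cstar_seminorms_def)
    then have "(p (gen g))\<^sup>2 \<le> p 1"
      using tri[of "adjoint (gen g) * gen g - 1" 1] by (simp add: N_cstar)
    moreover have "p 1 * p 1 = p 1" using N_cstar[of 1] by (simp add: power2_eq_square)
    then have "p 1 \<le> 1" by auto
    ultimately have "(p (gen g))\<^sup>2 \<le> 1\<^sup>2" by simp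
    then show ?thesis by (rule power2_le_imp_le) simp
  qed
  then show "bdd_above ((\<lambda>p. p (gen g)) ` cstar_seminorms free_group_rels)"
    by (auto simp: bdd_above_def)
qed

end

theory Submission
  imports Defs
begin

text \<open>
  The crossed product is the universal C*-algebra \<open>B\<close> of the three symmetries \<open>W\<close>, \<open>UW\<close>, \<open>VW\<close>, i.e. of three
  projections \<open>p\<^sub>1\<close>, \<open>p\<^sub>2\<close>, \<open>p\<^sub>3\<close>. For each \<open>i\<close> the homomorphisms \<open>B \<Rightarrow> M\<^sub>2(B)\<close> that send \<open>p\<^sub>i\<close> to its rotation
  from the first into the second diagonal entry and keep the other \<open>p\<^sub>j\<close> in the first entry form a homotopy.
  With \<open>e\<^sub>S\<close> the endomorphism of \<open>B\<close> that keeps \<open>p\<^sub>j\<close> for \<open>j \<in> S\<close> and kills the others, it shows that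
  \<open>x \<oplus> e\<^sub>\<emptyset>(x)\<close> and the sum of the images of \<open>x\<close> under \<open>e\<^sub>S\<close>, for \<open>S\<close> the complement of \<open>i\<close> and for \<open>S = {i}\<close>,
  have the same class in K-theory (this is Cuntz's argument for free products). Iterating, every class comes
  from the commutative subalgebras generated by a single \<open>p\<^sub>i\<close>, hence from scalar matrices: projections are
  stably classified by their ranks under the four characters of \<open>B\<close> that are nonzero on at most one \<open>p\<^sub>i\<close>,
  and unitaries are stably homotopic to \<open>1\<close>. That \<open>M\<^sub>2(B)\<close> is a C*-algebra rests on the positivity of
  \<open>x\<^sup>* x\<close> and the resulting Cauchy--Schwarz inequality.
\<close>

section \<open>C*-algebras as a type class\<close>

text \<open>Since W U W = U^*, the product U W is self-adjoint with square 1, and U = (U W) W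
  recovers U; likewise for V. So the semidirect product of the free group with Z_2 is a free product
  of three groups of order two. Freeness is what permits the rotation: one projection is conjugated
  by a rotation matrix while the others stay fixed, and the defining relations survive. All
  morphisms are unital, so killing every projection leaves the scalars and not 0. This is the source
  of the terms \<open>e\<^sub>\<emptyset>\<close>, which are carried along and absorbed stably at
  the end. The obstacle is analytic. The rotation takes values in 2 x 2 matrices, and universality
  only speaks of targets that are C*-algebras, so their operator norm has to satisfy the
  C*-identity; hence the chain square roots, order, positivity, inner product inequality. The same
  square roots make *-homomorphisms contractive, which turns paths of generators into continuous
  paths of morphisms. Homotopy then yields equivalence because close projections P, Q are linked by
  Q P (1 - (P - Q)^2)^(-1/2), so matrices near 1 need inverse square roots as well.\<close>

text \<open>The central element \<open>iu\<close> is the imaginary unit: together with the real scalars it carries the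
  complex structure.\<close>

class unital_cstar = real_normed_algebra_1 + banach +
  fixes adj :: "'a \<Rightarrow> 'a" and iu :: 'a
  assumes iu_sq: "iu * iu = - 1"
    and iu_comm: "iu * x = x * iu"
    and adj_add: "adj (x + y) = adj x + adj y"
    and adj_scaleR: "adj (r *\<^sub>R x) = r *\<^sub>R adj x"
    and adj_mult: "adj (x * y) = adj y * adj x"
    and adj_adj [simp]: "adj (adj x) = x"
    and adj_iu [simp]: "adj iu = - iu"
    and norm_adj_mult: "norm (adj x * x) = (norm x)\<^sup>2"

lemma adj_one [simp]: "adj 1 = (1 :: 'a::unital_cstar)"
  by (metis adj_adj adj_mult mult_1_left mult_1_right)

lemma adj_zero [simp]: "adj 0 = (0 :: 'a::unital_cstar)"
  using adj_scaleR[of 0 "0 :: 'a"] by simp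

lemma adj_minus [simp]: "adj (- x) = - adj (x :: 'a::unital_cstar)"
  using adj_scaleR[of "-1" x] by simp

lemma adj_diff: "adj (x - y :: 'a::unital_cstar) = adj x - adj y"
  using adj_add[of x "- y"] by simp

lemma adj_of_real [simp]: "adj (of_real r) = (of_real r :: 'a::unital_cstar)"
  by (simp add: of_real_def adj_scaleR)

lemma adj_sum: "adj (sum f S :: 'a::unital_cstar) = (\<Sum>x\<in>S. adj (f x))"
  by (induction S rule: infinite_finite_induct) (simp_all add: adj_add)

lemma norm_adj [simp]: "norm (adj x) = norm (x :: 'a::unital_cstar)"
proof -
  have *: "norm x \<le> norm (adj x)" for x :: 'a
  proof (cases "x = 0")
    case False
    have "norm x * norm x \<le> norm (adj x) * norm x"
      using norm_mult_ineq[of "adj x" x] unfolding norm_adj_mult power2_eq_square .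
    then show ?thesis using False by simp
  qed simp
  show ?thesis using *[of x] *[of "adj x"] by simp
qed

lemma adj_mult_eq_0: "adj x * x = 0 \<Longrightarrow> x = (0 :: 'a::unital_cstar)"
  using norm_adj_mult[of x] by simp

lemma norm_square: "adj s = s \<Longrightarrow> norm (s * s) = (norm (s :: 'a::unital_cstar))\<^sup>2"
  using norm_adj_mult[of s] by simp


lemma bounded_linear_adj: "bounded_linear (adj :: 'a::unital_cstar \<Rightarrow> 'a)"
  by (rule bounded_linear_intro[where K = 1]) (simp_all add: adj_add adj_scaleR)

lemmas tendsto_adj [tendsto_intros] = bounded_linear.tendsto[OF bounded_linear_adj]
  and continuous_on_adj [continuous_intros] = bounded_linear.continuous_on[OF bounded_linear_adj]

section \<open>Square roots\<close>

text \<open>The iteration for the fixed point \<open>y = (h + y\<^sup>2) / 2\<close>, i.e. \<open>(1 - y)\<^sup>2 = 1 - h\<close>.\<close>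

primrec sqrt_iter :: "'a::real_normed_algebra_1 \<Rightarrow> nat \<Rightarrow> 'a" where
  "sqrt_iter h 0 = 0"
| "sqrt_iter h (Suc n) = (1/2) *\<^sub>R (h + sqrt_iter h n * sqrt_iter h n)"

lemma sqrt_iter_commute: "x * h = h * x \<Longrightarrow> x * sqrt_iter h n = sqrt_iter h n * x"
proof (induction n)
  case (Suc n)
  have "x * (sqrt_iter h n * sqrt_iter h n) = sqrt_iter h n * sqrt_iter h n * x"
    using Suc by (metis mult.assoc)
  then show ?case using Suc.prems by (simp add: distrib_left distrib_right)
qed simp

text \<open>The case h = 1 is the scalar majorant: increasing and bounded by 1, it supplies the
  estimates for every contraction h.\<close>

lemma sqrt_iter_real: "0 \<le> sqrt_iter (1::real) n" "sqrt_iter (1::real) n \<le> 1"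
    "sqrt_iter (1::real) n \<le> sqrt_iter 1 (Suc n)"
proof -
  have *: "0 \<le> sqrt_iter (1::real) n \<and> sqrt_iter (1::real) n \<le> 1 \<and> sqrt_iter (1::real) n \<le> sqrt_iter 1 (Suc n)"
  proof (induction n)
    case (Suc n)
    let ?y = "sqrt_iter (1::real) n"
    have "?y * ?y \<le> 1" using Suc by (simp add: mult_le_one)
    moreover have "?y * ?y \<le> sqrt_iter 1 (Suc n) * sqrt_iter 1 (Suc n)"
      using Suc by (intro mult_mono) auto
    ultimately show ?case using Suc by simp
  qed simp
  then show "0 \<le> sqrt_iter (1::real) n" "sqrt_iter (1::real) n \<le> 1" "sqrt_iter (1::real) n \<le> sqrt_iter 1 (Suc n)"
    by blast+
qed

lemma norm_sqrt_iter:
  assumes "norm h \<le> 1" shows "norm (sqrt_iter h n) \<le> sqrt_iter 1 n"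
proof (induction n)
  case (Suc n)
  have "norm (h + sqrt_iter h n * sqrt_iter h n) \<le> 1 + sqrt_iter 1 n * sqrt_iter 1 n"
    by (intro order_trans[OF norm_triangle_ineq] add_mono assms order_trans[OF norm_mult_ineq]
        mult_mono Suc) (simp_all add: sqrt_iter_real)
  then show ?case by simp
qed simp

text \<open>The iterates are polynomials in \<open>h\<close> with nonnegative coefficients that grow with \<open>n\<close>,
  so their distances are dominated by those of the numerical iterates for \<open>h = 1\<close>.\<close>

lemma norm_sqrt_iter_Suc_diff:
  assumes "norm h \<le> 1"
  shows "norm (sqrt_iter h (Suc n) - sqrt_iter h n) \<le> sqrt_iter 1 (Suc n) - sqrt_iter 1 n"
proof (induction n)
  case 0 then show ?case using assms by simp
next
  case (Suc n)
  let ?a = "sqrt_iter h (Suc n)" and ?b = "sqrt_iter h n"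
  let ?s = "sqrt_iter (1::real) (Suc n)" and ?t = "sqrt_iter (1::real) n"
  have c: "?a * ?b = ?b * ?a"
    by (intro sqrt_iter_commute sqrt_iter_commute[symmetric] refl)
  have "sqrt_iter h (Suc (Suc n)) - ?a = (1/2) *\<^sub>R (?a * ?a - ?b * ?b)"
    unfolding sqrt_iter.simps(2)[of h "Suc n"] sqrt_iter.simps(2)[of h n]
    by (simp add: scaleR_diff_right[symmetric] del: sqrt_iter.simps)
  also have "?a * ?a - ?b * ?b = (?a - ?b) * (?a + ?b)"
    using c by (simp add: algebra_simps del: sqrt_iter.simps)
  finally have "norm (sqrt_iter h (Suc (Suc n)) - ?a) = norm ((?a - ?b) * (?a + ?b)) / 2"
    by (simp del: sqrt_iter.simps)
  also have "norm ((?a - ?b) * (?a + ?b)) \<le> (?s - ?t) * (?s + ?t)"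
    by (rule order_trans[OF norm_mult_ineq], rule mult_mono[OF Suc],
        rule order_trans[OF norm_triangle_ineq], rule add_mono)
      (simp_all add: norm_sqrt_iter[OF assms] sqrt_iter_real del: sqrt_iter.simps)
  also have "(?s - ?t) * (?s + ?t) / 2 = sqrt_iter 1 (Suc (Suc n)) - ?s"
    unfolding sqrt_iter.simps(2)[of 1 "Suc n"] sqrt_iter.simps(2)[of 1 n]
    by (simp add: field_simps del: sqrt_iter.simps)
  finally show ?case by (simp del: sqrt_iter.simps)
qed

text \<open>At norm h = 1 the iteration has no uniform contraction factor, hence no geometric rate.
  Telescoping the increments against the scalar iterates, which converge by monotonicity, still
  gives a Cauchy sequence.\<close>

lemma convergent_sqrt_iter:
  fixes h :: "'a::{real_normed_algebra_1, banach}"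
  assumes "norm h \<le> 1" shows "convergent (sqrt_iter h)"
proof -
  have mono: "incseq (sqrt_iter (1::real))" by (rule incseq_SucI) (rule sqrt_iter_real)
  have "convergent (sqrt_iter (1::real))"
    using incseq_convergent[OF mono, of 1] sqrt_iter_real(2) by (metis convergentI)
  then have S: "Cauchy (sqrt_iter (1::real))" by (rule convergent_Cauchy)
  have le: "norm (sqrt_iter h (n + k) - sqrt_iter h n) \<le> sqrt_iter 1 (n + k) - sqrt_iter 1 n" for n k
  proof (induction k)
    case (Suc k)
    have "norm (sqrt_iter h (Suc (n + k)) - sqrt_iter h n)
      \<le> norm (sqrt_iter h (Suc (n + k)) - sqrt_iter h (n + k)) + norm (sqrt_iter h (n + k) - sqrt_iter h n)"
      by (rule norm_diff_triangle_le[OF order_refl order_refl])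
    then show ?case using Suc norm_sqrt_iter_Suc_diff[OF assms, of "n + k"]
      by (simp del: sqrt_iter.simps)
  qed simp
  have "Cauchy (sqrt_iter h)"
  proof (rule CauchyI')
    fix e :: real assume "0 < e"
    then obtain M where M: "\<And>m n. m \<ge> M \<Longrightarrow> n \<ge> M \<Longrightarrow> norm (sqrt_iter (1::real) m - sqrt_iter 1 n) < e"
      using CauchyD[OF S] by blast
    have "norm (sqrt_iter h m - sqrt_iter h n) < e" if "m \<ge> M" "n > m" for m n
    proof -
      have "norm (sqrt_iter h (m + (n - m)) - sqrt_iter h m) \<le> sqrt_iter 1 (m + (n - m)) - sqrt_iter 1 m"
        by (rule le)
      also have "\<dots> < e" using M[of n m] that by simp
      finally show ?thesis using that by (simp add: norm_minus_commute)
    qed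
    then show "\<exists>M. \<forall>m\<ge>M. \<forall>n>m. dist (sqrt_iter h m) (sqrt_iter h n) < e" unfolding dist_norm by blast
  qed
  then show ?thesis by (rule Cauchy_convergent)
qed

text \<open>1 - y is the square root of 1 - h. Self-adjointness and commutation pass to the limit
  from the iterates, which are real polynomials in h. The bound norm y <= 1 is recorded because it
  later certifies that 1 - y is positive.\<close>

lemma sqrt_one_minus:
  fixes h :: "'a::unital_cstar"
  assumes "norm h \<le> 1" "adj h = h"
  obtains y where "(1 - y) * (1 - y) = 1 - h" "norm y \<le> 1" "adj y = y" "\<And>x. x * h = h * x \<Longrightarrow> x * y = y * x"
proof -
  obtain y where y: "sqrt_iter h \<longlonglongrightarrow> y" using convergent_sqrt_iter[OF assms(1)] by (auto simp: convergent_def)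
  have "(\<lambda>n. sqrt_iter h (Suc n)) \<longlonglongrightarrow> y" using y by (rule LIMSEQ_Suc)
  moreover have "(\<lambda>n. sqrt_iter h (Suc n)) \<longlonglongrightarrow> (1/2) *\<^sub>R (h + y * y)"
    unfolding sqrt_iter.simps by (intro tendsto_intros y)
  ultimately have "y = (1/2) *\<^sub>R (h + y * y)" by (rule LIMSEQ_unique)
  then have "2 *\<^sub>R y = h + y * y" by (metis scaleR_half_double scaleR_2 scaleR_add_right)
  then have 1: "(1 - y) * (1 - y) = 1 - h" by (simp add: algebra_simps scaleR_2)
  have 2: "norm y \<le> 1"
    using norm_sqrt_iter[OF assms(1)] sqrt_iter_real(2)
    by (intro LIMSEQ_le_const2[OF tendsto_norm[OF y]]) (metis order_trans)
  have "adj (sqrt_iter h n) = sqrt_iter h n" for n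
    by (induction n) (simp_all add: adj_scaleR adj_add adj_mult assms)
  then have 3: "adj y = y" using tendsto_adj[OF y] y by (simp add: LIMSEQ_unique)
  have 4: "x * y = y * x" if "x * h = h * x" for x
    using tendsto_mult_left[OF y, of x] tendsto_mult_right[OF y, of x] sqrt_iter_commute[OF that]
    by (simp add: LIMSEQ_unique)
  show thesis by (rule that[OF 1 2 3 4])
qed

section \<open>Elements with commuting real and imaginary parts, and domination of
  C*-seminorms\<close>

lemma iu_iu_mult: "iu * (iu * x) = - (x :: 'a::unital_cstar)"
  by (simp add: iu_sq flip: mult.assoc)

lemma adj_plus_iu:
  fixes s r :: "'a::unital_cstar"
  assumes "adj s = s" "adj r = r" "s * r = r * s"
  shows "adj (s + iu * r) = s - iu * r" "adj (s + iu * r) * (s + iu * r) = s * s + r * r"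
    "(s + iu * r) * adj (s + iu * r) = s * s + r * r"
proof -
  show u: "adj (s + iu * r) = s - iu * r" using assms by (simp add: adj_add adj_mult iu_comm)
  have "iu * r * s = s * (iu * r)" "iu * r * (iu * r) = - (r * r)"
    by (metis assms(3) iu_comm mult.assoc) (metis iu_comm iu_iu_mult mult.assoc)
  then show "adj (s + iu * r) * (s + iu * r) = s * s + r * r" "(s + iu * r) * adj (s + iu * r) = s * s + r * r"
    unfolding u by (simp_all add: algebra_simps)
qed

text \<open>s is the real part of the normal element s + iu r, whose squared norm is |t| by the
  C*-identity, and passing to the real part does not increase the norm. This is the norm form of s^2
  <= t.\<close>

lemma norm_square_le_sum:
  fixes s r :: "'a::unital_cstar"
  assumes "adj s = s" "adj r = r" "s * r = r * s" "s * s + r * r = of_real t"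
  shows "(norm s)\<^sup>2 \<le> \<bar>t\<bar>"
proof -
  let ?u = "s + iu * r"
  have "(norm ?u)\<^sup>2 = \<bar>t\<bar>" using norm_adj_mult[of ?u] adj_plus_iu[OF assms(1-3)] assms(4) by simp
  moreover have "2 *\<^sub>R s = ?u + adj ?u" using adj_plus_iu[OF assms(1-3)] by (simp add: scaleR_2)
  then have "2 * norm s \<le> norm ?u + norm (adj ?u)" by (metis norm_scaleR norm_triangle_ineq abs_numeral)
  then have "norm s \<le> norm ?u" by simp
  ultimately show ?thesis by (metis norm_ge_zero power_mono)
qed

text \<open>A self-adjoint contraction is the real part of a unitary, which bounds it in any C*-seminorm.\<close>

lemma seminorm_le_norm:
  fixes p :: "'a::unital_cstar \<Rightarrow> real"
  assumes tri: "\<And>x y. p (x + y) \<le> p x + p y"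
    and scale: "\<And>r x. p (r *\<^sub>R x) = \<bar>r\<bar> * p x"
    and cstar: "\<And>x. p (adj x * x) = (p x)\<^sup>2"
  shows "p x \<le> norm x"
proof -
  have nonneg: "0 \<le> p x" for x
    using tri[of x "- x"] scale[of "-1" x] scale[of 0 x] by simp
  have "p 1 = (p 1)\<^sup>2" using cstar[of 1] by simp
  then have one: "p 1 \<le> 1" by (cases "p 1 = 0") (simp_all add: power2_eq_square)
  have unitary: "p u \<le> 1" if "adj u * u = 1" for u
  proof -
    have "(p u)\<^sup>2 \<le> 1" using cstar[of u] that one by simp
    then show ?thesis using nonneg[of u] by (simp add: power_le_one_iff)
  qed
  have contraction: "p h \<le> 1" if h: "adj h = h" "norm h \<le> 1" for h
  proof -
    have "norm (h * h) \<le> 1" using h by (simp add: norm_square power_le_one)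
    moreover have "adj (h * h) = h * h" using h by (simp add: adj_mult)
    ultimately obtain y where y: "(1 - y) * (1 - y) = 1 - h * h" "adj y = y"
        "\<And>x. x * (h * h) = h * h * x \<Longrightarrow> x * y = y * x"
      using sqrt_one_minus[of "h * h"] by metis
    \<comment> \<open>\<open>r\<close> is the square root of 1 - h^2. It commutes with h, so h + iu
      r and its adjoint are unitaries with mean h.\<close>
    define r where "r = 1 - y"
    have r: "adj r = r" "h * r = r * h" "h * h + r * r = 1"
      using y(1) y(2) y(3)[of h] by (simp_all add: r_def adj_diff algebra_simps)
    let ?u = "h + iu * r"
    note u = adj_plus_iu[OF h(1) r(1,2)]
    have "p ?u \<le> 1" using u(2) r(3) by (intro unitary) simp
    moreover have "p (adj ?u) \<le> 1" using u(3) r(3) by (intro unitary) simp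
    moreover have "2 *\<^sub>R h = ?u + adj ?u" using u(1) by (simp add: scaleR_2)
    then have "2 * p h \<le> p ?u + p (adj ?u)" using tri[of ?u "adj ?u"] scale[of 2 h] by simp
    ultimately show ?thesis by simp
  qed
  have sa: "p h \<le> norm h" if h: "adj h = h" for h
  proof (cases "h = 0")
    case True then show ?thesis using scale[of 0 h] by simp
  next
    case False
    have "p ((1 / norm h) *\<^sub>R h) \<le> 1" by (rule contraction) (simp_all add: h adj_scaleR)
    then show ?thesis using False by (simp add: scale field_simps)
  qed
  \<comment> \<open>The C*-identity on both sides reduces x to the self-adjoint element
    \<open>adj x * x\<close>.\<close>
  have "(p x)\<^sup>2 \<le> (norm x)\<^sup>2"
    using sa[of "adj x * x"] by (simp add: cstar norm_adj_mult adj_mult)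
  then show ?thesis using norm_ge_zero power2_le_imp_le by blast
qed

section \<open>Positive elements\<close>

text \<open>Positivity means having a self-adjoint square root; the norm criterion
  \<open>pos_if_close\<close> makes it checkable.\<close>

definition pos :: "'a::unital_cstar \<Rightarrow> bool" where
  "pos a \<longleftrightarrow> (\<exists>s. adj s = s \<and> a = s * s)"

lemma pos_adj: "pos a \<Longrightarrow> adj a = a"
  by (auto simp: pos_def adj_mult)

lemma pos_square: "adj s = s \<Longrightarrow> pos (s * s)"
  by (auto simp: pos_def)

lemma pos_scaleR: assumes "pos a" "0 \<le> t" shows "pos (t *\<^sub>R a)"
proof -
  obtain s where s: "adj s = s" "a = s * s" using assms by (auto simp: pos_def)
  have "t *\<^sub>R a = (sqrt t *\<^sub>R s) * (sqrt t *\<^sub>R s)" using assms(2) s by simp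
  then show ?thesis using s(1) by (metis pos_square adj_scaleR)
qed

lemma pos_one: "pos 1"
  using pos_square[of 1] by simp

lemma pos_of_real: "0 \<le> t \<Longrightarrow> pos (of_real t)"
  unfolding of_real_def by (intro pos_scaleR pos_one)

text \<open>A negative t = s^2 would give s^2 + (sqrt (-t))^2 = 0, and then
  \<open>norm_square_le_sum\<close> forces s = 0.\<close>

lemma pos_of_realD: assumes "pos (of_real t :: 'a::unital_cstar)" shows "0 \<le> t"
proof (rule ccontr)
  assume t: "\<not> 0 \<le> t"
  obtain s :: 'a where s: "adj s = s" "of_real t = s * s" using assms by (auto simp: pos_def)
  have e: "s * s + of_real (sqrt (- t)) * of_real (sqrt (- t)) = of_real 0"
    using t by (simp add: s(2)[symmetric] flip: of_real_mult)
  have "s * of_real (sqrt (- t)) = of_real (sqrt (- t)) * s" by (simp add: of_real_def)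
  then have "(norm s)\<^sup>2 \<le> \<bar>0\<bar>" using norm_square_le_sum[OF s(1) adj_of_real _ e] by simp
  then show False using s t by simp
qed

text \<open>Scaling to h = s^2 / t reduces to \<open>sqrt_one_minus\<close>. The root r of t - s^2
  commutes with s, so the second bound is \<open>norm_square_le_sum\<close> with the roles of s and
  r exchanged.\<close>

lemma norm_of_real_diff_square_le:
  fixes s :: "'a::unital_cstar"
  assumes s: "adj s = s" and t: "(norm s)\<^sup>2 \<le> t"
  shows "\<exists>r. adj r = r \<and> of_real t - s * s = r * r" "norm (of_real t - s * s) \<le> t"
proof -
  have "\<exists>r. adj r = r \<and> of_real t - s * s = r * r \<and> s * r = r * s"
  proof (cases "t = 0")
    case True
    then have "s = 0" using t by simp
    then show ?thesis using True by (intro exI[of _ 0]) simp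
  next
    case False
    then have t0: "t > 0" using t by (smt (verit) zero_le_power2)
    let ?h = "(1/t) *\<^sub>R (s * s)"
    have "norm ?h \<le> 1" using t t0 by (simp add: norm_square[OF s])
    moreover have "adj ?h = ?h" by (simp add: adj_scaleR adj_mult s)
    ultimately obtain y where y: "(1 - y) * (1 - y) = 1 - ?h" "adj y = y" "\<And>x. x * ?h = ?h * x \<Longrightarrow> x * y = y * x"
      using sqrt_one_minus by metis
    have "s * y = y * s" by (rule y(3)) (simp add: mult.assoc)
    moreover have "of_real t - s * s = t *\<^sub>R (1 - ?h)" using t0 by (simp add: of_real_def scaleR_diff_right)
    then have "of_real t - s * s = (sqrt t *\<^sub>R (1 - y)) * (sqrt t *\<^sub>R (1 - y))" using t0 y(1) by simp
    ultimately show ?thesis using y(2)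
      by (intro exI[of _ "sqrt t *\<^sub>R (1 - y)"]) (simp add: adj_scaleR adj_diff algebra_simps)
  qed
  then obtain r where r: "adj r = r" "of_real t - s * s = r * r" "s * r = r * s" by blast
  then show "\<exists>r. adj r = r \<and> of_real t - s * s = r * r" by blast
  have "0 \<le> t" using t by (smt (verit) zero_le_power2)
  then show "norm (of_real t - s * s) \<le> t"
    using norm_square_le_sum[of r s t] r s by (simp add: norm_square algebra_simps)
qed

lemma pos_of_real_diff: assumes "pos a" "norm a \<le> t" shows "pos (of_real t - a)" "norm (of_real t - a) \<le> t"
proof -
  obtain s where s: "adj s = s" "a = s * s" using assms by (auto simp: pos_def)
  have "(norm s)\<^sup>2 \<le> t" using assms(2) s norm_square[OF s(1)] by simp
  from norm_of_real_diff_square_le[OF s(1) this] show "pos (of_real t - a)" "norm (of_real t - a) \<le> t"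
    using s(2) by (auto simp: pos_def)
qed

text \<open>The hypothesis on t expresses through the norm that the spectrum of a lies in [0, 2t].
  The root of a = t (1 - h) comes from the contraction h = 1 - a / t. The last conjunct says that
  the root satisfies the same criterion and is therefore positive too.\<close>

lemma pos_sqrt_aux:
  fixes a :: "'a::unital_cstar"
  assumes a: "adj a = a" and t: "norm (of_real t - a) \<le> t"
  shows "\<exists>s. adj s = s \<and> s * s = a \<and> (\<forall>x. x * a = a * x \<longrightarrow> x * s = s * x) \<and> (\<exists>t. norm (of_real t - s) \<le> t)"
proof (cases "t = 0")
  case True
  then have "a = 0" using t by simp
  then show ?thesis by (intro exI[of _ 0]) (auto intro: exI[of _ 0])
next
  case False
  then have t0: "t > 0" using t by (smt (verit) norm_ge_zero)
  let ?h = "(1/t) *\<^sub>R (of_real t - a)"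
  have "norm ?h \<le> 1" using t t0 by simp
  moreover have "adj ?h = ?h" by (simp add: adj_scaleR adj_diff a)
  ultimately obtain y where y: "(1 - y) * (1 - y) = 1 - ?h" "norm y \<le> 1" "adj y = y"
    "\<And>x. x * ?h = ?h * x \<Longrightarrow> x * y = y * x" using sqrt_one_minus by metis
  let ?s = "sqrt t *\<^sub>R (1 - y)"
  have h: "1 - ?h = (1/t) *\<^sub>R a" using t0 by (simp add: of_real_def scaleR_diff_right)
  have "?s * ?s = a" using t0 by (simp add: y(1) h)
  moreover have "x * ?s = ?s * x" if "x * a = a * x" for x
  proof -
    have "x * ?h = ?h * x" using that by (simp add: algebra_simps of_real_def)
    then show ?thesis using y(4) by (simp add: algebra_simps)
  qed
  moreover have "of_real (sqrt t) - ?s = sqrt t *\<^sub>R y" by (simp add: of_real_def algebra_simps)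
  then have "norm (of_real (sqrt t) - ?s) \<le> sqrt t" using y(2) t0 by (simp add: mult_left_le)
  ultimately show ?thesis using y(3) by (intro exI[of _ ?s]) (auto simp: adj_scaleR adj_diff)
qed

lemma pos_if_close: "adj a = a \<Longrightarrow> norm (of_real t - a) \<le> t \<Longrightarrow> pos a"
  using pos_sqrt_aux unfolding pos_def by metis

lemma pos_sqrt:
  assumes "pos a"
  obtains s where "adj s = s" "pos s" "s * s = a" "\<And>x. x * a = a * x \<Longrightarrow> x * s = s * x"
  using pos_sqrt_aux[OF pos_adj[OF assms] pos_of_real_diff(2)[OF assms order_refl]] pos_if_close by metis

text \<open>A sum of two squares shows no square root, but the norm criterion adds up: take t = norm
  a + norm b.\<close>

lemma pos_add: assumes "pos a" "pos b" shows "pos (a + b)"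
proof (rule pos_if_close)
  show "adj (a + b) = a + b" using assms by (simp add: adj_add pos_adj)
  have "of_real (norm a + norm b) - (a + b) = (of_real (norm a) - a) + (of_real (norm b) - b)" by simp
  then show "norm (of_real (norm a + norm b) - (a + b)) \<le> norm a + norm b"
    using pos_of_real_diff(2)[OF assms(1) order_refl] pos_of_real_diff(2)[OF assms(2) order_refl]
    by (metis norm_triangle_mono)
qed

text \<open>a and t - a are squares of commuting self-adjoint elements s and r, so s^2 + r^2 = t and
  \<open>norm_square_le_sum\<close> applies.\<close>

lemma norm_le_of_pos_diff:
  assumes "pos a" "pos (of_real t - a)" shows "norm a \<le> t"
proof -
  have "pos (of_real t :: 'a)" using pos_add[OF assms] by simp
  then have t: "0 \<le> t" by (rule pos_of_realD)
  obtain s where s: "adj s = s" "a = s * s" using assms by (auto simp: pos_def)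
  obtain r where r: "adj r = r" "r * r = of_real t - a"
    "\<And>x. x * (of_real t - a) = (of_real t - a) * x \<Longrightarrow> x * r = r * x" by (metis pos_sqrt[OF assms(2)])
  have "s * (of_real t - a) = (of_real t - a) * s" by (simp add: s algebra_simps of_real_def)
  then have "s * r = r * s" by (rule r(3))
  then have "(norm s)\<^sup>2 \<le> \<bar>t\<bar>" using s r(2) by (intro norm_square_le_sum[OF s(1) r(1)]) simp_all
  then show ?thesis using s t by (simp add: norm_square)
qed

lemma norm_mono: assumes "pos a" "pos (b - a)" shows "norm a \<le> norm b"
proof (rule norm_le_of_pos_diff[OF assms(1)])
  have "pos b" using pos_add[OF assms] by simp
  then have "pos (of_real (norm b) - b + (b - a))" by (intro pos_add pos_of_real_diff assms order_refl)
  then show "pos (of_real (norm b) - a)" by simp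
qed

text \<open>The square roots of commuting elements commute, so a b is the square of the self-adjoint
  element s r.\<close>

lemma pos_mult: assumes "pos a" "pos b" "a * b = b * a" shows "pos (a * b)"
proof -
  obtain s where s: "adj s = s" "s * s = a" "\<And>x. x * a = a * x \<Longrightarrow> x * s = s * x" by (metis pos_sqrt[OF assms(1)])
  obtain r where r: "adj r = r" "r * r = b" "\<And>x. x * b = b * x \<Longrightarrow> x * r = r * x" by (metis pos_sqrt[OF assms(2)])
  have "b * s = s * b" using s(3) assms(3) by simp
  then have c: "s * r = r * s" using r(3) by simp
  then have "a * b = (s * r) * (s * r)" unfolding s(2)[symmetric] r(2)[symmetric] by (metis mult.assoc)
  then show ?thesis using c s r by (metis adj_mult pos_square)
qed

text \<open>Bernoulli's inequality in the operator order. If d is the n-th difference, the next one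
  is d (1 + c) + n c^2, a sum of positive elements because d commutes with c.\<close>

lemma bernoulli_pos:
  fixes c :: "'a::unital_cstar"
  assumes "pos c" shows "pos ((1 + c) ^ n - 1 - of_nat n * c)"
proof (induction n)
  case 0 then show ?case using pos_of_real[of 0] by simp
next
  case (Suc n)
  let ?d = "(1 + c) ^ n - 1 - of_nat n * c"
  have 1: "c * (1 + c) ^ n = (1 + c) ^ n * c" by (rule power_commuting_commutes[symmetric]) (simp add: algebra_simps)
  have 2: "c * (of_nat n * c) = (of_nat n * c) * c" by (metis mult.assoc mult_of_nat_commute)
  have "?d * (1 + c) = (1 + c) * ?d" using 1 2 by (simp add: algebra_simps)
  then have "pos (?d * (1 + c))" by (intro pos_mult Suc pos_add pos_one assms)
  moreover have "pos (real n *\<^sub>R (c * c))" by (intro pos_scaleR pos_square pos_adj assms) simp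
  moreover have "?d * (1 + c) + real n *\<^sub>R (c * c) = (1 + c) ^ Suc n - 1 - of_nat (Suc n) * c"
    using 1 2 by (simp add: algebra_simps scaleR_conv_of_real mult.assoc)
  ultimately show ?case using pos_add by metis
qed

text \<open>If \<open>y\<^sup>* y = - p\<close> with \<open>p \<ge> 0\<close>, then \<open>c = y y\<^sup>*\<close> is positive, and \<open>c (1 + c / r)\<^sup>n\<close>
  is \<open>y (1 - p / r)\<^sup>n y\<^sup>*\<close>, which stays bounded although it dominates \<open>(n / r) c\<^sup>2\<close>.\<close>

lemma neg_adj_mult_pos:
  fixes y :: "'a::unital_cstar"
  assumes p: "pos (- (adj y * y))" shows "y = 0"
proof -
  define p where "p = - (adj y * y)"
  define c where "c = y * adj y"
  \<comment> \<open>r >= norm p makes 1 - p / r a contraction; the summand 1 keeps r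
    positive.\<close>
  define r where "r = norm p + 1"
  have r: "r > 0" by (simp add: r_def add_nonneg_pos)
  \<comment> \<open>h is twice the real part of y and k, up to sign, twice the imaginary part. Their
    squares add up to 2 (c - p), so c is positive as half a sum of squares plus p.\<close>
  define h where "h = y + adj y"
  define k where "k = iu * (y - adj y)"
  have hk: "adj h = h" "adj k = k"
    by (simp_all add: h_def k_def adj_add adj_diff adj_mult iu_comm algebra_simps)
  have "pos (h * h + k * k)" by (intro pos_add pos_square hk)
  moreover have "k * k = - ((y - adj y) * (y - adj y))"
  proof -
    have "k * k = iu * ((y - adj y) * iu) * (y - adj y)" by (simp only: k_def mult.assoc)
    also have "(y - adj y) * iu = iu * (y - adj y)" by (rule iu_comm[symmetric])
    finally show ?thesis by (simp only: mult.assoc iu_iu_mult mult_minus_left)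
  qed
  then have "h * h + k * k = 2 *\<^sub>R (c - p)"
    by (simp add: h_def c_def p_def algebra_simps scaleR_2)
  ultimately have "pos ((1/2) *\<^sub>R (2 *\<^sub>R (c - p)))" by (metis pos_scaleR zero_le_divide_1_iff zero_le_numeral)
  then have "pos (c - p + p)" by (intro pos_add) (use p p_def in auto)
  then have c: "pos c" by simp
  let ?c = "(1/r) *\<^sub>R c" and ?g = "1 - (1/r) *\<^sub>R p"
  have "pos ?c" using c r by (intro pos_scaleR) auto
  have comm: "c * (1 + ?c) ^ n = (1 + ?c) ^ n * c" for n
    by (rule power_commuting_commutes[symmetric]) (simp add: algebra_simps)
  have "norm ?g \<le> 1"
  proof -
    have "norm (of_real r - p) \<le> r" by (rule pos_of_real_diff) (use p in \<open>simp_all add: p_def r_def\<close>)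
    moreover have "?g = (1/r) *\<^sub>R (of_real r - p)" using r by (simp add: of_real_def algebra_simps)
    ultimately show ?thesis using r by simp
  qed
  then have gn: "norm (?g ^ n) \<le> 1" for n
    by (meson norm_ge_zero norm_power_ineq order_trans power_le_one)
  have step: "(1 + ?c) * y = y * ?g" by (simp add: c_def p_def algebra_simps)
  have "(1 + ?c) ^ n * y = y * ?g ^ n" for n
  proof (induction n)
    case (Suc n)
    have "(1 + ?c) ^ Suc n * y = (1 + ?c) * ((1 + ?c) ^ n * y)" by (simp only: power_Suc mult.assoc)
    also have "\<dots> = y * ?g ^ Suc n" unfolding Suc using step by (simp only: power_Suc flip: mult.assoc)
    finally show ?case .
  qed simp
  then have "(1 + ?c) ^ n * c = y * ?g ^ n * adj y" for n unfolding c_def by (metis mult.assoc)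
  moreover have "norm (y * ?g ^ n * adj y) \<le> norm y * 1 * norm y" for n
    by (intro order_trans[OF norm_mult_ineq] mult_mono gn) simp_all
  ultimately have up: "norm ((1 + ?c) ^ n * c) \<le> norm y * norm y" for n by simp
  have "real n * ((1/r) * norm (c * c)) \<le> norm y * norm y" for n
  proof -
    \<comment> \<open>Bernoulli's difference, multiplied by c, bounds (n / r) c^2 by (1 + c / r)^n c
      in the order, hence in norm. As n grows this forces c^2 = 0.\<close>
    let ?d = "(1 + ?c) ^ n - 1 - of_nat n * ?c"
    have nat: "of_nat n * x = real n *\<^sub>R x" for x :: 'a by (simp add: scaleR_conv_of_real)
    have dc: "?d * c = c * ?d"
    proof -
      have "c * (of_nat n * ?c) = of_nat n * ?c * c"  by (simp add: nat)
      then show ?thesis using comm[of n] by (simp add: algebra_simps)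
    qed
    have "pos (?d * c + c)" by (intro pos_add pos_mult bernoulli_pos c dc \<open>pos ?c\<close>)
    moreover have "?d * c + c = (1 + ?c) ^ n * c - (real n * (1/r)) *\<^sub>R (c * c)"
      by (simp add: left_diff_distrib nat)
    moreover have "pos ((real n * (1/r)) *\<^sub>R (c * c))" using r by (intro pos_scaleR pos_square pos_adj c) auto
    ultimately have "norm ((real n * (1/r)) *\<^sub>R (c * c)) \<le> norm ((1 + ?c) ^ n * c)"
      by (metis norm_mono)
    then show ?thesis using up[of n] r by simp
  qed
  then have "\<not> (1/r) * norm (c * c) > 0" using ex_less_of_nat_mult[of "(1/r) * norm (c * c)" "norm y * norm y"]
    by (metis not_less)
  then have "norm (c * c) = 0" using r by (simp add: zero_less_divide_iff)
  then have "c = 0" using norm_square[OF pos_adj[OF c]] by simp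
  then show ?thesis using adj_mult_eq_0[of "adj y"] by (simp add: c_def) (metis adj_adj adj_zero)
qed

text \<open>With a = \<open>adj x * x\<close>, the element m is |a| and b = |a| - a is twice the
  negative part of a. Then \<open>adj (x * b) * (x * b)\<close> equals - b^2 m, so
  \<open>neg_adj_mult_pos\<close> gives x b = 0, hence a b = 0 and b = 0.\<close>

theorem pos_adj_mult: "pos (adj x * x)"
proof -
  define a where "a = adj x * x"
  have a: "adj a = a" by (simp add: a_def adj_mult)
  have "pos (a * a)" by (rule pos_square[OF a])
  then obtain m where m: "adj m = m" "pos m" "m * m = a * a" "\<And>x. x * (a * a) = a * a * x \<Longrightarrow> x * m = m * x"
    by (metis pos_sqrt)
  obtain q where q: "adj q = q" "q * q = m" "\<And>x. x * m = m * x \<Longrightarrow> x * q = q * x" by (metis pos_sqrt[OF m(2)])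
  have am: "a * m = m * a" by (rule m(4)) (simp add: mult.assoc)
  define b where "b = m - a"
  have b: "adj b = b" by (simp add: b_def adj_diff m a)
  have ab: "a * b = - (b * m)" "b * m = m * b" by (simp_all add: b_def algebra_simps am m)
  have bq: "b * q = q * b" by (rule q(3)) (rule ab(2))
  have "adj (x * b) * (x * b) = b * (a * b)" by (simp add: adj_mult b a_def mult.assoc)
  also have "\<dots> = - (b * b * (q * q))" using ab(1) q(2) by (simp add: mult.assoc)
  also have "b * b * (q * q) = (b * q) * (b * q)" by (metis bq mult.assoc)
  finally have "- (adj (x * b) * (x * b)) = (b * q) * (b * q)" by simp
  moreover have "adj (b * q) = b * q" by (simp add: adj_mult b q bq)
  ultimately have "x * b = 0" by (metis neg_adj_mult_pos pos_square)
  then have "a * b = 0" by (simp add: a_def mult.assoc)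
  then have "b * b = 0" using ab by (simp add: b_def algebra_simps)
  then have "b = 0" using b norm_square[OF b] by simp
  then show ?thesis using m(2) by (simp add: b_def a_def)
qed

lemma norm_adj_mult_le_sum: "norm (adj a * a) \<le> norm (adj a * a + adj c * c)"
  by (rule norm_mono) (simp_all add: pos_adj_mult)

text \<open>Cauchy--Schwarz for columns, with inner products in the algebra. For t >= norm A, the
  squared length of the column (a x - t b, c x - t d), increased by
  \<open>adj (r * x) * (r * x)\<close> with r^2 = t - A, collapses to t^2 B - t
  \<open>adj x * x\<close>, which is therefore positive.\<close>

lemma pair_cauchy_schwarz:
  fixes a b c d :: "'a::unital_cstar"
  shows "(norm (adj a * b + adj c * d))\<^sup>2 \<le> norm (adj a * a + adj c * c) * norm (adj b * b + adj d * d)"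
proof -
  define x where "x = adj a * b + adj c * d"
  define A where "A = adj a * a + adj c * c"
  define B where "B = adj b * b + adj d * d"
  have A: "pos A" unfolding A_def by (intro pos_add pos_adj_mult)
  have main: "(norm x)\<^sup>2 \<le> t * norm B" if t: "t > 0" "norm A \<le> t" for t
  proof -
    obtain r where r: "adj r = r" "of_real t - A = r * r"
      using pos_of_real_diff(1)[OF A t(2)] by (auto simp: pos_def)
    let ?u = "a * x - t *\<^sub>R b" and ?v = "c * x - t *\<^sub>R d"
    have "adj (r * x) * (r * x) = adj x * (r * r) * x" by (simp add: adj_mult r mult.assoc)
    then have 1: "adj (r * x) * (r * x) = t *\<^sub>R (adj x * x) - adj x * A * x"
      by (simp add: r(2)[symmetric] algebra_simps of_real_def)
    have 2: "adj b * a + adj d * c = adj x" by (simp add: x_def adj_add adj_mult)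
    have "adj ?u * ?u + adj ?v * ?v
      = adj x * A * x - t *\<^sub>R (adj x * (adj a * b + adj c * d)) - t *\<^sub>R ((adj b * a + adj d * c) * x) + (t * t) *\<^sub>R B"
      by (simp add: adj_diff adj_mult adj_scaleR A_def B_def algebra_simps)
    also have "\<dots> = adj x * A * x - t *\<^sub>R (adj x * x) - t *\<^sub>R (adj x * x) + (t * t) *\<^sub>R B"
      unfolding 2 unfolding x_def[symmetric] ..
    finally have "adj ?u * ?u + adj ?v * ?v + adj (r * x) * (r * x) = (t * t) *\<^sub>R B - t *\<^sub>R (adj x * x)"
      unfolding 1 by (simp only: algebra_simps)
    moreover have "pos (adj ?u * ?u + adj ?v * ?v + adj (r * x) * (r * x))" by (intro pos_add pos_adj_mult)
    ultimately have "pos ((t * t) *\<^sub>R B - t *\<^sub>R (adj x * x))" by (simp only:)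
    then have "norm (t *\<^sub>R (adj x * x)) \<le> norm ((t * t) *\<^sub>R B)"
      using t by (intro norm_mono pos_scaleR pos_adj_mult) auto
    then show ?thesis using t(1) by (simp add: norm_adj_mult)
  qed
  have "(norm x)\<^sup>2 \<le> norm A * norm B"
  proof (cases "A = 0")
    case False then show ?thesis using main[of "norm A"] by simp
  next
    \<comment> \<open>The choice t = norm A needs A nonzero; for A = 0 let t tend to 0.\<close>
    case True
    have "(norm x)\<^sup>2 \<le> inverse (real (Suc n)) * norm B" for n
      using main[of "inverse (real (Suc n))"] True by simp
    moreover have "(\<lambda>n. inverse (real (Suc n)) * norm B) \<longlonglongrightarrow> 0 * norm B"
      by (intro tendsto_mult_right LIMSEQ_inverse_real_of_nat)
    ultimately have "(norm x)\<^sup>2 \<le> 0 * norm B" by (intro LIMSEQ_le_const) auto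
    then show ?thesis using True by simp
  qed
  then show ?thesis by (simp add: x_def A_def B_def)
qed

section \<open>Two by two matrices over a C*-algebra\<close>

datatype 'a m2 = M2 (e11: 'a) (e12: 'a) (e21: 'a) (e22: 'a)

lemma m2_eqI: "e11 x = e11 y \<Longrightarrow> e12 x = e12 y \<Longrightarrow> e21 x = e21 y \<Longrightarrow> e22 x = e22 y \<Longrightarrow> x = y"
  by (cases x, cases y) simp

instantiation m2 :: (unital_cstar) ring_1
begin
definition "0 = M2 0 0 0 0"
definition "1 = M2 1 0 0 1"
definition "x + y = M2 (e11 x + e11 y) (e12 x + e12 y) (e21 x + e21 y) (e22 x + e22 y)"
definition "x - y = M2 (e11 x - e11 y) (e12 x - e12 y) (e21 x - e21 y) (e22 x - e22 y)"
definition "- x = M2 (- e11 x) (- e12 x) (- e21 x) (- e22 x)"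
definition "x * y = M2 (e11 x * e11 y + e12 x * e21 y) (e11 x * e12 y + e12 x * e22 y)
  (e21 x * e11 y + e22 x * e21 y) (e21 x * e12 y + e22 x * e22 y)"
instance
  by standard (simp_all add: zero_m2_def one_m2_def plus_m2_def minus_m2_def uminus_m2_def times_m2_def algebra_simps)
end

instantiation m2 :: (unital_cstar) real_algebra_1
begin
definition "r *\<^sub>R x = M2 (r *\<^sub>R e11 x) (r *\<^sub>R e12 x) (r *\<^sub>R e21 x) (r *\<^sub>R e22 x)"
instance
  by standard (simp_all add: plus_m2_def times_m2_def scaleR_m2_def algebra_simps)
end

lemma m2_simps [simp]:
  "e11 0 = 0" "e12 0 = 0" "e21 0 = 0" "e22 0 = 0"
  "e11 1 = 1" "e12 1 = 0" "e21 1 = 0" "e22 1 = 1"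
  "e11 (x + y) = e11 x + e11 y" "e12 (x + y) = e12 x + e12 y"
  "e21 (x + y) = e21 x + e21 y" "e22 (x + y) = e22 x + e22 y"
  "e11 (x - y) = e11 x - e11 y" "e12 (x - y) = e12 x - e12 y"
  "e21 (x - y) = e21 x - e21 y" "e22 (x - y) = e22 x - e22 y"
  "e11 (- x) = - e11 x" "e12 (- x) = - e12 x" "e21 (- x) = - e21 x" "e22 (- x) = - e22 x"
  "e11 (x * y) = e11 x * e11 y + e12 x * e21 y" "e12 (x * y) = e11 x * e12 y + e12 x * e22 y"
  "e21 (x * y) = e21 x * e11 y + e22 x * e21 y" "e22 (x * y) = e21 x * e12 y + e22 x * e22 y"
  "e11 (r *\<^sub>R x) = r *\<^sub>R e11 x" "e12 (r *\<^sub>R x) = r *\<^sub>R e12 x"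
  "e21 (r *\<^sub>R x) = r *\<^sub>R e21 x" "e22 (r *\<^sub>R x) = r *\<^sub>R e22 x"
  by (simp_all add: zero_m2_def one_m2_def plus_m2_def minus_m2_def uminus_m2_def times_m2_def scaleR_m2_def)

text \<open>The norm of the column (x, y) in the Hilbert module of pairs.\<close>

definition pair_norm :: "'a::unital_cstar \<Rightarrow> 'a \<Rightarrow> real" where
  "pair_norm x y = sqrt (norm (adj x * x + adj y * y))"

definition m2_apply :: "'a::unital_cstar m2 \<Rightarrow> 'a \<times> 'a \<Rightarrow> 'a \<times> 'a" where
  "m2_apply M v = (e11 M * fst v + e12 M * snd v, e21 M * fst v + e22 M * snd v)"

abbreviation vnorm :: "'a::unital_cstar \<times> 'a \<Rightarrow> real" where
  "vnorm v \<equiv> pair_norm (fst v) (snd v)"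

lemma pair_norm_nonneg [simp]: "0 \<le> pair_norm x y"
  by (simp add: pair_norm_def)

lemma pair_norm_square: "(pair_norm x y)\<^sup>2 = norm (adj x * x + adj y * y)"
  by (simp add: pair_norm_def)

lemma pair_norm_inner_le: "norm (adj a * b + adj c * d) \<le> pair_norm a c * pair_norm b d"
  using pair_cauchy_schwarz[of a b c d]
  by (intro power2_le_imp_le[of "norm _"]) (simp_all add: power_mult_distrib pair_norm_square)

lemma pair_norm_triangle: "pair_norm (a + b) (c + d) \<le> pair_norm a c + pair_norm b d"
proof (rule power2_le_imp_le)
  have "adj (a + b) * (a + b) + adj (c + d) * (c + d)
     = (adj a * a + adj c * c) + (adj a * b + adj c * d) + (adj b * a + adj d * c) + (adj b * b + adj d * d)"
    by (simp add: adj_add algebra_simps)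
  then have "(pair_norm (a + b) (c + d))\<^sup>2 \<le> norm (adj a * a + adj c * c) + norm (adj a * b + adj c * d)
      + norm (adj b * a + adj d * c) + norm (adj b * b + adj d * d)"
    unfolding pair_norm_square by (simp add: norm_triangle_le)
  also have "\<dots> \<le> (pair_norm a c)\<^sup>2 + pair_norm a c * pair_norm b d + pair_norm b d * pair_norm a c + (pair_norm b d)\<^sup>2"
    by (intro add_mono pair_norm_inner_le) (simp_all add: pair_norm_square)
  also have "\<dots> = (pair_norm a c + pair_norm b d)\<^sup>2" by (simp add: power2_eq_square algebra_simps)
  finally show "(pair_norm (a + b) (c + d))\<^sup>2 \<le> (pair_norm a c + pair_norm b d)\<^sup>2" .
qed simp

lemma pair_norm_scaleR: "pair_norm (r *\<^sub>R x) (r *\<^sub>R y) = \<bar>r\<bar> * pair_norm x y"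
proof -
  have "adj (r *\<^sub>R x) * (r *\<^sub>R x) + adj (r *\<^sub>R y) * (r *\<^sub>R y) = (r * r) *\<^sub>R (adj x * x + adj y * y)"
    by (simp add: adj_scaleR algebra_simps)
  then show ?thesis by (simp add: pair_norm_def real_sqrt_mult)
qed

lemma pair_norm_simple [simp]: "pair_norm x 0 = norm x" "pair_norm 0 x = norm x"
  by (simp_all add: pair_norm_def norm_adj_mult)

lemma norm_le_pair_norm: "norm x \<le> pair_norm x y" "norm y \<le> pair_norm x y"
proof -
  show "norm x \<le> pair_norm x y"
    unfolding pair_norm_def by (rule real_le_rsqrt) (metis norm_adj_mult norm_adj_mult_le_sum)
  show "norm y \<le> pair_norm x y"
    unfolding pair_norm_def by (rule real_le_rsqrt) (metis norm_adj_mult norm_adj_mult_le_sum add.commute)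
qed

lemma pair_norm_le: "pair_norm x y \<le> norm x + norm y"
  using pair_norm_triangle[of x 0 0 y] by simp

instantiation m2 :: (unital_cstar) real_normed_algebra_1
begin

text \<open>The operator norm on columns, chosen because it satisfies the C*-identity. Comparison
  with the sum of the norms of the entries gives completeness.\<close>

definition "norm M = (SUP v\<in>{v. vnorm v \<le> 1}. vnorm (m2_apply M v))"
definition "sgn (x :: 'a m2) = x /\<^sub>R norm x"
definition "dist (x :: 'a m2) y = norm (x - y)"
definition "(uniformity :: ('a m2 \<times> 'a m2) filter) = (INF e\<in>{0 <..}. principal {(x, y). dist x y < e})"
definition "open (U :: 'a m2 set) \<longleftrightarrow> (\<forall>x\<in>U. \<forall>\<^sub>F (x', y) in uniformity. x' = x \<longrightarrow> y \<in> U)"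

lemma m2_apply_le_sum: "vnorm (m2_apply M v) \<le> (norm (e11 M) + norm (e12 M) + norm (e21 M) + norm (e22 M)) * vnorm v"
proof -
  have "vnorm (m2_apply M v) \<le> norm (e11 M * fst v + e12 M * snd v) + norm (e21 M * fst v + e22 M * snd v)"
    by (simp add: m2_apply_def pair_norm_le)
  also have "\<dots> \<le> (norm (e11 M) * vnorm v + norm (e12 M) * vnorm v) + (norm (e21 M) * vnorm v + norm (e22 M) * vnorm v)"
    by (intro add_mono order_trans[OF norm_triangle_ineq] order_trans[OF norm_mult_ineq] mult_left_mono norm_le_pair_norm)
      simp_all
  finally show ?thesis by (simp add: algebra_simps)
qed

lemma bdd_m2_apply: "bdd_above ((\<lambda>v. vnorm (m2_apply M v)) ` {v. vnorm v \<le> 1})"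
proof -
  let ?K = "norm (e11 M) + norm (e12 M) + norm (e21 M) + norm (e22 M)"
  have "vnorm (m2_apply M v) \<le> ?K" if "vnorm v \<le> 1" for v
    using order_trans[OF m2_apply_le_sum mult_left_mono[OF that, of ?K]] by simp
  then show ?thesis by (intro bdd_aboveI2[where M = ?K]) simp
qed

lemma m2_norm_le:
  assumes "\<And>v. vnorm (m2_apply M v) \<le> K * vnorm v" "0 \<le> K"
  shows "norm M \<le> K"
  unfolding norm_m2_def
proof (rule cSUP_least)
  show "{v :: 'a \<times> 'a. vnorm v \<le> 1} \<noteq> {}" by (auto intro!: exI[of _ 0])
  show "vnorm (m2_apply M v) \<le> K" if "v \<in> {v. vnorm v \<le> 1}" for v
    using order_trans[OF assms(1) mult_left_mono[OF _ assms(2)]] that by (metis mem_Collect_eq mult.right_neutral)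
qed

lemma m2_norm_nonneg: "0 \<le> norm (M :: 'a m2)"
  unfolding norm_m2_def by (rule cSUP_upper2[OF bdd_m2_apply, of "(0, 0)"]) simp_all

lemma m2_apply_le: "vnorm (m2_apply M v) \<le> norm M * vnorm v"
proof (cases "vnorm v = 0")
  case True
  then show ?thesis using m2_apply_le_sum[of M v] by simp
next
  case False
  then have p: "vnorm v > 0" using pair_norm_nonneg[of "fst v" "snd v"] by linarith
  let ?r = "1 / vnorm v"
  let ?v = "(?r *\<^sub>R fst v, ?r *\<^sub>R snd v)"
  have "vnorm ?v = ?r * vnorm v" using pair_norm_scaleR[of ?r "fst v" "snd v"] p by simp
  then have "vnorm ?v \<le> 1" using p by simp
  then have "vnorm (m2_apply M ?v) \<le> norm M"
    unfolding norm_m2_def by (intro cSUP_upper[OF _ bdd_m2_apply]) simp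
  moreover have "m2_apply M ?v = (?r *\<^sub>R fst (m2_apply M v), ?r *\<^sub>R snd (m2_apply M v))"
    by (simp add: m2_apply_def scaleR_add_right)
  then have "vnorm (m2_apply M ?v) = ?r * vnorm (m2_apply M v)"
    using pair_norm_scaleR[of ?r "fst (m2_apply M v)" "snd (m2_apply M v)"] p by simp
  ultimately show ?thesis using p by (simp add: field_simps)
qed

lemma norm_m2_entries:
  "norm (e11 M) \<le> norm M" "norm (e12 M) \<le> norm M" "norm (e21 M) \<le> norm M" "norm (e22 M) \<le> norm M"
proof -
  have 1: "pair_norm (e11 M) (e21 M) \<le> norm M" using m2_apply_le[of M "(1, 0)"] by (simp add: m2_apply_def)
  have 2: "pair_norm (e12 M) (e22 M) \<le> norm M" using m2_apply_le[of M "(0, 1)"] by (simp add: m2_apply_def)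
  show "norm (e11 M) \<le> norm M" "norm (e21 M) \<le> norm M" using norm_le_pair_norm 1 by (meson order_trans)+
  show "norm (e12 M) \<le> norm M" "norm (e22 M) \<le> norm M" using norm_le_pair_norm 2 by (meson order_trans)+
qed

lemma norm_m2_le_sum: "norm M \<le> norm (e11 M) + norm (e12 M) + norm (e21 M) + norm (e22 M)"
  by (rule m2_norm_le[OF m2_apply_le_sum]) simp

instance
proof
  fix M N :: "'a m2" and r :: real and U :: "'a m2 set"
  show "dist M N = norm (M - N)" by (rule dist_m2_def)
  show "sgn M = M /\<^sub>R norm M" by (rule sgn_m2_def)
  show "(uniformity :: ('a m2 \<times> 'a m2) filter) = (INF e\<in>{0 <..}. principal {(x, y). dist x y < e})"
    by (rule uniformity_m2_def)
  show "open U \<longleftrightarrow> (\<forall>x\<in>U. \<forall>\<^sub>F (x', y) in uniformity. x' = x \<longrightarrow> y \<in> U)" by (rule open_m2_def)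
  show "norm M = 0 \<longleftrightarrow> M = 0"
  proof
    assume "norm M = 0"
    then show "M = 0" using norm_m2_entries[of M] by (intro m2_eqI) simp_all
  next
    assume "M = 0"
    then show "norm M = 0" using norm_m2_le_sum[of M] m2_norm_nonneg[of M] by simp
  qed
  show "norm (M + N) \<le> norm M + norm N"
  proof (rule m2_norm_le)
    fix v
    have "vnorm (m2_apply (M + N) v) \<le> vnorm (m2_apply M v) + vnorm (m2_apply N v)"
    proof -
      have "fst (m2_apply (M + N) v) = fst (m2_apply M v) + fst (m2_apply N v)"
          "snd (m2_apply (M + N) v) = snd (m2_apply M v) + snd (m2_apply N v)"
        by (simp_all add: m2_apply_def algebra_simps)
      then show ?thesis using pair_norm_triangle by metis
    qed
    also have "\<dots> \<le> norm M * vnorm v + norm N * vnorm v" by (intro add_mono m2_apply_le)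
    finally show "vnorm (m2_apply (M + N) v) \<le> (norm M + norm N) * vnorm v" by (simp add: algebra_simps)
  qed (simp add: m2_norm_nonneg)
  have scale_le: "norm (r *\<^sub>R M) \<le> \<bar>r\<bar> * norm M" for r and M :: "'a m2"
  proof (rule m2_norm_le)
    fix v
    have "m2_apply (r *\<^sub>R M) v = (r *\<^sub>R fst (m2_apply M v), r *\<^sub>R snd (m2_apply M v))"
      by (simp add: m2_apply_def algebra_simps)
    then have "vnorm (m2_apply (r *\<^sub>R M) v) = \<bar>r\<bar> * vnorm (m2_apply M v)" using pair_norm_scaleR by simp
    also have "\<dots> \<le> \<bar>r\<bar> * (norm M * vnorm v)" by (intro mult_left_mono m2_apply_le) simp
    finally show "vnorm (m2_apply (r *\<^sub>R M) v) \<le> \<bar>r\<bar> * norm M * vnorm v" by (simp add: algebra_simps)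
  qed (simp add: m2_norm_nonneg)
  show "norm (r *\<^sub>R M) = \<bar>r\<bar> * norm M"
  proof (cases "r = 0")
    case True then show ?thesis using scale_le[of 0 M] m2_norm_nonneg[of "0 *\<^sub>R M"] by simp
  next
    case False
    then have "norm M \<le> \<bar>inverse r\<bar> * norm (r *\<^sub>R M)" using scale_le[of "inverse r" "r *\<^sub>R M"] by simp
    then have "\<bar>r\<bar> * norm M \<le> norm (r *\<^sub>R M)" using False by (simp add: field_simps)
    then show ?thesis using scale_le[of r M] by simp
  qed
  show "norm (M * N) \<le> norm M * norm N"
  proof (rule m2_norm_le)
    fix v
    have "m2_apply (M * N) v = m2_apply M (m2_apply N v)"
      by (simp add: m2_apply_def algebra_simps)
    then have "vnorm (m2_apply (M * N) v) \<le> norm M * vnorm (m2_apply N v)" by (simp add: m2_apply_le)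
    also have "\<dots> \<le> norm M * (norm N * vnorm v)" by (intro mult_left_mono m2_apply_le m2_norm_nonneg)
    finally show "vnorm (m2_apply (M * N) v) \<le> norm M * norm N * vnorm v" by (simp add: algebra_simps)
  qed (simp add: m2_norm_nonneg)
  show "norm (1 :: 'a m2) = 1"
  proof (rule antisym)
    show "norm (1 :: 'a m2) \<le> 1" by (rule m2_norm_le) (simp_all add: m2_apply_def)
    show "1 \<le> norm (1 :: 'a m2)" using norm_m2_entries(1)[of "1 :: 'a m2"] by simp
  qed
qed

end

instance m2 :: (unital_cstar) banach
proof
  fix X :: "nat \<Rightarrow> 'a m2"
  assume C: "Cauchy X"
  have *: "convergent (\<lambda>n. f (X n))" if "\<And>M N. f (M - N) = f M - f N" "\<And>M. norm (f M) \<le> norm M"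
    for f :: "'a m2 \<Rightarrow> 'a"
  proof (rule Cauchy_convergent, rule CauchyI)
    fix e :: real assume "0 < e"
    then obtain K where "\<forall>m\<ge>K. \<forall>n\<ge>K. norm (X m - X n) < e" using CauchyD[OF C] by blast
    then show "\<exists>K. \<forall>m\<ge>K. \<forall>n\<ge>K. norm (f (X m) - f (X n)) < e" using that by (metis le_less_trans)
  qed
  obtain a b c d where l: "(\<lambda>n. e11 (X n)) \<longlonglongrightarrow> a" "(\<lambda>n. e12 (X n)) \<longlonglongrightarrow> b"
      "(\<lambda>n. e21 (X n)) \<longlonglongrightarrow> c" "(\<lambda>n. e22 (X n)) \<longlonglongrightarrow> d"
    using *[of e11] *[of e12] *[of e21] *[of e22] norm_m2_entries by (auto simp: convergent_def)
  let ?L = "M2 a b c d"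
  have "(\<lambda>n. norm (e11 (X n) - a) + norm (e12 (X n) - b)
      + norm (e21 (X n) - c) + norm (e22 (X n) - d)) \<longlonglongrightarrow> 0 + 0 + 0 + 0"
    by (intro tendsto_add tendsto_norm_zero l[THEN LIM_zero])
  then have lim: "(\<lambda>n. norm (e11 (X n) - a) + norm (e12 (X n) - b)
      + norm (e21 (X n) - c) + norm (e22 (X n) - d)) \<longlonglongrightarrow> 0" by simp
  have "(\<lambda>n. norm (X n - ?L)) \<longlonglongrightarrow> 0"
    using norm_m2_le_sum[of "X _ - ?L"] by (intro tendsto_sandwich[OF _ _ tendsto_const lim]) auto
  then have "X \<longlonglongrightarrow> ?L" by (simp add: tendsto_norm_zero_iff LIM_zero_iff)
  then show "convergent X" by (rule convergentI)
qed

instantiation m2 :: (unital_cstar) unital_cstar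
begin
definition "adj M = M2 (adj (e11 M)) (adj (e21 M)) (adj (e12 M)) (adj (e22 M))"
definition "iu = M2 iu 0 0 iu"

lemma m2_adj_simps [simp]:
  "e11 (adj M) = adj (e11 M)" "e12 (adj M) = adj (e21 M)" "e21 (adj M) = adj (e12 M)" "e22 (adj M) = adj (e22 M)"
  "e11 iu = iu" "e12 iu = 0" "e21 iu = 0" "e22 iu = iu"
  by (simp_all add: adj_m2_def iu_m2_def)

instance
proof
  fix M N :: "'a m2" and r :: real
  show "iu * iu = (- 1 :: 'a m2)" by (rule m2_eqI) (simp_all add: iu_sq)
  show "iu * M = M * iu" by (rule m2_eqI) (simp_all add: iu_comm)
  show "adj (M + N) = adj M + adj N" by (rule m2_eqI) (simp_all add: adj_add)
  show "adj (r *\<^sub>R M) = r *\<^sub>R adj M" by (rule m2_eqI) (simp_all add: adj_scaleR)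
  show "adj (M * N) = adj N * adj M" by (rule m2_eqI) (simp_all add: adj_add adj_mult)
  show "adj (adj M) = M" by (rule m2_eqI) simp_all
  show "adj iu = (- iu :: 'a m2)" by (rule m2_eqI) simp_all
  have le: "(norm M)\<^sup>2 \<le> norm (adj M * M)" for M :: "'a m2"
  proof -
    have "norm M \<le> sqrt (norm (adj M * M))"
    proof (rule m2_norm_le)
      fix v
      let ?w = "m2_apply (adj M * M) v"
      \<comment> \<open>This is <M v, M v> = <v, M^* M v> for the inner product with values in the
        algebra; Cauchy--Schwarz then bounds the right side.\<close>
      have "adj (fst (m2_apply M v)) * fst (m2_apply M v) + adj (snd (m2_apply M v)) * snd (m2_apply M v)
        = adj (fst v) * fst ?w + adj (snd v) * snd ?w"
        by (simp add: m2_apply_def adj_add adj_mult algebra_simps)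
      then have "(vnorm (m2_apply M v))\<^sup>2 \<le> vnorm v * vnorm ?w"
        unfolding pair_norm_square by (simp add: pair_norm_inner_le)
      also have "\<dots> \<le> vnorm v * (norm (adj M * M) * vnorm v)" by (intro mult_left_mono m2_apply_le) simp
      also have "\<dots> = (sqrt (norm (adj M * M)) * vnorm v)\<^sup>2"
        by (simp add: power_mult_distrib power2_eq_square[of "vnorm v"])
      finally show "vnorm (m2_apply M v) \<le> sqrt (norm (adj M * M)) * vnorm v"
        by (rule power2_le_imp_le) simp
    qed simp
    then have "(norm M)\<^sup>2 \<le> (sqrt (norm (adj M * M)))\<^sup>2" by (rule power_mono) simp
    then show ?thesis by simp
  qed
  have adj_le: "norm M \<le> norm (adj M)" for M :: "'a m2"
  proof (cases "M = 0")
    case False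
    have "norm M * norm M \<le> norm (adj M) * norm M"
      using le[of M] norm_mult_ineq[of "adj M" M] by (simp add: power2_eq_square)
    then show ?thesis using False by simp
  qed simp
  have "adj (adj M) = M" by (rule m2_eqI) simp_all
  then have "norm (adj M) = norm M" using adj_le[of M] adj_le[of "adj M"] by simp
  then show "norm (adj M * M) = (norm M)\<^sup>2"
    using le[of M] norm_mult_ineq[of "adj M" M] by (simp add: power2_eq_square)
qed

end

section \<open>Complex scalars and *-homomorphisms\<close>

text \<open>The class has real scalars; this embeds the complex numbers as a central subalgebra,
  with the class constant \<open>iu\<close> as i.\<close>

definition cs :: "complex \<Rightarrow> 'a::unital_cstar" where
  "cs c = of_real (Re c) + of_real (Im c) * iu"

lemma cs_add: "cs (c + d) = cs c + cs d"
  by (simp add: cs_def algebra_simps)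

lemma cs_comm: "cs c * x = x * cs c"
proof -
  have "of_real r * x = x * (of_real r :: 'a)" for r by (simp add: of_real_def)
  moreover have "of_real r * iu * x = x * (of_real r * (iu :: 'a))" for r
    by (simp add: of_real_def) (metis iu_comm)
  ultimately show ?thesis by (simp add: cs_def distrib_left distrib_right)
qed

lemma cs_times: "cs (c * d) = (cs c * cs d :: 'a::unital_cstar)"
  by (simp add: cs_def of_real_def iu_sq algebra_simps)

lemma cs_simps [simp]: "cs 0 = 0" "cs 1 = 1" "cs (- c) = - cs c" "cs (of_real r) = of_real r"
  by (simp_all add: cs_def)

lemma cs_adj: "adj (cs c) = cs (cnj c)"
  by (simp add: cs_def adj_add adj_mult) (simp add: of_real_def)

lemma norm_cs_mult: "norm (cs c * x) = cmod c * norm x"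
proof -
  have "adj (cs c * x) * (cs c * x) = adj x * (cs (cnj c) * cs c) * x" by (simp add: adj_mult cs_adj mult.assoc)
  also have "cs (cnj c) * cs c = (of_real ((cmod c)\<^sup>2) :: 'a)"
    unfolding cs_times[symmetric] by (simp only: complex_norm_square[symmetric] mult.commute[of "cnj c"] flip: cs_simps(4))
  finally have "adj (cs c * x) * (cs c * x) = (cmod c)\<^sup>2 *\<^sub>R (adj x * x)" by (simp add: of_real_def)
  then have "(norm (cs c * x))\<^sup>2 = (cmod c * norm x)\<^sup>2"
    by (simp add: norm_adj_mult[symmetric] power_mult_distrib)
  then show ?thesis by (simp add: power2_eq_iff_nonneg)
qed

lemma norm_cs [simp]: "norm (cs c :: 'a::unital_cstar) = cmod c"
  using norm_cs_mult[of c "1 :: 'a"] by simp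

lemma bounded_linear_cs: "bounded_linear (cs :: complex \<Rightarrow> 'a::unital_cstar)"
proof (rule bounded_linear_intro[where K = 1])
  show "cs (r *\<^sub>R x) = (r *\<^sub>R cs x :: 'a)" for r x
    by (simp add: scaleR_conv_of_real cs_times)
qed (simp_all add: cs_add)

lemmas continuous_on_cs [continuous_intros] = bounded_linear.continuous_on[OF bounded_linear_cs]

instantiation complex :: unital_cstar
begin
definition "adj_complex = cnj"
definition "iu_complex = \<i>"
instance
  by standard (simp_all add: adj_complex_def iu_complex_def norm_mult power2_eq_square)
end

lemma cs_complex [simp]: "cs c = c"
  by (simp add: cs_def iu_complex_def complex_eq_iff)

text \<open>Packs a typed algebra as a record, so that it can be the target of the universal
  property, which is stated for records.\<close>

definition cstar_rec :: "'a::unital_cstar cstar" where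
  "cstar_rec = \<lparr>carrier = UNIV, monoid.mult = (*), one = 1, zero = 0, add = (+),
     smult = (\<lambda>c x. cs c * x), star = adj, cnorm = norm\<rparr>"

lemma cstar_rec_simps [simp]:
  "carrier cstar_rec = UNIV" "x \<otimes>\<^bsub>cstar_rec\<^esub> y = x * y" "\<one>\<^bsub>cstar_rec\<^esub> = 1" "\<zero>\<^bsub>cstar_rec\<^esub> = 0"
  "x \<oplus>\<^bsub>cstar_rec\<^esub> y = x + y" "c \<odot>\<^bsub>cstar_rec\<^esub> x = cs c * x" "star cstar_rec x = adj x" "cnorm cstar_rec x = norm x"
  by (simp_all add: cstar_rec_def)

lemma ring_cstar_rec: "ring (cstar_rec :: 'a::unital_cstar cstar)"
proof (rule ringI)
  show "abelian_group (cstar_rec :: 'a cstar)"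
  proof (rule abelian_groupI)
    show "\<exists>y\<in>carrier cstar_rec. y \<oplus>\<^bsub>cstar_rec\<^esub> x = \<zero>\<^bsub>cstar_rec\<^esub>" for x :: 'a
      by (intro bexI[of _ "- x"]) simp_all
  qed (simp_all add: algebra_simps)
  show "Group.monoid (cstar_rec :: 'a cstar)" by (rule monoidI) (simp_all add: mult.assoc)
qed (simp_all add: algebra_simps)

lemma cstar_rec_minus [simp]: "x \<ominus>\<^bsub>cstar_rec\<^esub> y = x - y"
proof -
  interpret ring "cstar_rec :: 'a cstar" by (rule ring_cstar_rec)
  have "\<ominus>\<^bsub>cstar_rec\<^esub> y = - y" by (rule minus_equality) simp_all
  then show ?thesis by (simp add: a_minus_def)
qed

lemma cstar_algebra_rec: "cstar_algebra (cstar_rec :: 'a::unital_cstar cstar)"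
proof (intro cstar_algebra.intro ring_cstar_rec cstar_algebra_axioms.intro)
  fix X :: "nat \<Rightarrow> 'a"
  assume "\<forall>e>0. \<exists>M. \<forall>m\<ge>M. \<forall>n\<ge>M. cnorm cstar_rec (X m \<ominus>\<^bsub>cstar_rec\<^esub> X n) < e"
  then have "convergent X" by (intro Cauchy_convergent CauchyI) simp
  then obtain L where "X \<longlonglongrightarrow> L" by (auto simp: convergent_def)
  then show "\<exists>L\<in>carrier cstar_rec. (\<lambda>n. cnorm cstar_rec (X n \<ominus>\<^bsub>cstar_rec\<^esub> L)) \<longlonglongrightarrow> 0"
    by (auto simp: tendsto_norm_zero_iff LIM_zero_iff)
next
  show "x \<otimes>\<^bsub>cstar_rec\<^esub> (c \<odot>\<^bsub>cstar_rec\<^esub> y) = c \<odot>\<^bsub>cstar_rec\<^esub> (x \<otimes>\<^bsub>cstar_rec\<^esub> y)" for c and x y :: 'a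
    by simp (metis cs_comm mult.assoc)
qed (simp_all add: cs_add cs_times adj_add adj_mult cs_adj cs_comm[of "cnj _"] norm_cs_mult norm_mult_ineq
    norm_triangle_ineq norm_adj_mult algebra_simps)

section \<open>Evaluation of *-polynomials and unital *-homomorphisms\<close>

definition eval_at :: "('g \<Rightarrow> 'a::unital_cstar) \<Rightarrow> 'g free_star \<Rightarrow> 'a" where
  "eval_at f = cstar_algebra.eval_poly cstar_rec f"

lemma cstar_evaluation_rec: "cstar_evaluation (cstar_rec :: 'a::unital_cstar cstar) f"
  by (intro cstar_evaluation.intro cstar_algebra_rec cstar_evaluation_axioms.intro) simp

lemma eval_at_simps [simp]:
  "eval_at f (x + y) = eval_at f x + eval_at f y" "eval_at f (x - y) = eval_at f x - eval_at f y"
  "eval_at f (x * y) = eval_at f x * eval_at f y" "eval_at f (adjoint x) = adj (eval_at f x)"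
  "eval_at f (gen g) = f g" "eval_at f 1 = 1" "eval_at f (scale c x) = cs c * eval_at f x"
  using cstar_evaluation.eval_add[OF cstar_evaluation_rec, of f x y]
    cstar_evaluation.eval_diff[OF cstar_evaluation_rec, of f x y]
    cstar_evaluation.eval_mult[OF cstar_evaluation_rec, of f x y]
    cstar_evaluation.eval_adjoint[OF cstar_evaluation_rec, of f x]
    cstar_evaluation.eval_gen[OF cstar_evaluation_rec, of f g]
    cstar_evaluation.eval_one[OF cstar_evaluation_rec, of f]
    cstar_evaluation.eval_scale[OF cstar_evaluation_rec, of f c x]
  by (simp_all add: eval_at_def)

locale star_morphism =
  fixes \<phi> :: "'a::unital_cstar \<Rightarrow> 'b::unital_cstar"
  assumes add: "\<phi> (x + y) = \<phi> x + \<phi> y"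
    and mult: "\<phi> (x * y) = \<phi> x * \<phi> y"
    and one [simp]: "\<phi> 1 = 1"
    and cs_mult: "\<phi> (cs c * x) = cs c * \<phi> x"
    and star: "\<phi> (adj x) = adj (\<phi> x)"
begin

lemma zero [simp]: "\<phi> 0 = 0" using add[of 0 0] by simp

lemma scaleR: "\<phi> (r *\<^sub>R x) = r *\<^sub>R \<phi> x"
  using cs_mult[of "of_real r" x] by (simp add: scaleR_conv_of_real)

lemma minus: "\<phi> (- x) = - \<phi> x" using scaleR[of "-1" x] by simp

lemma diff: "\<phi> (x - y) = \<phi> x - \<phi> y" using add[of x "- y"] by (simp add: minus)

lemma cs: "\<phi> (cs c) = cs c" using cs_mult[of c 1] by simp

text \<open>Contractivity is automatic: the norm of the image is a C*-seminorm on the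
  source.\<close>

lemma norm_le: "norm (\<phi> x) \<le> norm x"
  by (rule seminorm_le_norm[of "\<lambda>x. norm (\<phi> x)"])
    (simp_all add: add scaleR mult star norm_adj_mult norm_triangle_ineq)

lemma bounded_linear: "bounded_linear \<phi>"
  by (rule bounded_linear_intro[where K = 1]) (simp_all add: add scaleR norm_le)

lemma sum: "\<phi> (sum f S) = (\<Sum>x\<in>S. \<phi> (f x))"
  by (induction S rule: infinite_finite_induct) (simp_all add: add)

end

lemma star_morphism_star_hom:
  "\<phi> \<in> star_hom (cstar_rec :: 'a::unital_cstar cstar) (cstar_rec :: 'b::unital_cstar cstar) \<longleftrightarrow> star_morphism \<phi>"
  by (auto simp: star_hom_def star_morphism_def Ring.ring_hom_def)

lemma star_morphism_comp: "star_morphism \<phi> \<Longrightarrow> star_morphism \<psi> \<Longrightarrow> star_morphism (\<lambda>x. \<phi> (\<psi> x))"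
  by (intro star_morphism.intro)
    (simp_all only: star_morphism.add star_morphism.mult star_morphism.one star_morphism.cs star_morphism.star)

lemma star_morphism_id: "star_morphism (\<lambda>x. x)"
  by (simp add: star_morphism_def)

lemma star_morphism_cs: "star_morphism (cs :: complex \<Rightarrow> 'a::unital_cstar)"
  by (simp add: star_morphism_def cs_add cs_times cs_adj adj_complex_def)

section \<open>Universal C*-algebras as types\<close>

text \<open>The type of generators carries its relations, so that each universal algebra becomes a
  type of its own. Nontriviality is demanded because the algebra classes require 0 \<noteq> 1 and
  norm 1 = 1.\<close>

class star_relations =
  fixes relations :: "'a free_star set"
  assumes admissible_relations: "admissible relations"
    and relations_nontrivial: "universal_seminorm relations 1 \<noteq> 0"

text \<open>One representation suffices: its norm is a seminorm respecting R with value 1 at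
  1.\<close>

lemma universal_nontrivial:
  fixes f :: "'g \<Rightarrow> 'a::unital_cstar"
  assumes "admissible R" "\<And>r. r \<in> R \<Longrightarrow> eval_at f r = 0"
  shows "universal_seminorm R 1 \<noteq> 0"
proof -
  have "(\<lambda>x. norm (eval_at f x)) \<in> cstar_seminorms R"
    using cstar_evaluation.eval_seminorm[OF cstar_evaluation_rec[of f], of R] assms(2)
    by (simp add: eval_at_def)
  from universal_upper[OF assms(1) this, of 1] show ?thesis by simp
qed

abbreviation uni :: "(nat \<Rightarrow> 'g::star_relations free_star) set cstar" where
  "uni \<equiv> universal_cstar relations"

interpretation U: cstar_algebra "uni :: (nat \<Rightarrow> 'g::star_relations free_star) set cstar"
  by (rule cstar_algebra_universal[OF admissible_relations])

typedef (overloaded) 'g ucstar = "carrier (uni :: (nat \<Rightarrow> 'g::star_relations free_star) set cstar)"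
  morphisms rep_u abs_u
  by (intro exI[of _ "\<zero>\<^bsub>uni\<^esub>"]) (rule U.zero_closed)

lemmas rep_u_closed [simp] = rep_u and rep_abs_u [simp] = abs_u_inverse and abs_rep_u [simp] = rep_u_inverse

instantiation ucstar :: (star_relations) ring_1
begin
definition "0 = abs_u \<zero>\<^bsub>uni\<^esub>"
definition "1 = abs_u \<one>\<^bsub>uni\<^esub>"
definition "x + y = abs_u (rep_u x \<oplus>\<^bsub>uni\<^esub> rep_u y)"
definition "- x = abs_u (\<ominus>\<^bsub>uni\<^esub> rep_u x)"
definition "x - y = abs_u (rep_u x \<ominus>\<^bsub>uni\<^esub> rep_u y)"
definition "x * y = abs_u (rep_u x \<otimes>\<^bsub>uni\<^esub> rep_u y)"

lemma rep_u_simps [simp]: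
  "rep_u (0 :: 'a ucstar) = \<zero>\<^bsub>uni\<^esub>" "rep_u (1 :: 'a ucstar) = \<one>\<^bsub>uni\<^esub>"
  "rep_u (x + y) = rep_u x \<oplus>\<^bsub>uni\<^esub> rep_u y" "rep_u (- x) = \<ominus>\<^bsub>uni\<^esub> rep_u x"
  "rep_u (x - y) = rep_u x \<ominus>\<^bsub>uni\<^esub> rep_u y" "rep_u (x * y) = rep_u x \<otimes>\<^bsub>uni\<^esub> rep_u y"
  by (simp_all add: zero_ucstar_def one_ucstar_def plus_ucstar_def uminus_ucstar_def minus_ucstar_def times_ucstar_def)

lemma cnorm_one_uni: "cnorm (uni :: (nat \<Rightarrow> 'a free_star) set cstar) \<one>\<^bsub>uni\<^esub> = 1"
proof -
  interpret N: cstar_seminorm "universal_seminorm (relations :: 'a free_star set)"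
    by (rule cstar_seminorm_universal[OF admissible_relations])
  have e: "cnorm (uni :: (nat \<Rightarrow> 'a free_star) set cstar) \<one>\<^bsub>uni\<^esub> = universal_seminorm relations (1 :: 'a free_star)"
    unfolding universal_cstar_def N.class_one by (rule N.class_cnorm_eqI) simp_all
  have "universal_seminorm relations (1 :: 'a free_star) = (universal_seminorm relations (1 :: 'a free_star))\<^sup>2"
    using N.N_cstar[of 1] by simp
  then show ?thesis using relations_nontrivial[where 'a = 'a] by (simp add: e power2_eq_square)
qed

instance
proof
  have "cnorm (uni :: (nat \<Rightarrow> 'a free_star) set cstar) \<zero>\<^bsub>uni\<^esub> \<noteq> cnorm (uni :: (nat \<Rightarrow> 'a free_star) set cstar) \<one>\<^bsub>uni\<^esub>"
    by (simp add: cnorm_one_uni)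
  then show "(0 :: 'a ucstar) \<noteq> 1" unfolding rep_u_inject[symmetric] rep_u_simps by metis
qed (simp_all add: rep_u_inject[symmetric] U.a_ac U.m_assoc U.l_distr U.r_distr U.l_neg U.r_neg a_minus_def)

end

instantiation ucstar :: (star_relations) real_algebra_1
begin
definition "r *\<^sub>R x = abs_u (complex_of_real r \<odot>\<^bsub>uni\<^esub> rep_u x)"

lemma rep_u_scaleR [simp]: "rep_u (r *\<^sub>R x) = complex_of_real r \<odot>\<^bsub>uni\<^esub> rep_u x"
  by (simp add: scaleR_ucstar_def U.smult_closed)

instance
  by standard (simp_all add: rep_u_inject[symmetric] U.smult_add_left U.smult_add_right U.smult_smult
    U.smult_one U.smult_mult_left U.smult_mult_right)

end

instantiation ucstar :: (star_relations) real_normed_algebra_1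
begin
definition "norm x = cnorm uni (rep_u x)"
definition "sgn (x :: 'a ucstar) = x /\<^sub>R norm x"
definition "dist (x :: 'a ucstar) y = norm (x - y)"
definition "(uniformity :: ('a ucstar \<times> 'a ucstar) filter) = (INF e\<in>{0 <..}. principal {(x, y). dist x y < e})"
definition "open (U :: 'a ucstar set) \<longleftrightarrow> (\<forall>x\<in>U. \<forall>\<^sub>F (x', y) in uniformity. x' = x \<longrightarrow> y \<in> U)"

instance
proof
  fix x y :: "'a ucstar"
  show "norm x = 0 \<longleftrightarrow> x = 0"
    using U.cnorm_eq_0[of "rep_u x"] by (auto simp: norm_ucstar_def simp flip: rep_u_inject)
qed (simp_all add: sgn_ucstar_def dist_ucstar_def uniformity_ucstar_def open_ucstar_def
    norm_ucstar_def U.cnorm_triangle U.cnorm_smult U.cnorm_mult cnorm_one_uni)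

end

instance ucstar :: (star_relations) banach
proof
  fix X :: "nat \<Rightarrow> 'a ucstar"
  assume "Cauchy X"
  then have "\<forall>e>0. \<exists>M. \<forall>m\<ge>M. \<forall>n\<ge>M. cnorm uni (rep_u (X m) \<ominus>\<^bsub>uni\<^esub> rep_u (X n)) < e"
    by (simp add: Cauchy_def dist_norm norm_ucstar_def)
  then obtain L where L: "L \<in> carrier uni" "(\<lambda>n. cnorm uni (rep_u (X n) \<ominus>\<^bsub>uni\<^esub> L)) \<longlonglongrightarrow> 0"
    using U.complete[of "\<lambda>n. rep_u (X n)"] by auto
  then have "(\<lambda>n. norm (X n - abs_u L)) \<longlonglongrightarrow> 0" by (simp add: norm_ucstar_def)
  then have "X \<longlonglongrightarrow> abs_u L" by (simp add: tendsto_norm_zero_iff LIM_zero_iff)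
  then show "convergent X" by (rule convergentI)
qed

instantiation ucstar :: (star_relations) unital_cstar
begin
definition "adj x = abs_u (star uni (rep_u x))"
definition "iu = abs_u (\<i> \<odot>\<^bsub>uni\<^esub> \<one>\<^bsub>uni\<^esub>)"

lemma rep_u_adj [simp]: "rep_u (adj x) = star uni (rep_u x)"
  by (simp add: adj_ucstar_def U.star_closed)

lemma rep_u_iu [simp]: "rep_u (iu :: 'a ucstar) = \<i> \<odot>\<^bsub>uni\<^esub> \<one>\<^bsub>uni\<^esub>"
  by (simp add: iu_ucstar_def U.smult_closed)

instance
  by standard
   (simp_all add: rep_u_inject[symmetric] U.smult_closed U.star_add U.star_smult U.star_mult U.star_star U.star_closed
     U.smult_mult_left U.smult_mult_right U.cstar_identity norm_ucstar_def U.smult_minus_one[symmetric]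
     flip: U.smult_smult)
end

lemma rep_u_cs: "rep_u (cs c * x) = c \<odot>\<^bsub>uni\<^esub> rep_u x"
proof -
  have "cs c * x = Re c *\<^sub>R x + Im c *\<^sub>R (iu * x)" by (simp add: cs_def distrib_right scaleR_conv_of_real mult.assoc)
  then have "rep_u (cs c * x) = complex_of_real (Re c) \<odot>\<^bsub>uni\<^esub> rep_u x \<oplus>\<^bsub>uni\<^esub> (complex_of_real (Im c) * \<i>) \<odot>\<^bsub>uni\<^esub> rep_u x"
    by (simp add: U.smult_smult U.smult_mult_left)
  also have "\<dots> = (complex_of_real (Re c) + complex_of_real (Im c) * \<i>) \<odot>\<^bsub>uni\<^esub> rep_u x"
    by (simp add: U.smult_add_left)
  also have "complex_of_real (Re c) + complex_of_real (Im c) * \<i> = c" by (metis complex_eq mult.commute)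
  finally show ?thesis .
qed

lemma rep_u_cs_mult: "x \<in> carrier uni \<Longrightarrow> rep_u (cs c) \<otimes>\<^bsub>uni\<^esub> x = c \<odot>\<^bsub>uni\<^esub> x"
  using rep_u_cs[of c "abs_u x"] by simp

lemma star_hom_rep_u: "rep_u \<in> star_hom cstar_rec uni"
  by (simp add: star_hom_def Ring.ring_hom_def rep_u_cs_mult)

lemma star_hom_abs_u: "abs_u \<in> star_hom uni cstar_rec"
  by (auto simp: star_hom_def Ring.ring_hom_def rep_u_cs_mult U.smult_closed U.star_closed simp flip: rep_u_inject)

definition ugen :: "'g::star_relations \<Rightarrow> 'g ucstar" where
  "ugen g = abs_u (universal_gen relations g)"

lemma universal_gen_closed: "admissible R \<Longrightarrow> universal_gen R g \<in> carrier (universal_cstar R)"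
  unfolding universal_gen_def universal_cstar_def
  by (intro cstar_seminorm.class_closed cstar_seminorm_universal cstar_seminorm.cauchy_const)

lemma rep_ugen [simp]: "rep_u (ugen g) = universal_gen relations g"
  by (simp add: ugen_def universal_gen_closed admissible_relations)

lemma star_hom_comp: "f \<in> star_hom A B \<Longrightarrow> h \<in> star_hom B C \<Longrightarrow> (\<lambda>x. h (f x)) \<in> star_hom A C"
  by (auto simp: star_hom_def Ring.ring_hom_def Pi_iff)

theorem ucstar_universal:
  fixes f :: "'g::star_relations \<Rightarrow> 'a::unital_cstar"
  assumes "\<And>r. r \<in> relations \<Longrightarrow> eval_at f r = 0"
  obtains \<phi> where "star_morphism \<phi>" "\<And>g. \<phi> (ugen g) = f g"
proof -
  obtain \<psi> where \<psi>: "\<psi> \<in> star_hom uni (cstar_rec :: 'a cstar)" "\<And>g. \<psi> (universal_gen relations g) = f g"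
    using universal_property[OF admissible_relations cstar_algebra_rec, of f] assms
    by (auto simp: eval_at_def)
  show thesis
    using star_hom_comp[OF star_hom_rep_u \<psi>(1)] \<psi>(2) that[of "\<lambda>x. \<psi> (rep_u x)"] by (simp add: star_morphism_star_hom)
qed

lemma free_star_induct [case_names gen one add mult adjoint scale]:
  fixes x :: "'g free_star"
  assumes gen: "\<And>g. P (gen g)" and one: "P 1" and add: "\<And>x y. P x \<Longrightarrow> P y \<Longrightarrow> P (x + y)"
    and mult: "\<And>x y. P x \<Longrightarrow> P y \<Longrightarrow> P (x * y)" and adjoint: "\<And>x. P x \<Longrightarrow> P (adjoint x)"
    and scale: "\<And>c x. P x \<Longrightarrow> P (scale c x)"
  shows "P x"
proof (induction x rule: star_poly_induct)
  case (single w c)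
  have word: "P (Poly_Mapping.single (Word ls) 1)" for ls
  proof (induction ls)
    case Nil
    then show ?case using one by (simp flip: zero_star_word_def)
  next
    case (Cons l ls)
    obtain g b where l: "l = (g, b)" by (cases l)
    have "P (Poly_Mapping.single (Word [l]) 1)"
    proof (cases b)
      case True
      then have "Poly_Mapping.single (Word [l]) 1 = adjoint (gen g)" by (simp add: l gen_def word_star_def)
      then show ?thesis using adjoint gen by simp
    next
      case False
      then have "Poly_Mapping.single (Word [l]) 1 = gen g" by (simp add: l gen_def)
      then show ?thesis using gen by simp
    qed
    moreover have "Poly_Mapping.single (Word (l # ls)) 1
       = Poly_Mapping.single (Word [l]) 1 * (Poly_Mapping.single (Word ls) 1 :: 'g free_star)"
      by (simp add: mult_single plus_star_word_def)
    ultimately show ?case using mult Cons by simp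
  qed
  obtain ls where "w = Word ls" by (cases w)
  then show ?case using scale[OF word[of ls], of c] by simp
qed (rule add)

lemma rep_u_eval_at:
  "rep_u (eval_at ugen x) = U.eval_poly (universal_gen relations) x"
proof -
  interpret E: cstar_evaluation "uni :: (nat \<Rightarrow> 'a free_star) set cstar" "universal_gen relations"
    by unfold_locales (simp add: universal_gen_closed admissible_relations)
  show ?thesis
    by (induction x rule: free_star_induct)
      (simp_all add: E.eval_add E.eval_mult E.eval_adjoint E.eval_scale rep_u_cs_mult)
qed

lemma eval_at_relation: "r \<in> relations \<Longrightarrow> eval_at ugen r = 0"
  by (simp add: rep_u_eval_at universal_relations admissible_relations flip: rep_u_inject)

text \<open>By density of the *-polynomials in the generators. Uniqueness of morphisms and
  continuity of families of morphisms both come from this rule.\<close>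

theorem ucstar_induct [case_names closed gen one add mult adj cs]:
  fixes x :: "'g::star_relations ucstar"
  assumes closed: "\<And>z x. (\<And>n::nat. P (z n)) \<Longrightarrow> z \<longlonglongrightarrow> x \<Longrightarrow> P x" and gen: "\<And>g. P (ugen g)" and one: "P 1"
    and add: "\<And>x y. P x \<Longrightarrow> P y \<Longrightarrow> P (x + y)" and mult: "\<And>x y. P x \<Longrightarrow> P y \<Longrightarrow> P (x * y)"
    and adj: "\<And>x. P x \<Longrightarrow> P (adj x)" and cs: "\<And>c x. P x \<Longrightarrow> P (cs c * x)"
  shows "P x"
proof -
  have poly: "P (eval_at ugen y)" for y
    by (induction y rule: free_star_induct) (simp_all add: gen one add mult adj cs)
  have "\<exists>z. P z \<and> norm (x - z) \<le> inverse (real (Suc n))" for n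
    using universal_dense[OF admissible_relations rep_u_closed, of "inverse (real (Suc n))" x] poly
    unfolding norm_ucstar_def rep_u_simps rep_u_eval_at[symmetric] by (metis inverse_positive_iff_positive of_nat_0_less_iff zero_less_Suc)
  then obtain z where z: "\<And>n. P (z n)" "\<And>n. norm (x - z n) \<le> inverse (real (Suc n))" by metis
  have "(\<lambda>n. norm (z n - x)) \<longlonglongrightarrow> 0"
    using z(2) by (intro tendsto_sandwich[OF _ _ tendsto_const LIMSEQ_inverse_real_of_nat]) (auto simp: norm_minus_commute)
  then have "z \<longlonglongrightarrow> x" by (simp add: tendsto_norm_zero_iff LIM_zero_iff)
  then show "P x" using closed z(1) by blast
qed

lemma star_morphism_eq:
  fixes \<phi> \<psi> :: "'g::star_relations ucstar \<Rightarrow> 'a::unital_cstar"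
  assumes "star_morphism \<phi>" "star_morphism \<psi>" "\<And>g. \<phi> (ugen g) = \<psi> (ugen g)"
  shows "\<phi> x = \<psi> x"
proof -
  interpret \<phi>: star_morphism \<phi> by fact
  interpret \<psi>: star_morphism \<psi> by fact
  show ?thesis
  proof (induction x rule: ucstar_induct)
    case (closed z x)
    then show ?case
      using bounded_linear.tendsto[OF \<phi>.bounded_linear closed(2)]
        bounded_linear.tendsto[OF \<psi>.bounded_linear closed(2)]
      by (simp add: LIMSEQ_unique)
  qed (simp_all add: assms \<phi>.add \<psi>.add \<phi>.mult \<psi>.mult \<phi>.star \<psi>.star \<phi>.cs \<psi>.cs)
qed

lemma continuous_on_iff_dist:
  "continuous_on S f \<longleftrightarrow> (\<forall>x\<in>S. \<forall>e>0. \<exists>d>0. \<forall>y\<in>S. dist y x < d \<longrightarrow> dist (f y) (f x) < e)"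
  unfolding continuous_on_def tendsto_iff eventually_at by (metis dist_self)

text \<open>All members of the family are contractive, hence equicontinuous, so continuity in t
  passes to limits by a three-part estimate. A path of images of the generators thereby becomes a
  homotopy of morphisms.\<close>

lemma continuous_on_star_morphisms:
  fixes \<phi> :: "real \<Rightarrow> 'g::star_relations ucstar \<Rightarrow> 'a::unital_cstar"
  assumes hom: "\<And>t. star_morphism (\<phi> t)" and gen: "\<And>g. continuous_on S (\<lambda>t. \<phi> t (ugen g))"
  shows "continuous_on S (\<lambda>t. \<phi> t x)"
proof (induction x rule: ucstar_induct)
  case (closed z x)
  show ?case
    unfolding continuous_on_iff_dist
  proof (intro ballI allI impI)
      fix s e assume s: "s \<in> S" and e: "(0::real) < e"
      then obtain n where n: "norm (z n - x) < e / 3"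
        using LIMSEQ_D[OF closed(2), of "e / 3"] by auto
      obtain d where d: "d > 0" "\<And>t. t \<in> S \<Longrightarrow> dist t s < d \<Longrightarrow> dist (\<phi> t (z n)) (\<phi> s (z n)) < e / 3"
        using closed(1) s e unfolding continuous_on_iff_dist by (metis zero_less_divide_iff zero_less_numeral)
      have "dist (\<phi> t x) (\<phi> s x) < e" if t: "t \<in> S" "dist t s < d" for t
      proof -
        have le: "dist (\<phi> r x) (\<phi> r (z n)) < e / 3" for r
          using star_morphism.norm_le[OF hom, of r "x - z n"] n
          by (simp add: dist_norm star_morphism.diff[OF hom] norm_minus_commute)
        have "dist (\<phi> t x) (\<phi> s x) \<le> dist (\<phi> t x) (\<phi> t (z n)) + dist (\<phi> t (z n)) (\<phi> s (z n)) + dist (\<phi> s x) (\<phi> s (z n))"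
          using dist_triangle[of "\<phi> t x" "\<phi> s x" "\<phi> t (z n)"] dist_triangle[of "\<phi> t (z n)" "\<phi> s x" "\<phi> s (z n)"]
            dist_commute[of "\<phi> s x" "\<phi> s (z n)"] by linarith
        then show ?thesis using le[of t] le[of s] d(2)[OF t] by linarith
      qed
      then show "\<exists>d>0. \<forall>t\<in>S. dist t s < d \<longrightarrow> dist (\<phi> t x) (\<phi> s x) < e" using d(1) by blast
  qed
qed (simp_all add: star_morphism.add[OF hom] star_morphism.mult[OF hom] star_morphism.star[OF hom]
    star_morphism.cs[OF hom] star_morphism.one[OF hom] gen continuous_intros)

section \<open>Matrices\<close>

definition madj :: "'a::unital_cstar mat \<Rightarrow> 'a mat" where
  "madj M = mat (dim_col M) (dim_row M) (\<lambda>(i, j). adj (M $$ (j, i)))"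

definition dsm :: "'a::zero mat \<Rightarrow> 'a mat \<Rightarrow> 'a mat" where
  "dsm M N = four_block_mat M (0\<^sub>m (dim_row M) (dim_col N)) (0\<^sub>m (dim_row N) (dim_col M)) N"

definition proj :: "nat \<Rightarrow> 'a::unital_cstar mat \<Rightarrow> bool" where
  "proj n P \<longleftrightarrow> P \<in> carrier_mat n n \<and> madj P = P \<and> P * P = P"

definition unit :: "nat \<Rightarrow> 'a::unital_cstar mat \<Rightarrow> bool" where
  "unit n u \<longleftrightarrow> u \<in> carrier_mat n n \<and> madj u * u = 1\<^sub>m n \<and> u * madj u = 1\<^sub>m n"

definition mvn :: "'a::unital_cstar mat \<Rightarrow> 'a mat \<Rightarrow> bool" where
  "mvn P Q \<longleftrightarrow> (\<exists>v\<in>carrier_mat (dim_row Q) (dim_row P). madj v * v = P \<and> v * madj v = Q)"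

lemma madj_carrier [simp]: "madj M \<in> carrier_mat m n \<longleftrightarrow> M \<in> carrier_mat n m"
  unfolding carrier_mat_def madj_def by auto

lemma madj_dim [simp]: "dim_row (madj M) = dim_col M" "dim_col (madj M) = dim_row M"
  by (simp_all add: madj_def)

lemma madj_index [simp]: "i < dim_col M \<Longrightarrow> j < dim_row M \<Longrightarrow> madj M $$ (i, j) = adj (M $$ (j, i))"
  by (simp add: madj_def)

lemma madj_madj [simp]: "madj (madj M) = M"
  by (rule eq_matI) simp_all

lemma madj_one [simp]: "madj (1\<^sub>m n) = 1\<^sub>m n"
  by (rule eq_matI) auto

lemma madj_zero [simp]: "madj (0\<^sub>m n m) = 0\<^sub>m m n"
  by (rule eq_matI) auto

lemma madj_mult: "dim_col A = dim_row B \<Longrightarrow> madj (A * B) = madj B * madj A"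
  by (rule eq_matI) (auto simp: scalar_prod_def adj_sum adj_mult)

lemma madj_add: "dim_row A = dim_row B \<Longrightarrow> dim_col A = dim_col B \<Longrightarrow> madj (A + B) = madj A + madj B"
  by (rule eq_matI) (auto simp: adj_add)

lemma madj_minus: "dim_row A = dim_row B \<Longrightarrow> dim_col A = dim_col B \<Longrightarrow> madj (A - B) = madj A - madj B"
  by (rule eq_matI) (auto simp: adj_diff)

lemma madj_four_block:
  assumes "A \<in> carrier_mat nr1 nc1" "B \<in> carrier_mat nr1 nc2" "C \<in> carrier_mat nr2 nc1" "D \<in> carrier_mat nr2 nc2"
  shows "madj (four_block_mat A B C D) = four_block_mat (madj A) (madj C) (madj B) (madj D)"
  using assms by (intro eq_matI) auto

lemma dsm_carrier: "A \<in> carrier_mat m k \<Longrightarrow> B \<in> carrier_mat n l \<Longrightarrow> dsm A B \<in> carrier_mat (m + n) (k + l)"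
  by (simp add: dsm_def)

lemma dsm_dim [simp]: "dim_row (dsm A B) = dim_row A + dim_row B" "dim_col (dsm A B) = dim_col A + dim_col B"
  by (simp_all add: dsm_def)

lemma dsm_assoc: "dsm A (dsm B C) = dsm (dsm A B) C"
  unfolding dsm_def by (rule assoc_four_block_mat)

lemma dsm_mult:
  assumes "dim_col A = dim_row C" "dim_col B = dim_row D"
  shows "dsm A B * dsm C D = dsm (A * C) (B * D)"
  unfolding dsm_def using assms
  by (subst mult_four_block_mat[of _ "dim_row A" "dim_col A" _ "dim_col B" _ "dim_row B" _ _ "dim_col C" _ "dim_col D"]) (auto intro!: cong_four_block_mat)

lemma dsm_madj: "madj (dsm A B) = dsm (madj A) (madj B)"
  unfolding dsm_def by (subst madj_four_block) auto

lemma dsm_one: "dsm (1\<^sub>m m) (1\<^sub>m n) = 1\<^sub>m (m + n)"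
  by (simp add: dsm_def)

lemma dsm_map: "f 0 = 0 \<Longrightarrow> map_mat f (dsm A B) = dsm (map_mat f A) (map_mat f B)"
  unfolding dsm_def by (intro eq_matI) auto

lemma proj_dims: "proj n P \<Longrightarrow> dim_row P = n \<and> dim_col P = n"
  by (auto simp: proj_def)

lemma proj_dsm: "proj m P \<Longrightarrow> proj n Q \<Longrightarrow> proj (m + n) (dsm P Q)"
  by (auto simp: proj_def dsm_carrier dsm_mult dsm_madj)

lemma proj_one: "proj n (1\<^sub>m n)" by (simp add: proj_def)

lemma unit_one: "unit n (1\<^sub>m n)" by (simp add: unit_def)

lemma unit_dsm: "unit m P \<Longrightarrow> unit n Q \<Longrightarrow> unit (m + n) (dsm P Q)"
  by (auto simp: unit_def dsm_carrier dsm_mult dsm_madj dsm_one)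

lemma unit_adj: "unit n u \<Longrightarrow> unit n (madj u)"
  by (auto simp: unit_def)

lemma unit_mult: assumes u: "unit n u" and v: "unit n v" shows "unit n (u * v)"
proof -
  have c: "u \<in> carrier_mat n n" "v \<in> carrier_mat n n" "madj u \<in> carrier_mat n n" "madj v \<in> carrier_mat n n"
    using u v by (auto simp: unit_def)
  have "madj (u * v) * (u * v) = madj v * (madj u * u) * v"
    using c by (simp add: madj_mult assoc_mult_mat[of _ n n _ n _ n])
  also have "\<dots> = 1\<^sub>m n" using u v c by (simp add: unit_def)
  finally have 1: "madj (u * v) * (u * v) = 1\<^sub>m n" .
  have "u * v * madj (u * v) = u * (v * madj v) * madj u"
    using c by (simp add: madj_mult assoc_mult_mat[of _ n n _ n _ n])
  also have "\<dots> = 1\<^sub>m n" using u v c by (simp add: unit_def)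
  finally show ?thesis using 1 c by (simp add: unit_def)
qed

lemma mvn_refl: "proj n P \<Longrightarrow> mvn P P"
  unfolding mvn_def by (rule bexI[of _ P]) (auto simp: proj_def)

lemma mvn_sym: assumes "mvn P Q" shows "mvn Q P"
proof -
  obtain v where v: "v \<in> carrier_mat (dim_row Q) (dim_row P)" "madj v * v = P" "v * madj v = Q"
    using assms by (auto simp: mvn_def)
  then show ?thesis unfolding mvn_def by (intro bexI[of _ "madj v"]) auto
qed

lemma mvn_trans: assumes "mvn P Q" "mvn Q R" and P: "proj k P" and Q: "proj m Q" and R: "proj n R"
  shows "mvn P R"
proof -
  note d = proj_dims[OF P] proj_dims[OF Q] proj_dims[OF R]
  obtain v where v: "v \<in> carrier_mat m k" "madj v * v = P" "v * madj v = Q"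
    using assms(1) d by (auto simp: mvn_def)
  obtain w where w: "w \<in> carrier_mat n m" "madj w * w = Q" "w * madj w = R"
    using assms(2) d by (auto simp: mvn_def)
  have c: "madj v \<in> carrier_mat k m" "madj w \<in> carrier_mat m n" using v w by auto
  have 1: "madj v * madj w * (w * v) = madj v * (madj w * w) * v"
    using v(1) w(1) c by (simp add: assoc_mult_mat[of _ k m _ n _ k] assoc_mult_mat[of _ m n _ m _ k]
        assoc_mult_mat[of _ k m _ m _ k])
  also have "\<dots> = madj v * v * (madj v * v)"
    unfolding w(2) v(3)[symmetric] using v(1) c
    by (simp add: assoc_mult_mat[of _ k m _ k _ k] assoc_mult_mat[of _ k m _ m _ k] assoc_mult_mat[of _ m k _ m _ k])
  finally have 1: "madj (w * v) * (w * v) = P" using P v w by (simp add: madj_mult proj_def)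
  have "w * v * (madj v * madj w) = w * (v * madj v) * madj w"
    using v(1) w(1) c by (simp add: assoc_mult_mat[of _ n m _ k _ n] assoc_mult_mat[of _ m k _ m _ n]
        assoc_mult_mat[of _ n m _ m _ n])
  also have "\<dots> = w * madj w * (w * madj w)"
    unfolding v(3) w(2)[symmetric] using w(1) c
    by (simp add: assoc_mult_mat[of _ n m _ n _ n] assoc_mult_mat[of _ n m _ m _ n] assoc_mult_mat[of _ m n _ m _ n])
  finally have "w * v * madj (w * v) = R" using R v w by (simp add: madj_mult proj_def)
  then show ?thesis using 1 v w d unfolding mvn_def by (intro bexI[of _ "w * v"]) auto
qed

lemma mvn_dsm: assumes "mvn P Q" "mvn P' Q'" shows "mvn (dsm P P') (dsm Q Q')"
proof -
  obtain v where v: "v \<in> carrier_mat (dim_row Q) (dim_row P)" "madj v * v = P" "v * madj v = Q"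
    using assms by (auto simp: mvn_def)
  obtain w where w: "w \<in> carrier_mat (dim_row Q') (dim_row P')" "madj w * w = P'" "w * madj w = Q'"
    using assms by (auto simp: mvn_def)
  show ?thesis unfolding mvn_def
    by (intro bexI[of _ "dsm v w"]) (use v w in \<open>auto simp: dsm_madj dsm_mult dsm_carrier\<close>)
qed

text \<open>Placed off the diagonal, Q and P form a partial isometry that exchanges the two
  summands.\<close>

lemma mvn_dsm_comm: assumes P: "proj m P" and Q: "proj n Q" shows "mvn (dsm P Q) (dsm Q P)"
proof -
  let ?v = "four_block_mat (0\<^sub>m n m) Q P (0\<^sub>m m n)"
  have c: "P \<in> carrier_mat m m" "Q \<in> carrier_mat n n" using P Q by (auto simp: proj_def)
  have a: "madj ?v = four_block_mat (0\<^sub>m m n) P Q (0\<^sub>m n m)"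
    using P Q by (subst madj_four_block[of _ n m _ n _ m]) (auto simp: proj_def)
  have "madj ?v * ?v = dsm P Q" unfolding a dsm_def
    using P Q by (subst mult_four_block_mat[of _ m n _ m _ n _ _ m _ n]) (auto simp: proj_def intro!: cong_four_block_mat)
  moreover have "?v * madj ?v = dsm Q P" unfolding a dsm_def
    using P Q by (subst mult_four_block_mat[of _ n m _ n _ m _ _ n _ m]) (auto simp: proj_def intro!: cong_four_block_mat)
  moreover have "?v \<in> carrier_mat (n + m) (m + n)" by (rule four_block_carrier_mat) auto
  ultimately show ?thesis using c unfolding mvn_def by (intro bexI[of _ ?v]) auto
qed

lemma (in star_morphism) map_mat_mult:
  "dim_col A = dim_row B \<Longrightarrow> map_mat \<phi> (A * B) = map_mat \<phi> A * map_mat \<phi> B"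
  by (rule eq_matI) (auto simp: scalar_prod_def sum mult)

lemma (in star_morphism) map_mat_madj: "map_mat \<phi> (madj A) = madj (map_mat \<phi> A)"
  by (rule eq_matI) (auto simp: star)

lemma (in star_morphism) map_mat_one: "map_mat \<phi> (1\<^sub>m n) = 1\<^sub>m n"
  by (rule eq_matI) auto

lemma (in star_morphism) map_mat_proj: "proj n P \<Longrightarrow> proj n (map_mat \<phi> P)"
  by (auto simp: proj_def map_mat_madj[symmetric] map_mat_mult[symmetric])

lemma (in star_morphism) map_mat_unit: "unit n P \<Longrightarrow> unit n (map_mat \<phi> P)"
  by (auto simp: unit_def map_mat_madj[symmetric] map_mat_mult[symmetric] map_mat_one)

lemma (in star_morphism) map_mat_mvn: assumes "mvn P Q" shows "mvn (map_mat \<phi> P) (map_mat \<phi> Q)"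
proof -
  obtain v where v: "v \<in> carrier_mat (dim_row Q) (dim_row P)" "madj v * v = P" "v * madj v = Q"
    using assms by (auto simp: mvn_def)
  have "madj (map_mat \<phi> v) * map_mat \<phi> v = map_mat \<phi> P" "map_mat \<phi> v * madj (map_mat \<phi> v) = map_mat \<phi> Q"
    unfolding map_mat_madj[symmetric] by (subst map_mat_mult[symmetric]; simp add: v)+
  then show ?thesis unfolding mvn_def by (intro bexI[of _ "map_mat \<phi> v"]) (use v(1) in auto)
qed

text \<open>Identifies matrices over 2 x 2 matrices with matrices of twice the size. The entries are
  grouped into four large blocks, so that a diagonal homomorphism becomes the direct sum of its
  components, see \<open>flat_diag\<close>.\<close>

definition flat :: "'a m2 mat \<Rightarrow> 'a mat" where
  "flat M = four_block_mat (map_mat e11 M) (map_mat e12 M) (map_mat e21 M) (map_mat e22 M)"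

lemma flat_carrier: "M \<in> carrier_mat m n \<Longrightarrow> flat M \<in> carrier_mat (m + m) (n + n)"
  by (auto simp: flat_def)

lemma flat_madj: "flat (madj M) = madj (flat M)"
  unfolding flat_def
  by (subst madj_four_block[of _ "dim_row M" "dim_col M" _ "dim_col M" _ "dim_row M"])
    (auto intro!: cong_four_block_mat eq_matI)

lemma m2_entries_sum:
  "e11 (sum f S) = (\<Sum>x\<in>S. e11 (f x))" "e12 (sum f S) = (\<Sum>x\<in>S. e12 (f x))"
  "e21 (sum f S) = (\<Sum>x\<in>S. e21 (f x))" "e22 (sum f S) = (\<Sum>x\<in>S. e22 (f x))"
  by (induction S rule: infinite_finite_induct) simp_all

lemma flat_mult:
  fixes M N :: "'a::unital_cstar m2 mat"
  assumes "dim_col M = dim_row N" shows "flat (M * N) = flat M * flat N"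
  unfolding flat_def
  by (subst mult_four_block_mat[of _ "dim_row M" "dim_col M" _ "dim_col M" _ "dim_row M" _ _ "dim_col N" _ "dim_col N"])
    (use assms in \<open>auto intro!: cong_four_block_mat eq_matI simp: scalar_prod_def m2_entries_sum sum.distrib\<close>)

lemma flat_one: "flat (1\<^sub>m n :: 'a::unital_cstar m2 mat) = 1\<^sub>m (n + n)"
proof -
  have "flat (1\<^sub>m n) = four_block_mat (1\<^sub>m n) (0\<^sub>m n n) (0\<^sub>m n n) (1\<^sub>m n :: 'a mat)"
    unfolding flat_def by (intro cong_four_block_mat eq_matI) auto
  then show ?thesis by simp
qed

lemma flat_proj: "proj n P \<Longrightarrow> proj (n + n) (flat P)"
  by (auto simp: proj_def flat_carrier flat_madj[symmetric] flat_mult[symmetric])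

lemma flat_unit: "unit n P \<Longrightarrow> unit (n + n) (flat P)"
  by (auto simp: unit_def flat_carrier flat_madj[symmetric] flat_mult[symmetric] flat_one)

section \<open>Homotopic projections are equivalent\<close>

text \<open>Submultiplicative and dominating every entry, which is what contraction estimates with
  entrywise limits require.\<close>

definition mnorm :: "'a::real_normed_vector mat \<Rightarrow> real" where
  "mnorm M = (\<Sum>i<dim_row M. \<Sum>j<dim_col M. norm (M $$ (i, j)))"

lemma mnorm_nonneg [simp]: "0 \<le> mnorm M"
  by (simp add: mnorm_def sum_nonneg)

lemma mnorm_entry: "i < dim_row M \<Longrightarrow> j < dim_col M \<Longrightarrow> norm (M $$ (i, j)) \<le> mnorm M"
  unfolding mnorm_def
  by (rule order_trans[OF member_le_sum[of j] member_le_sum[of i]]) (auto simp: sum_nonneg)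

lemma mnorm_add: "dim_row A = dim_row B \<Longrightarrow> dim_col A = dim_col B \<Longrightarrow> mnorm (A + B) \<le> mnorm A + mnorm B"
  by (auto simp: mnorm_def sum.distrib[symmetric] intro!: sum_mono norm_triangle_ineq)

lemma mnorm_minus: "dim_row A = dim_row B \<Longrightarrow> dim_col A = dim_col B \<Longrightarrow> mnorm (A - B) \<le> mnorm A + mnorm B"
  by (auto simp: mnorm_def sum.distrib[symmetric] intro!: sum_mono norm_triangle_ineq4)

lemma mnorm_mult:
  fixes A B :: "'a::real_normed_algebra_1 mat"
  assumes "dim_col A = dim_row B" shows "mnorm (A * B) \<le> mnorm A * mnorm B"
proof -
  let ?a = "\<lambda>i k. norm (A $$ (i, k))" and ?b = "\<lambda>k j. norm (B $$ (k, j))"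
  have "mnorm (A * B) \<le> (\<Sum>i<dim_row A. \<Sum>j<dim_col B. \<Sum>k<dim_row B. ?a i k * ?b k j)"
    using assms unfolding mnorm_def
    by (auto simp: scalar_prod_def atLeast0LessThan intro!: sum_mono order_trans[OF norm_sum] norm_mult_ineq)
  also have "\<dots> = (\<Sum>i<dim_row A. \<Sum>k<dim_row B. ?a i k * (\<Sum>j<dim_col B. ?b k j))"
    by (subst sum.swap[of _ "{..<dim_row B}"]) (simp add: sum_distrib_left)
  also have "\<dots> \<le> (\<Sum>i<dim_row A. \<Sum>k<dim_row B. ?a i k * mnorm B)"
    unfolding mnorm_def by (intro sum_mono mult_left_mono member_le_sum) (auto simp: sum_nonneg)
  also have "\<dots> = mnorm A * mnorm B" using assms by (simp add: mnorm_def sum_distrib_right)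
  finally show ?thesis .
qed

definition half :: "'a::real_vector mat \<Rightarrow> 'a mat" where
  "half M = map_mat (\<lambda>x. (1/2) *\<^sub>R x) M"

lemma half_simps [simp]: "dim_row (half M) = dim_row M" "dim_col (half M) = dim_col M"
  "half M \<in> carrier_mat m n \<longleftrightarrow> M \<in> carrier_mat m n"
  "i < dim_row M \<Longrightarrow> j < dim_col M \<Longrightarrow> half M $$ (i, j) = (1/2) *\<^sub>R (M $$ (i, j))"
  by (auto simp: half_def)

lemma mnorm_half: "mnorm (half M) = mnorm M / 2"
  by (simp add: mnorm_def sum_divide_distrib)

lemma half_mult:
  fixes A B :: "'a::real_algebra_1 mat"
  assumes "dim_col A = dim_row B"
  shows "half A * B = half (A * B)" "A * half B = half (A * B)"
  using assms by (auto intro!: eq_matI simp: scalar_prod_def scaleR_sum_right)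

lemma half_madj: "madj (half A) = half (madj A)"
  by (rule eq_matI) (auto simp: adj_scaleR)

section \<open>Inverse square roots of matrices close to the identity\<close>

context
  fixes n :: nat
begin

lemma sq_closed [simp]:
  fixes A B :: "'a::ring_1 mat"
  assumes "A \<in> carrier_mat n n" "B \<in> carrier_mat n n"
  shows "A * B \<in> carrier_mat n n" "A + B \<in> carrier_mat n n" "A - B \<in> carrier_mat n n"
  using assms by auto

lemmas sq_assoc = assoc_mult_mat[of _ n n _ n _ n]
lemmas sq_distrib = add_mult_distrib_mat[of _ n n _ _ n] mult_add_distrib_mat[of _ n n _ n]
  minus_mult_distrib_mat[of _ n n _ _ n] mult_minus_distrib_mat[of _ n n _ n]

text \<open>The iteration for the solution \<open>s = 1 + x\<close> of \<open>s\<^sup>2 (1 - h) = 1\<close>, a contraction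
  near \<open>0\<close> when \<open>h\<close> is small.\<close>

definition inv_sqrt_step :: "'a::unital_cstar mat \<Rightarrow> 'a mat \<Rightarrow> 'a mat" where
  "inv_sqrt_step h x = half (h + (x * h + x * h) + x * x * h - x * x)"

primrec inv_sqrt_iter :: "'a::unital_cstar mat \<Rightarrow> nat \<Rightarrow> 'a mat" where
  "inv_sqrt_iter h 0 = 0\<^sub>m n n"
| "inv_sqrt_iter h (Suc k) = inv_sqrt_step h (inv_sqrt_iter h k)"

lemma inv_sqrt_step_closed [simp]:
  "h \<in> carrier_mat n n \<Longrightarrow> x \<in> carrier_mat n n \<Longrightarrow> inv_sqrt_step h x \<in> carrier_mat n n"
  by (simp add: inv_sqrt_step_def)

lemma inv_sqrt_iter_closed [simp]: "h \<in> carrier_mat n n \<Longrightarrow> inv_sqrt_iter h k \<in> carrier_mat n n"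
  by (induction k) simp_all

text \<open>The iterates are polynomials in h.\<close>

lemma inv_sqrt_iter_commute:
  assumes h: "h \<in> carrier_mat n n" and a: "a \<in> carrier_mat n n" and c: "a * h = h * a"
  shows "a * inv_sqrt_iter h k = inv_sqrt_iter h k * a"
proof (induction k)
  case 0 then show ?case using a by simp
next
  case (Suc k)
  let ?x = "inv_sqrt_iter h k"
  have x: "?x \<in> carrier_mat n n" using h by simp
  have 1: "a * (?x * h) = ?x * h * a" using Suc c a h x by (metis sq_assoc)
  have 2: "a * (?x * ?x) = ?x * ?x * a" using Suc a x by (metis sq_assoc)
  have 3: "a * (?x * ?x * h) = ?x * ?x * h * a" using 2 c a h x by (metis sq_assoc sq_closed(1))
  show ?case
    unfolding inv_sqrt_iter.simps inv_sqrt_step_def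
    using 1 2 3 c
    by (simp add: a h x half_mult sq_distrib carrier_matD[OF a] carrier_matD[OF h] carrier_matD[OF x])
qed

lemma inv_sqrt_iter_adj:
  assumes h: "h \<in> carrier_mat n n" "madj h = h"
  shows "madj (inv_sqrt_iter h k) = inv_sqrt_iter h k"
proof (induction k)
  case (Suc k)
  let ?x = "inv_sqrt_iter h k"
  have x: "?x \<in> carrier_mat n n" using h by simp
  have c: "h * ?x = ?x * h" by (rule inv_sqrt_iter_commute) (use h in auto)
  have c2: "h * (?x * ?x) = ?x * ?x * h" using c x h by (metis sq_assoc)
  show ?case
    unfolding inv_sqrt_iter.simps inv_sqrt_step_def
    using Suc c c2 h(2)
    by (simp add: half_madj madj_add madj_minus madj_mult carrier_matD[OF x] carrier_matD[OF h(1)])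
qed simp

text \<open>The ball of radius 1/4 is mapped into itself: the terms add up to 33/128 before halving.
  The bound 1/8 on h also yields the factor 1/2 in \<open>inv_sqrt_step_lipschitz\<close>, where the
  sum is 13/16 before halving.\<close>

lemma inv_sqrt_step_norm:
  assumes h: "h \<in> carrier_mat n n" "mnorm h \<le> 1/8" and x: "x \<in> carrier_mat n n" "mnorm x \<le> 1/4"
  shows "mnorm (inv_sqrt_step h x) \<le> 1/4"
proof -
  have xh: "mnorm (x * h) \<le> 1/4 * (1/8)"
    by (rule order_trans[OF mnorm_mult mult_mono]) (use h x in auto)
  have xx: "mnorm (x * x) \<le> 1/4 * (1/4)"
    by (rule order_trans[OF mnorm_mult mult_mono]) (use h x in auto)
  have xxh: "mnorm (x * x * h) \<le> 1/4 * (1/4) * (1/8)"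
    by (rule order_trans[OF mnorm_mult mult_mono[OF xx]]) (use h x in auto)
  have "mnorm (h + (x * h + x * h) + x * x * h - x * x)
      \<le> mnorm h + (mnorm (x * h) + mnorm (x * h)) + mnorm (x * x * h) + mnorm (x * x)"
    by (rule order_trans[OF mnorm_minus] add_right_mono order_trans[OF mnorm_add] add_left_mono order_refl mnorm_add
        | use h x in force)+
  then show ?thesis using h xh xx xxh unfolding inv_sqrt_step_def mnorm_half by simp
qed

lemma inv_sqrt_step_lipschitz:
  assumes h: "h \<in> carrier_mat n n" "mnorm h \<le> 1/8" and x: "x \<in> carrier_mat n n" "mnorm x \<le> 1/4"
    and y: "y \<in> carrier_mat n n" "mnorm y \<le> 1/4"
  shows "mnorm (inv_sqrt_step h x - inv_sqrt_step h y) \<le> mnorm (x - y) / 2"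
proof -
  define d where "d = x - y"
  \<comment> \<open>x^2 - y^2 = x d + d y holds without commutativity.\<close>
  define q where "q = x * d + d * y"
  have d: "d \<in> carrier_mat n n" and q: "q \<in> carrier_mat n n" using x y by (auto simp: d_def q_def)
  have q': "x * x - y * y = q" unfolding q_def d_def using x y
    by (simp add: sq_distrib) (intro eq_matI, auto)
  have dh: "x * h - y * h = d * h" using h x y by (simp add: d_def sq_distrib)
  have qh: "x * x * h - y * y * h = q * h" using h x y by (simp add: q'[symmetric] sq_distrib)
  have "inv_sqrt_step h x - inv_sqrt_step h y = half (((x * h - y * h) + (x * h - y * h)) + (x * x * h - y * y * h) - (x * x - y * y))"
    unfolding inv_sqrt_step_def using h x y
    by (intro eq_matI) (auto simp: scaleR_diff_right[symmetric] scaleR_add_right[symmetric] simp del: index_mult_mat(1) intro!: arg_cong[of _ _ "scaleR _"])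
  then have e: "inv_sqrt_step h x - inv_sqrt_step h y = half ((d * h + d * h) + q * h - q)"
    unfolding dh qh q' .
  have n1: "mnorm (d * h) \<le> mnorm d * (1/8)"
    by (rule order_trans[OF mnorm_mult mult_left_mono]) (use h d in auto)
  have "mnorm (x * d) \<le> 1/4 * mnorm d"
    by (rule order_trans[OF mnorm_mult mult_right_mono]) (use x d in auto)
  moreover have "mnorm (d * y) \<le> mnorm d * (1/4)"
    by (rule order_trans[OF mnorm_mult mult_left_mono]) (use y d in auto)
  moreover have "mnorm q \<le> mnorm (x * d) + mnorm (d * y)"
    unfolding q_def by (rule mnorm_add) (use x y d in auto)
  ultimately have n2: "mnorm q \<le> mnorm d / 2" by simp
  have n3: "mnorm (q * h) \<le> mnorm q * (1/8)"
    by (rule order_trans[OF mnorm_mult mult_left_mono]) (use h q in auto)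
  have "mnorm ((d * h + d * h) + q * h - q) \<le> mnorm (d * h) + mnorm (d * h) + mnorm (q * h) + mnorm q"
    by (rule order_trans[OF mnorm_minus] add_right_mono order_trans[OF mnorm_add] add_left_mono order_refl mnorm_add
        | use h d q in force)+
  then show ?thesis
    unfolding e mnorm_half d_def[symmetric] using n1 n2 n3 mnorm_nonneg[of d] by linarith
qed

lemma inv_sqrt_iter_Cauchy:
  assumes h: "h \<in> carrier_mat n n" "mnorm h \<le> 1/8"
  shows "mnorm (inv_sqrt_iter h k) \<le> 1/4" "mnorm (inv_sqrt_iter h (Suc k) - inv_sqrt_iter h k) \<le> (1/2) ^ k"
proof -
  have 1: "mnorm (inv_sqrt_iter h k) \<le> 1/4" for k
  proof (induction k)
    case 0 show ?case by (simp add: mnorm_def)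
  next
    case (Suc k)
    show ?case unfolding inv_sqrt_iter.simps by (rule inv_sqrt_step_norm[OF h _ Suc]) (simp add: h)
  qed
  then show "mnorm (inv_sqrt_iter h k) \<le> 1/4" .
  show "mnorm (inv_sqrt_iter h (Suc k) - inv_sqrt_iter h k) \<le> (1/2) ^ k"
  proof (induction k)
    case 0
    have "mnorm (inv_sqrt_iter h (Suc 0) - inv_sqrt_iter h 0) \<le> mnorm (inv_sqrt_iter h (Suc 0)) + mnorm (inv_sqrt_iter h 0)"
      by (rule mnorm_minus) (use h in \<open>simp_all add: inv_sqrt_step_def\<close>)
    then show ?case unfolding power_0 using 1[of 0] 1[of "Suc 0"] by linarith
  next
    case (Suc k)
    have "mnorm (inv_sqrt_iter h (Suc (Suc k)) - inv_sqrt_iter h (Suc k)) \<le> mnorm (inv_sqrt_iter h (Suc k) - inv_sqrt_iter h k) / 2"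
      unfolding inv_sqrt_iter.simps(2)[of h "Suc k"] inv_sqrt_iter.simps(2)[of h k]
      by (rule inv_sqrt_step_lipschitz) (use h 1 1[of "Suc k"] in \<open>simp_all\<close>)
    then show ?case using Suc by simp
  qed
qed

definition mlim :: "(nat \<Rightarrow> 'a::real_normed_vector mat) \<Rightarrow> 'a mat \<Rightarrow> bool" where
  "mlim X L \<longleftrightarrow> (\<forall>k. X k \<in> carrier_mat n n) \<and> L \<in> carrier_mat n n \<and>
     (\<forall>i<n. \<forall>j<n. (\<lambda>k. X k $$ (i, j)) \<longlonglongrightarrow> L $$ (i, j))"

lemma mlim_dims:
  assumes "mlim X L"
  shows "dim_row (X k) = n" "dim_col (X k) = n" "dim_row L = n" "dim_col L = n"
  using assms by (auto simp: mlim_def)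

lemma mlim_unique: assumes "mlim X L" "mlim X M" shows "L = M"
proof (rule eq_matI)
  fix i j assume "i < dim_row M" "j < dim_col M"
  then show "L $$ (i, j) = M $$ (i, j)"
    using assms LIMSEQ_unique[of "\<lambda>k. X k $$ (i, j)"] by (auto simp: mlim_def)
qed (use mlim_dims[OF assms(1)] mlim_dims[OF assms(2)] in auto)

lemma mlim_const: "A \<in> carrier_mat n n \<Longrightarrow> mlim (\<lambda>k. A) A"
  by (simp add: mlim_def)

lemma mlim_add: "mlim X L \<Longrightarrow> mlim Y M \<Longrightarrow> mlim (\<lambda>k. X k + Y k :: 'a::unital_cstar mat) (L + M)"
  using mlim_dims[of X L] mlim_dims[of Y M] by (auto simp: mlim_def tendsto_add)

lemma mlim_minus: "mlim X L \<Longrightarrow> mlim Y M \<Longrightarrow> mlim (\<lambda>k. X k - Y k :: 'a::unital_cstar mat) (L - M)"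
  using mlim_dims[of X L] mlim_dims[of Y M] by (auto simp: mlim_def tendsto_diff)

lemma mlim_half: assumes X: "mlim X L" shows "mlim (\<lambda>k. half (X k)) (half L)"
  unfolding mlim_def
proof (intro conjI allI impI)
  fix i j assume "i < n" "j < n"
  moreover from this have "(\<lambda>k. (1/2) *\<^sub>R (X k $$ (i, j))) \<longlonglongrightarrow> (1/2) *\<^sub>R (L $$ (i, j))"
    using X unfolding mlim_def by (intro tendsto_scaleR[OF tendsto_const]) blast
  ultimately show "(\<lambda>k. half (X k) $$ (i, j)) \<longlonglongrightarrow> half L $$ (i, j)" by (simp add: mlim_dims[OF X])
qed (use X in \<open>simp_all add: mlim_def\<close>)

lemma mlim_madj: assumes X: "mlim X L" shows "mlim (\<lambda>k. madj (X k)) (madj L)"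
  unfolding mlim_def
proof (intro conjI allI impI)
  fix i j assume "i < n" "j < n"
  moreover from this have "(\<lambda>k. adj (X k $$ (j, i))) \<longlonglongrightarrow> adj (L $$ (j, i))"
    using X unfolding mlim_def by (intro tendsto_adj) blast
  ultimately show "(\<lambda>k. madj (X k) $$ (i, j)) \<longlonglongrightarrow> madj L $$ (i, j)" by (simp add: mlim_dims[OF X])
qed (use X in \<open>simp_all add: mlim_def\<close>)

lemma mlim_mult:
  assumes X: "mlim X L" and Y: "mlim Y M" shows "mlim (\<lambda>k. X k * Y k :: 'a::unital_cstar mat) (L * M)"
  unfolding mlim_def
proof (intro conjI allI impI)
  fix i j assume ij: "i < n" "j < n"
  have "(\<lambda>k. \<Sum>l\<in>{0..<n}. X k $$ (i, l) * Y k $$ (l, j)) \<longlonglongrightarrow> (\<Sum>l\<in>{0..<n}. L $$ (i, l) * M $$ (l, j))"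
    using X Y ij unfolding mlim_def by (intro tendsto_sum tendsto_mult) auto
  then show "(\<lambda>k. (X k * Y k) $$ (i, j)) \<longlonglongrightarrow> (L * M) $$ (i, j)"
    using ij by (simp add: mlim_dims[OF X] mlim_dims[OF Y] scalar_prod_def)
qed (use X Y in \<open>auto simp add: mlim_def\<close>)

text \<open>Increments are dominated by a geometric series, so each entry converges; multiplying out
  s^2 (1 - h) = 1 with s = 1 + x gives back the fixed point equation.\<close>

lemma inv_sqrt_exists:
  fixes h :: "'a::unital_cstar mat"
  assumes h: "h \<in> carrier_mat n n" "mnorm h \<le> 1/8" "madj h = h"
  obtains s where "s \<in> carrier_mat n n" "madj s = s" "s * s * (1\<^sub>m n - h) = 1\<^sub>m n"
    "\<And>a. a \<in> carrier_mat n n \<Longrightarrow> a * h = h * a \<Longrightarrow> a * s = s * a"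
proof -
  let ?X = "inv_sqrt_iter h"
  have "\<exists>l. (\<lambda>k. ?X k $$ (i, j)) \<longlonglongrightarrow> l" if ij: "i < n" "j < n" for i j
  proof -
    have "norm (?X (Suc k) $$ (i, j) - ?X k $$ (i, j)) \<le> (1/2) ^ k" for k
    proof -
      have c: "?X (Suc k) \<in> carrier_mat n n" "?X k \<in> carrier_mat n n" using h(1) inv_sqrt_iter_closed by blast+
      have "norm ((?X (Suc k) - ?X k) $$ (i, j)) \<le> mnorm (?X (Suc k) - ?X k)"
        using c ij by (intro mnorm_entry) auto
      also have "\<dots> \<le> (1/2) ^ k" by (rule inv_sqrt_iter_Cauchy[OF h(1,2)])
      finally show ?thesis using c ij by (simp del: inv_sqrt_iter.simps)
    qed
    then have "summable (\<lambda>k. ?X (Suc k) $$ (i, j) - ?X k $$ (i, j))"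
      by (intro summable_comparison_test'[OF summable_geometric[of "1/2 :: real"]]) auto
    then have "convergent (\<lambda>m. \<Sum>k<m. ?X (Suc k) $$ (i, j) - ?X k $$ (i, j))"
      by (simp add: summable_iff_convergent)
    then have "convergent (\<lambda>m. ?X m $$ (i, j) - ?X 0 $$ (i, j))"
      unfolding sum_lessThan_telescope[of "\<lambda>k. ?X k $$ (i, j)"] .
    then show ?thesis using convergent_diff_const_right_iff[of "\<lambda>m. ?X m $$ (i, j)"]
      by (simp add: convergent_def del: inv_sqrt_iter.simps)
  qed
  then obtain l where l: "\<And>i j. i < n \<Longrightarrow> j < n \<Longrightarrow> (\<lambda>k. ?X k $$ (i, j)) \<longlonglongrightarrow> l i j" by metis
  define x where "x = mat n n (\<lambda>(i, j). l i j)"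
  have x: "x \<in> carrier_mat n n" by (simp add: x_def)
  have lim: "mlim ?X x" using l h(1) by (simp add: mlim_def x_def)
  have "mlim (\<lambda>k. ?X (Suc k)) x"
    using lim unfolding mlim_def by (auto intro: LIMSEQ_Suc simp del: inv_sqrt_iter.simps)
  moreover have "mlim (\<lambda>k. ?X (Suc k)) (half (h + (x * h + x * h) + x * x * h - x * x))"
    unfolding inv_sqrt_iter.simps inv_sqrt_step_def
    by (intro mlim_half mlim_minus mlim_add mlim_mult mlim_const lim h)
  ultimately have "x = half (h + (x * h + x * h) + x * x * h - x * x)" by (rule mlim_unique)
  then have fixpt: "x $$ (i, j) = (1/2) *\<^sub>R ((h + (x * h + x * h) + x * x * h - x * x) $$ (i, j))" if "i < n" "j < n" for i j
    using that h x by (metis half_simps(4) index_minus_mat(2,3) index_mult_mat(2,3) carrier_matD)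
  let ?s = "1\<^sub>m n + x"
  have s: "?s \<in> carrier_mat n n" using x by simp
  have commute: "a * x = x * a" if "a \<in> carrier_mat n n" "a * h = h * a" for a
    using mlim_mult[OF mlim_const[OF that(1)] lim] mlim_mult[OF lim mlim_const[OF that(1)]]
    unfolding inv_sqrt_iter_commute[OF h(1) that] by (rule mlim_unique)
  have "madj x = x"
    using mlim_madj[OF lim] lim unfolding inv_sqrt_iter_adj[OF h(1,3)] by (rule mlim_unique)
  then have 1: "madj ?s = ?s" using x by (simp add: madj_add)
  have "?s * ?s * (1\<^sub>m n - h) = 1\<^sub>m n + x + (x + x * x) - (h + x * h + (x * h + x * x * h))"
    using x h by (simp add: sq_distrib)
  also have "\<dots> = 1\<^sub>m n"
  proof (rule eq_matI)
    fix i j assume "i < dim_row (1\<^sub>m n :: 'a mat)" "j < dim_col (1\<^sub>m n :: 'a mat)"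
    then have ij: "i < n" "j < n" by simp_all
    have "x $$ (i, j) + x $$ (i, j) = h $$ (i, j) + ((x * h) $$ (i, j) + (x * h) $$ (i, j)) + (x * x * h) $$ (i, j) - (x * x) $$ (i, j)"
      using fixpt[OF ij] ij x h by (simp add: scaleR_2[symmetric] del: index_mult_mat(1))
    then show "(1\<^sub>m n + x + (x + x * x) - (h + x * h + (x * h + x * x * h))) $$ (i, j) = 1\<^sub>m n $$ (i, j)"
      using ij x h by (simp add: algebra_simps del: index_mult_mat(1) index_one_mat)
  qed (use x h in auto)
  finally have 2: "?s * ?s * (1\<^sub>m n - h) = 1\<^sub>m n" .
  have 3: "a * ?s = ?s * a" if "a \<in> carrier_mat n n" "a * h = h * a" for a
    using commute[OF that] that x by (simp add: sq_distrib)
  show thesis by (rule that[OF s 1 2 3])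
qed

text \<open>h = (P - Q)^2 commutes with P and Q, and P Q P = P (1 - h). Hence Q P times the inverse
  square root s of 1 - h is a partial isometry from P to Q. The bound 1/3 makes
  \<open>mnorm h\<close> at most 1/9, within the 1/8 required for s.\<close>

lemma close_projections:
  fixes P Q :: "'a::unital_cstar mat"
  assumes P: "proj n P" and Q: "proj n Q" and d: "mnorm (P - Q) \<le> 1/3"
  shows "mvn P Q"
proof -
  have c [simp]: "P \<in> carrier_mat n n" "Q \<in> carrier_mat n n" and adj: "madj P = P" "madj Q = Q"
    and idem: "P * P = P" "Q * Q = Q" using P Q by (auto simp: proj_def)
  note [simp] = right_mult_one_mat[OF c(1)] right_mult_one_mat[OF c(2)] left_mult_one_mat[OF c(1)] left_mult_one_mat[OF c(2)]
  define h where "h = (P - Q) * (P - Q)"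
  have h [simp]: "h \<in> carrier_mat n n" by (simp add: h_def)
  have h9: "mnorm h \<le> 1/3 * (1/3)" unfolding h_def
    by (rule order_trans[OF mnorm_mult mult_mono[OF d d]]) (use carrier_matD[OF c(2)] in auto)
  have hadj: "madj h = h"
    by (simp add: h_def madj_mult madj_minus adj carrier_matD[OF c(1)] carrier_matD[OF c(2)])
  have h8: "mnorm h \<le> 1/8" using h9 by simp
  obtain s where s [simp]: "s \<in> carrier_mat n n" and s': "madj s = s" "s * s * (1\<^sub>m n - h) = 1\<^sub>m n"
    and commute: "\<And>a. a \<in> carrier_mat n n \<Longrightarrow> a * h = h * a \<Longrightarrow> a * s = s * a"
    using inv_sqrt_exists[OF h h8 hadj] by blast
  note [simp] = right_mult_one_mat[OF s] left_mult_one_mat[OF s]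
  have h_eq: "h = (P - Q * P) - (P * Q - Q)"
    by (simp add: h_def sq_distrib idem)
  have idem2: "P * (P * B) = P * B" "Q * (Q * B) = Q * B" if "B \<in> carrier_mat n n" for B
    using that idem by (metis c sq_assoc)+
  have Ph: "P * h = P - P * Q * P" "h * P = P - P * Q * P" and Qh: "Q * h = Q - Q * P * Q" "h * Q = Q - Q * P * Q"
  proof -
    have *: "A - B - (C - C) = A - B" "A - C - (B - C) = A - B"
      if "A \<in> carrier_mat n n" "B \<in> carrier_mat n n" "C \<in> carrier_mat n n" for A B C :: "'a mat"
      using that by (auto intro!: eq_matI)
    have **: "A - A - (B - C) = C - B" "C - A - (C - B) = B - A"
      if "A \<in> carrier_mat n n" "B \<in> carrier_mat n n" "C \<in> carrier_mat n n" for A B C :: "'a mat"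
      using that by (auto intro!: eq_matI)
    show "P * h = P - P * Q * P" "h * P = P - P * Q * P" "Q * h = Q - Q * P * Q" "h * Q = Q - Q * P * Q"
      unfolding h_eq by (simp_all add: sq_distrib sq_assoc idem idem2 * **)
  qed
  have sP: "P * s = s * P" and sQ: "Q * s = s * Q" using Ph Qh by (auto intro: commute)
  have "P * Q * P = P * (1\<^sub>m n - h)" by (auto simp add: sq_distrib Ph intro!: eq_matI simp del: index_mult_mat(1))
  moreover have "Q * P * Q = Q * (1\<^sub>m n - h)" by (auto simp add: sq_distrib Qh intro!: eq_matI simp del: index_mult_mat(1))
  ultimately have PQP: "P * Q * P = P * (1\<^sub>m n - h)" "Q * P * Q = Q * (1\<^sub>m n - h)" by auto
  have u [simp]: "1\<^sub>m n - h \<in> carrier_mat n n" by simp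
  have ch: "(1\<^sub>m n - h) * s = s * (1\<^sub>m n - h)" using commute[OF h refl] by (simp add: sq_distrib)
  define v where "v = Q * P * s"
  have v [simp]: "v \<in> carrier_mat n n" by (simp add: v_def)
  have av: "madj v = s * (P * Q)"
    using s'(1) adj by (simp add: v_def madj_mult carrier_matD[OF c(1)] carrier_matD[OF c(2)] carrier_matD[OF s])
  have "madj v * v = s * (P * Q) * (Q * P * s)" unfolding av by (simp add: v_def)
  also have "\<dots> = s * (P * Q * P) * s" by (simp add: sq_assoc idem2)
  also have "\<dots> = s * (P * (1\<^sub>m n - h)) * s" by (simp only: PQP)
  also have "\<dots> = s * P * ((1\<^sub>m n - h) * s)" by (simp add: sq_assoc)
  also have "\<dots> = P * s * (s * (1\<^sub>m n - h))" by (simp only: ch sP)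
  also have "\<dots> = P * (s * s * (1\<^sub>m n - h))" by (simp add: sq_assoc)
  finally have 1: "madj v * v = P" by (simp only: s'(2) right_mult_one_mat[OF c(1)])
  have "v * madj v = Q * P * s * (s * (P * Q))" unfolding av by (simp add: v_def)
  also have "\<dots> = Q * (P * (s * s)) * (P * Q)" by (simp add: sq_assoc)
  also have "P * (s * s) = s * s * P" using sP by (metis c(1) s sq_assoc)
  also have "Q * (s * s * P) * (P * Q) = Q * (s * s) * (P * Q)" by (simp add: sq_assoc idem2)
  also have "Q * (s * s) = s * s * Q" using sQ by (metis c(2) s sq_assoc)
  also have "s * s * Q * (P * Q) = s * s * (Q * P * Q)" by (simp add: sq_assoc)
  also have "\<dots> = s * s * (Q * (1\<^sub>m n - h))" by (simp only: PQP)
  also have "Q * (1\<^sub>m n - h) = (1\<^sub>m n - h) * Q" by (simp add: sq_distrib Qh)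
  also have "s * s * ((1\<^sub>m n - h) * Q) = s * s * (1\<^sub>m n - h) * Q" by (simp add: sq_assoc)
  finally have "v * madj v = Q" by (simp only: s'(2) left_mult_one_mat[OF c(2)])
  then show ?thesis using 1 unfolding mvn_def by (intro bexI[of _ v]) auto
qed

end

definition mat_path :: "nat \<Rightarrow> (real \<Rightarrow> 'a::topological_space mat) \<Rightarrow> bool" where
  "mat_path n \<gamma> \<longleftrightarrow> (\<forall>i<n. \<forall>j<n. continuous_on {0..1} (\<lambda>t. \<gamma> t $$ (i, j)))"

text \<open>Bisection by \<open>Bolzano\<close>: equivalence of the endpoints composes over adjacent
  intervals, and near each point continuity and \<open>close_projections\<close> give it on all
  short intervals.\<close>

theorem homotopic_projections:
  assumes P: "\<And>t. t \<in> {0..1} \<Longrightarrow> proj n (\<gamma> t)" and cont: "mat_path n \<gamma>"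
  shows "mvn (\<gamma> 0) (\<gamma> 1)"
proof -
  have "0 \<le> (0::real) \<longrightarrow> (1::real) \<le> 1 \<longrightarrow> mvn (\<gamma> 0) (\<gamma> 1)"
  proof (rule Bolzano[where P = "\<lambda>a b. 0 \<le> a \<longrightarrow> b \<le> 1 \<longrightarrow> mvn (\<gamma> a) (\<gamma> b)"])
    fix a b c :: real
    assume "0 \<le> a \<longrightarrow> b \<le> 1 \<longrightarrow> mvn (\<gamma> a) (\<gamma> b)" "0 \<le> b \<longrightarrow> c \<le> 1 \<longrightarrow> mvn (\<gamma> b) (\<gamma> c)" "a \<le> b" "b \<le> c"
    then show "0 \<le> a \<longrightarrow> c \<le> 1 \<longrightarrow> mvn (\<gamma> a) (\<gamma> c)"
      using mvn_trans[of "\<gamma> a" "\<gamma> b" "\<gamma> c" n n n] P[of a] P[of b] P[of c] by auto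
  next
    fix x :: real assume x: "0 \<le> x" "x \<le> 1"
    \<comment> \<open>Each of the n^2 entries differs by at most 2 ?e, so the total stays below 1/3;
      the summand 1 covers n = 0.\<close>
    let ?e = "1 / (6 * (real n * real n + 1))"
    have e: "?e > 0" by (simp add: add_nonneg_pos)
    have "\<forall>i\<in>{..<n}. \<forall>j\<in>{..<n}. \<exists>d>0. \<forall>y\<in>{0..1}. dist y x < d \<longrightarrow> dist (\<gamma> y $$ (i, j)) (\<gamma> x $$ (i, j)) < ?e"
      using cont x e unfolding mat_path_def continuous_on_iff_dist by (metis atLeastAtMost_iff lessThan_iff)
    then obtain D where D: "\<And>i j. i < n \<Longrightarrow> j < n \<Longrightarrow> D i j > 0 \<and>
        (\<forall>y\<in>{0..1}. dist y x < D i j \<longrightarrow> dist (\<gamma> y $$ (i, j)) (\<gamma> x $$ (i, j)) < ?e)"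
      by (metis lessThan_iff)
    \<comment> \<open>\<open>insert 1\<close> keeps the set nonempty when n = 0.\<close>
    define d where "d = Min (insert 1 ((\<lambda>(i, j). D i j) ` ({..<n} \<times> {..<n})))"
    have d0: "d > 0" unfolding d_def using D by (subst Min_gr_iff) auto
    have dD: "d \<le> D i j" if "i < n" "j < n" for i j
      unfolding d_def using that by (intro Min_le) auto
    have near: "mnorm (\<gamma> a - \<gamma> b) \<le> 1/3" if a: "a \<in> {0..1}" "dist a x < d" and b: "b \<in> {0..1}" "dist b x < d" for a b
    proof -
      have c: "dim_row (\<gamma> a) = n" "dim_col (\<gamma> a) = n" "dim_row (\<gamma> b) = n" "dim_col (\<gamma> b) = n"
        using proj_dims[OF P[OF a(1)]] proj_dims[OF P[OF b(1)]] by auto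
      have "norm ((\<gamma> a - \<gamma> b) $$ (i, j)) \<le> 2 * ?e" if ij: "i < n" "j < n" for i j
      proof -
        have "dist (\<gamma> a $$ (i, j)) (\<gamma> x $$ (i, j)) < ?e" "dist (\<gamma> b $$ (i, j)) (\<gamma> x $$ (i, j)) < ?e"
          using D[OF ij] dD[OF ij] a b by force+
        then have "dist (\<gamma> a $$ (i, j)) (\<gamma> b $$ (i, j)) < 2 * ?e" using dist_triangle_half_l by (smt (verit) dist_commute dist_triangle)
        then show ?thesis using c ij by (simp add: dist_norm)
      qed
      then have "mnorm (\<gamma> a - \<gamma> b) \<le> (\<Sum>i<n. \<Sum>j<n. 2 * ?e)"
        unfolding mnorm_def index_minus_mat(2,3) c by (intro sum_mono) blast
      also have "\<dots> \<le> 1/3"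
      proof -
        have "6 + real n * (real n * 6) > 0" by (simp add: add_pos_nonneg)
        then show ?thesis by (simp add: field_simps divide_le_eq_1_pos)
      qed
      finally show ?thesis .
    qed
    show "\<exists>d>0. \<forall>a b. a \<le> x \<and> x \<le> b \<and> b - a < d \<longrightarrow> 0 \<le> a \<longrightarrow> b \<le> 1 \<longrightarrow> mvn (\<gamma> a) (\<gamma> b)"
    proof (intro exI[of _ d] conjI allI impI d0, elim conjE)
      fix a b assume ab: "a \<le> x" "x \<le> b" "b - a < d" "0 \<le> a" "b \<le> 1"
      then show "mvn (\<gamma> a) (\<gamma> b)"
        by (intro close_projections[OF P P near]) (auto simp: dist_real_def)
    qed
  qed simp
  then show ?thesis by simp
qed

section \<open>Paths of unitaries\<close>

definition upath :: "nat \<Rightarrow> 'a::unital_cstar mat \<Rightarrow> 'a mat \<Rightarrow> bool" where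
  "upath n u v \<longleftrightarrow> (\<exists>\<gamma>. (\<forall>t\<in>{0..1}. unit n (\<gamma> t)) \<and> mat_path n \<gamma> \<and> \<gamma> 0 = u \<and> \<gamma> 1 = v)"

lemma upath_unit: "upath n u v \<Longrightarrow> unit n u" "upath n u v \<Longrightarrow> unit n v"
  by (force simp: upath_def)+

lemma upath_refl: "unit n u \<Longrightarrow> upath n u u"
  unfolding upath_def by (rule exI[of _ "\<lambda>t. u"]) (simp add: mat_path_def)

lemma upath_sym: assumes "upath n u v" shows "upath n v u"
proof -
  obtain \<gamma> where g: "\<And>t. t \<in> {0..1} \<Longrightarrow> unit n (\<gamma> t)" "mat_path n \<gamma>" "\<gamma> 0 = u" "\<gamma> 1 = v"
    using assms unfolding upath_def by blast
  have "continuous_on {0..1} (\<lambda>t. \<gamma> (1 - t) $$ (i, j))" if "i < n" "j < n" for i j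
    by (rule continuous_on_compose2[of "{0..1}" "\<lambda>t. \<gamma> t $$ (i, j)"])
      (use g(2) that in \<open>auto simp: mat_path_def intro!: continuous_intros\<close>)
  then show ?thesis unfolding upath_def using g
    by (intro exI[of _ "\<lambda>t. \<gamma> (1 - t)"]) (simp add: mat_path_def)
qed

lemma mat_path_mult:
  fixes \<gamma> \<delta> :: "real \<Rightarrow> 'a::unital_cstar mat"
  assumes "\<And>t. t \<in> {0..1} \<Longrightarrow> \<gamma> t \<in> carrier_mat n n" "\<And>t. t \<in> {0..1} \<Longrightarrow> \<delta> t \<in> carrier_mat n n"
    and "mat_path n \<gamma>" "mat_path n \<delta>"
  shows "mat_path n (\<lambda>t. \<gamma> t * \<delta> t)"
  unfolding mat_path_def
proof (intro allI impI)
  fix i j assume ij: "i < n" "j < n"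
  have "continuous_on {0..1} (\<lambda>t. \<Sum>k\<in>{0..<n}. \<gamma> t $$ (i, k) * \<delta> t $$ (k, j))"
    using assms(3,4) ij unfolding mat_path_def by (intro continuous_on_sum continuous_on_mult) auto
  moreover have "(\<gamma> t * \<delta> t) $$ (i, j) = (\<Sum>k\<in>{0..<n}. \<gamma> t $$ (i, k) * \<delta> t $$ (k, j))" if "t \<in> {0..1}" for t
    using assms(1,2)[OF that] ij by (auto simp: scalar_prod_def)
  ultimately show "continuous_on {0..1} (\<lambda>t. (\<gamma> t * \<delta> t) $$ (i, j))"
    by (simp cong: continuous_on_cong_simp)
qed

lemma upath_mult: assumes "upath n u v" "upath n u' v'" shows "upath n (u * u') (v * v')"
proof -
  obtain \<gamma> where g: "\<And>t. t \<in> {0..1} \<Longrightarrow> unit n (\<gamma> t)" "mat_path n \<gamma>" "\<gamma> 0 = u" "\<gamma> 1 = v"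
    using assms(1) unfolding upath_def by blast
  obtain \<delta> where d: "\<And>t. t \<in> {0..1} \<Longrightarrow> unit n (\<delta> t)" "mat_path n \<delta>" "\<delta> 0 = u'" "\<delta> 1 = v'"
    using assms(2) unfolding upath_def by blast
  have "mat_path n (\<lambda>t. \<gamma> t * \<delta> t)"
    by (rule mat_path_mult) (use g d in \<open>auto simp: unit_def\<close>)
  then show ?thesis unfolding upath_def using g d
    by (intro exI[of _ "\<lambda>t. \<gamma> t * \<delta> t"]) (simp add: unit_mult)
qed

text \<open>Instead of concatenating paths, multiply pointwise by \<open>v\<^sup>*\<close> times the second one.\<close>

lemma upath_trans: assumes uv: "upath n u v" and vw: "upath n v w" shows "upath n u w"
proof -
  have v: "unit n v" by (rule upath_unit(2)[OF uv])
  have c: "u \<in> carrier_mat n n" "v \<in> carrier_mat n n" "w \<in> carrier_mat n n"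
    using upath_unit[OF uv] upath_unit[OF vw] by (auto simp: unit_def)
  have "upath n (u * (madj v * v)) (v * (madj v * w))"
    by (intro upath_mult uv vw upath_refl unit_adj v)
  moreover have "u * (madj v * v) = u" using v c by (simp add: unit_def)
  moreover have "v * (madj v * w) = w"
  proof -
    have "v * (madj v * w) = (v * madj v) * w"
      by (rule assoc_mult_mat[symmetric, of _ n n _ n _ n]) (use c in auto)
    also have "v * madj v = 1\<^sub>m n" using v by (simp add: unit_def)
    finally show ?thesis using c by simp
  qed
  ultimately show ?thesis by (simp only:)
qed

lemma mat_path_dsm:
  fixes \<gamma> \<delta> :: "real \<Rightarrow> 'a::unital_cstar mat"
  assumes c: "\<And>t. t \<in> {0..1} \<Longrightarrow> \<gamma> t \<in> carrier_mat m m" "\<And>t. t \<in> {0..1} \<Longrightarrow> \<delta> t \<in> carrier_mat n n"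
    and "mat_path m \<gamma>" "mat_path n \<delta>"
  shows "mat_path (m + n) (\<lambda>t. dsm (\<gamma> t) (\<delta> t))"
  unfolding mat_path_def
proof (intro allI impI)
  fix i j assume ij: "i < m + n" "j < m + n"
  have e: "dsm (\<gamma> t) (\<delta> t) $$ (i, j) = (if i < m then if j < m then \<gamma> t $$ (i, j) else 0
      else if j < m then 0 else \<delta> t $$ (i - m, j - m))" if "t \<in> {0..1}" for t
    using c[OF that] ij unfolding dsm_def by (subst index_mat_four_block) auto
  have "continuous_on {0..1} (\<lambda>t. if i < m then if j < m then \<gamma> t $$ (i, j) else 0
      else if j < m then 0 else \<delta> t $$ (i - m, j - m))"
    using assms(3,4) ij unfolding mat_path_def by (cases "i < m"; cases "j < m") auto
  then show "continuous_on {0..1} (\<lambda>t. dsm (\<gamma> t) (\<delta> t) $$ (i, j))"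
    by (simp add: e cong: continuous_on_cong_simp)
qed

lemma upath_dsm: assumes "upath m u v" "upath n u' v'" shows "upath (m + n) (dsm u u') (dsm v v')"
proof -
  obtain \<gamma> where g: "\<And>t. t \<in> {0..1} \<Longrightarrow> unit m (\<gamma> t)" "mat_path m \<gamma>" "\<gamma> 0 = u" "\<gamma> 1 = v"
    using assms(1) unfolding upath_def by blast
  obtain \<delta> where d: "\<And>t. t \<in> {0..1} \<Longrightarrow> unit n (\<delta> t)" "mat_path n \<delta>" "\<delta> 0 = u'" "\<delta> 1 = v'"
    using assms(2) unfolding upath_def by blast
  have "mat_path (m + n) (\<lambda>t. dsm (\<gamma> t) (\<delta> t))"
    by (rule mat_path_dsm) (use g d in \<open>auto simp: unit_def\<close>)
  then show ?thesis unfolding upath_def using g d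
    by (intro exI[of _ "\<lambda>t. dsm (\<gamma> t) (\<delta> t)"]) (simp add: unit_dsm)
qed

lemma (in star_morphism) map_mat_upath: assumes "upath n u v" shows "upath n (map_mat \<phi> u) (map_mat \<phi> v)"
proof -
  obtain \<gamma> where g: "\<And>t. t \<in> {0..1} \<Longrightarrow> unit n (\<gamma> t)" "mat_path n \<gamma>" "\<gamma> 0 = u" "\<gamma> 1 = v"
    using assms unfolding upath_def by blast
  have "continuous_on {0..1} (\<lambda>t. map_mat \<phi> (\<gamma> t) $$ (i, j))" if ij: "i < n" "j < n" for i j
  proof -
    have "continuous_on {0..1} (\<lambda>t. \<phi> (\<gamma> t $$ (i, j)))"
      using g(2) ij unfolding mat_path_def by (intro bounded_linear.continuous_on[OF bounded_linear]) blast
    moreover have "map_mat \<phi> (\<gamma> t) $$ (i, j) = \<phi> (\<gamma> t $$ (i, j))" if "t \<in> {0..1}" for t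
      using g(1)[OF that] ij by (auto simp: unit_def)
    ultimately show ?thesis by (simp cong: continuous_on_cong_simp)
  qed
  then show ?thesis unfolding upath_def using g
    by (intro exI[of _ "\<lambda>t. map_mat \<phi> (\<gamma> t)"]) (simp add: map_mat_unit mat_path_def)
qed

section \<open>Scalar matrices\<close>

lemma adj_complex [simp]: "adj (z :: complex) = cnj z"
  by (simp add: adj_complex_def)

definition mtr :: "'a::comm_monoid_add mat \<Rightarrow> 'a" where
  "mtr M = (\<Sum>i<dim_row M. M $$ (i, i))"

lemma mtr_mult_commute:
  fixes A B :: "complex mat"
  assumes "A \<in> carrier_mat k n" "B \<in> carrier_mat n k" shows "mtr (A * B) = mtr (B * A)"
proof -
  have "mtr (A * B) = (\<Sum>i<k. \<Sum>j<n. A $$ (i, j) * B $$ (j, i))"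
    using assms by (auto simp: mtr_def scalar_prod_def atLeast0LessThan)
  also have "\<dots> = (\<Sum>j<n. \<Sum>i<k. B $$ (j, i) * A $$ (i, j))"
    by (subst sum.swap) (simp add: mult.commute)
  also have "\<dots> = mtr (B * A)" using assms by (auto simp: mtr_def scalar_prod_def atLeast0LessThan)
  finally show ?thesis .
qed

lemma mtr_mvn:
  fixes P Q :: "complex mat"
  assumes "mvn P Q" shows "mtr P = mtr Q"
proof -
  obtain v where v: "v \<in> carrier_mat (dim_row Q) (dim_row P)" "madj v * v = P" "v * madj v = Q"
    using assms by (auto simp: mvn_def)
  show ?thesis using mtr_mult_commute[of "madj v" "dim_row P" "dim_row Q" v] v by simp
qed

lemma mtr_one [simp]: "mtr (1\<^sub>m k :: complex mat) = of_nat k"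
  by (simp add: mtr_def)

lemma mtr_dsm:
  fixes P Q :: "complex mat"
  assumes "P \<in> carrier_mat m m" "Q \<in> carrier_mat n n" shows "mtr (dsm P Q) = mtr P + mtr Q"
proof -
  have "mtr (dsm P Q) = (\<Sum>i<m + n. dsm P Q $$ (i, i))" using assms by (auto simp: mtr_def)
  also have "\<dots> = (\<Sum>i<m. dsm P Q $$ (i, i)) + (\<Sum>i<n. dsm P Q $$ (m + i, m + i))"
    by (induction n) (simp_all add: add.assoc)
  also have "\<dots> = mtr P + mtr Q" using assms by (auto simp: mtr_def dsm_def intro!: arg_cong2[of _ _ _ _ "(+)"] sum.cong)
  finally show ?thesis .
qed

text \<open>From P = P^* P: a diagonal entry is the squared length of its column.\<close>

lemma proj_diag:
  fixes P :: "complex mat"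
  assumes P: "proj n P" and j: "j < n"
  shows "P $$ (j, j) = of_real (\<Sum>i<n. (cmod (P $$ (i, j)))\<^sup>2)"
proof -
  have c: "P \<in> carrier_mat n n" using P by (simp add: proj_def)
  have "P $$ (j, j) = (madj P * P) $$ (j, j)" using P by (simp add: proj_def)
  also have "\<dots> = (\<Sum>i<n. cnj (P $$ (i, j)) * P $$ (i, j))"
    using c j by (auto simp: scalar_prod_def atLeast0LessThan)
  also have "\<dots> = of_real (\<Sum>i<n. (cmod (P $$ (i, j)))\<^sup>2)"
    by (simp add: complex_norm_square mult.commute del: of_real_power)
  finally show ?thesis .
qed

text \<open>The induction removes a rank one subprojection, which lowers the trace by one.\<close>

lemma complex_proj_mvn_one:
  fixes P :: "complex mat"
  assumes "proj n P" shows "\<exists>k. mvn P (1\<^sub>m k)"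
proof -
  \<comment> \<open>m is a strict upper bound for the trace. Traces of projections are nonnegative,
    so m = 0 is contradictory.\<close>
  have "proj n P \<Longrightarrow> Re (mtr P) < real m \<Longrightarrow> \<exists>k. mvn P (1\<^sub>m k)" for m and P :: "complex mat"
  proof (induction m arbitrary: P)
    case 0
    have "0 \<le> Re (mtr P)" unfolding mtr_def Re_sum
      using proj_diag[OF 0(1)] proj_dims[OF 0(1)] by (intro sum_nonneg) (auto simp: sum_nonneg)
    then show ?case using 0 by simp
  next
    case (Suc m)
    note P = Suc.prems(1)
    have c: "P \<in> carrier_mat n n" and idem: "P * P = P" using P by (auto simp: proj_def)
    show ?case
    proof (cases "\<forall>j<n. P $$ (j, j) = 0")
      case True
      have "P = 0\<^sub>m n n"
      proof (rule eq_matI)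
        fix i j assume "i < dim_row (0\<^sub>m n n :: complex mat)" "j < dim_col (0\<^sub>m n n :: complex mat)"
        then have ij: "i < n" "j < n" by simp_all
        have "of_real (\<Sum>i<n. (cmod (P $$ (i, j)))\<^sup>2) = (0 :: complex)" using proj_diag[OF P ij(2)] True ij by simp
        then have "(\<Sum>i<n. (cmod (P $$ (i, j)))\<^sup>2) = 0" by (simp only: of_real_eq_0_iff)
        then have "(cmod (P $$ (i, j)))\<^sup>2 = 0" using ij by (subst (asm) sum_nonneg_eq_0_iff) auto
        then show "P $$ (i, j) = 0\<^sub>m n n $$ (i, j)" using ij by simp
      qed (use c in auto)
      then have "mvn P (1\<^sub>m 0)" unfolding mvn_def by (intro bexI[of _ "0\<^sub>m 0 n"]) auto
      then show ?thesis by blast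
    next
      case False
      then obtain j where j: "j < n" "P $$ (j, j) \<noteq> 0" by blast
      define r where "r = (\<Sum>i<n. (cmod (P $$ (i, j)))\<^sup>2)"
      have r: "P $$ (j, j) = of_real r" unfolding r_def by (rule proj_diag[OF P j(1)])
      have "r \<ge> 0" unfolding r_def by (intro sum_nonneg) simp
      then have r0: "r > 0" using j r by (metis of_real_0 order_le_less)
      \<comment> \<open>x is the normalised j-th column, a unit vector in the range of P;
        \<open>x * madj x\<close> is the rank one projection to be split off.\<close>
      define x where "x = mat n 1 (\<lambda>(i, l). P $$ (i, j) / of_real (sqrt r))"
      have x: "x \<in> carrier_mat n 1" by (simp add: x_def)
      have xx: "madj x * x = 1\<^sub>m 1"
      proof (rule eq_matI)
        fix a b assume "a < dim_row (1\<^sub>m 1 :: complex mat)" "b < dim_col (1\<^sub>m 1 :: complex mat)"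
        then have ab: "a = 0" "b = 0" by simp_all
        have "(madj x * x) $$ (0, 0) = (\<Sum>i<n. cnj (P $$ (i, j)) * P $$ (i, j) / of_real r)"
          using r0 by (simp add: x_def scalar_prod_def atLeast0LessThan flip: of_real_mult)
        also have "\<dots> = of_real r / of_real r"
          unfolding sum_divide_distrib[symmetric] r_def
          by (simp add: complex_norm_square mult.commute del: of_real_power)
        finally show "(madj x * x) $$ (a, b) = 1\<^sub>m 1 $$ (a, b)" using r0 ab by simp
      qed (use x in auto)
      have Px: "P * x = x"
      proof (rule eq_matI)
        fix a b assume "a < dim_row x" "b < dim_col x"
        then have ab: "a < n" "b = 0" using x by auto
        have "(P * P) $$ (a, j) = (\<Sum>i<n. P $$ (a, i) * P $$ (i, j))"
          using c ab j by (auto simp: scalar_prod_def atLeast0LessThan)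
        then show "(P * x) $$ (a, b) = x $$ (a, b)"
          using c ab by (auto simp: x_def idem scalar_prod_def atLeast0LessThan sum_divide_distrib)
      qed (use c x in auto)
      define R where "R = x * madj x"
      have R: "R \<in> carrier_mat n n" using x by (simp add: R_def)
      have PR: "P * R = R" using c x Px by (simp add: R_def flip: assoc_mult_mat[of _ n n _ 1 _ n])
      have Radj: "madj R = R" using x by (auto simp: R_def madj_mult)
      have RP: "R * P = R"
      proof -
        have "madj (P * R) = madj R" by (simp add: PR)
        then show ?thesis using c R P by (simp add: madj_mult Radj proj_def)
      qed
      have RR: "R * R = R"
      proof -
        have "R * R = x * (madj x * x) * madj x"
          using x by (simp add: R_def assoc_mult_mat[of _ n 1 _ n _ n] assoc_mult_mat[of _ 1 n _ 1 _ n]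
             assoc_mult_mat[of _ n 1 _ 1 _ n])
        then show ?thesis using x by (simp add: xx R_def)
      qed
      let ?P = "P - R"
      have "?P * ?P = ?P"
        using c R by (simp add: minus_mult_distrib_mat[of _ n n _ _ n] mult_minus_distrib_mat[of _ n n _ n] idem PR RP RR)
          (auto intro!: eq_matI)
      then have P': "proj n ?P" using c R P by (auto simp: proj_def madj_minus Radj)
      have "mtr ?P = mtr P - mtr R" using c R by (auto simp: mtr_def sum_subtractf)
      moreover have "mtr R = 1" unfolding R_def using mtr_mult_commute[of x n 1 "madj x"] x by (simp add: xx)
      ultimately have "Re (mtr ?P) < real m" using Suc.prems(2) by simp
      then obtain k where "mvn ?P (1\<^sub>m k)" using Suc.IH[OF P'] by blast
      then obtain v where v: "v \<in> carrier_mat k n" "madj v * v = ?P" "v * madj v = 1\<^sub>m k"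
        using c R by (auto simp: mvn_def)
      have "?P * x = x - R * x" using c R x Px by (simp add: minus_mult_distrib_mat[of _ n n _ _ 1])
      also have "R * x = x" using x by (simp add: R_def assoc_mult_mat[of _ n 1 _ n _ 1] xx)
      finally have Px0: "?P * x = 0\<^sub>m n 1" using x by auto
      have vx: "v * x = 0\<^sub>m k 1"
      proof -
        have "v * x = (v * madj v) * (v * x)" using v x by simp
        also have "\<dots> = v * ((madj v * v) * x)"
          using v(1) x by (simp add: assoc_mult_mat[of _ k n _ k _ 1] assoc_mult_mat[of _ n k _ n _ 1])
        finally show ?thesis using v x by (simp add: Px0)
      qed
      have xv: "madj x * madj v = 0\<^sub>m 1 k"
      proof -
        have "madj (v * x) = madj x * madj v" using v x by (simp add: madj_mult)
        then show ?thesis by (simp add: vx)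
      qed
      \<comment> \<open>The row \<open>madj x\<close> below v sends the split-off direction to one
        new coordinate; the blocks of width 0 put this stacking into the form of a block
        matrix.\<close>
      let ?w = "four_block_mat v (0\<^sub>m k 0) (madj x) (0\<^sub>m 1 0)"
      have aw: "madj ?w = four_block_mat (madj v) x (0\<^sub>m 0 k) (0\<^sub>m 0 1)"
        using v x by (subst madj_four_block[of _ k n _ 0 _ 1]) auto
      have "madj ?w * ?w = four_block_mat P (0\<^sub>m n 0) (0\<^sub>m 0 n) (0\<^sub>m 0 0)"
        unfolding aw using v x c R
        by (subst mult_four_block_mat[of _ n k _ 1 _ 0 _ _ n _ 0]) (auto simp: R_def[symmetric] intro!: cong_four_block_mat eq_matI)
      also have "\<dots> = P" using c by (intro eq_matI) auto
      finally have 1: "madj ?w * ?w = P" .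
      have "?w * madj ?w = four_block_mat (1\<^sub>m k) (0\<^sub>m k 1) (0\<^sub>m 1 k) (1\<^sub>m 1)"
        unfolding aw using v x
        by (subst mult_four_block_mat[of _ k n _ 0 _ 1 _ _ k _ 1]) (auto simp: vx xv xx intro!: cong_four_block_mat)
      then have 2: "?w * madj ?w = 1\<^sub>m (k + 1)" by simp
      have "?w \<in> carrier_mat (k + 1) (n + 0)" by (rule four_block_carrier_mat) (use v in auto)
      then have "mvn P (1\<^sub>m (k + 1))" unfolding mvn_def using 1 2 c by (intro bexI[of _ ?w]) auto
      then show ?thesis by blast
    qed
  qed
  moreover obtain m where "Re (mtr P) < real m" using reals_Archimedean2 by blast
  ultimately show ?thesis using assms by blast
qed

lemma complex_proj_rank: "proj n (P :: complex mat) \<Longrightarrow> \<exists>k. mtr P = of_nat k"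
  using complex_proj_mvn_one mtr_mvn by (metis mtr_one)

lemma complex_proj_mvn:
  fixes P Q :: "complex mat"
  assumes "proj m P" "proj n Q" "mtr P = mtr Q" shows "mvn P Q"
proof -
  obtain k l where k: "mvn P (1\<^sub>m k)" "mvn Q (1\<^sub>m l)" using complex_proj_mvn_one assms by metis
  then have "of_nat k = (of_nat l :: complex)" using assms(3) mtr_mvn by (metis mtr_one)
  then have "mvn (1\<^sub>m k) Q" using k(2) by (simp add: mvn_sym)
  then show ?thesis using mvn_trans[OF k(1) _ assms(1) proj_one assms(2)] by blast
qed

text \<open>The scalar on the range of Q moves along the unit circle from 1 to l. The map sending z
  to 1 + (z - 1) Q is multiplicative and compatible with adjoints, so the path stays
  unitary.\<close>

lemma upath_reflection:
  fixes Q :: "complex mat"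
  assumes Q: "proj n Q" and l: "cmod l = 1"
  shows "upath n (1\<^sub>m n) (1\<^sub>m n + (l - 1) \<cdot>\<^sub>m Q)"
proof -
  have c: "Q \<in> carrier_mat n n" "Q * Q = Q" "madj Q = Q" using Q by (auto simp: proj_def)
  let ?g = "\<lambda>z. 1\<^sub>m n + (z - 1) \<cdot>\<^sub>m Q"
  have mult: "?g z * ?g w = ?g (z * w)" for z w
  proof -
    have "?g z * ?g w = 1\<^sub>m n + (w - 1) \<cdot>\<^sub>m Q + ((z - 1) \<cdot>\<^sub>m Q + (z - 1) \<cdot>\<^sub>m ((w - 1) \<cdot>\<^sub>m Q))"
      using c by (simp add: add_mult_distrib_mat[of _ n n _ _ n] mult_add_distrib_mat[of _ n n _ n]
          mult_smult_distrib[of _ n n _ n] mult_smult_assoc_mat[of _ n n _ n])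
        (use c in \<open>auto intro!: eq_matI simp: algebra_simps\<close>)
    also have "\<dots> = ?g (z * w)" using c by (intro eq_matI) (auto simp: algebra_simps)
    finally show ?thesis .
  qed
  have adj: "madj (?g z) = ?g (cnj z)" for z
  proof (rule eq_matI)
    fix i j assume "i < dim_row (?g (cnj z))" "j < dim_col (?g (cnj z))"
    then have ij: "i < n" "j < n" using c by auto
    have "cnj (Q $$ (j, i)) = Q $$ (i, j)" using c ij by (metis adj_complex carrier_matD madj_index)
    then show "madj (?g z) $$ (i, j) = ?g (cnj z) $$ (i, j)" using c ij by auto
  qed (use c in auto)
  have one: "?g 1 = 1\<^sub>m n" using c by (intro eq_matI) auto
  have unit: "unit n (?g z)" if "cmod z = 1" for z
  proof -
    have "cnj z * z = 1" "z * cnj z = 1" using that by (simp_all add: complex_norm_square[symmetric] mult.commute[of "cnj z"])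
    then show ?thesis using c one by (simp add: unit_def adj mult)
  qed
  obtain \<theta> where \<theta>: "l = cis \<theta>" using rcis_cmod_Arg[of l] l by (metis rcis_def of_real_1 mult_1)
  show ?thesis unfolding upath_def
  proof (intro exI[of _ "\<lambda>t. ?g (cis (\<theta> * t))"] conjI ballI)
    show "mat_path n (\<lambda>t. ?g (cis (\<theta> * t)))"
      unfolding mat_path_def using c by (auto intro!: continuous_intros)
  qed (use one in \<open>simp_all add: unit \<theta>\<close>)
qed

lemma unit_zero_dim: "unit 0 u \<Longrightarrow> u = 1\<^sub>m 0"
  by (auto simp: unit_def)

text \<open>Elimination by complex reflections: a reflection connected to 1 turns column 0 into the
  basis vector e_0, unitarity then clears row 0, and the remaining block is handled by induction on
  the size.\<close>

lemma complex_unit_path: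
  fixes u :: "complex mat"
  assumes "unit n u" shows "upath n u (1\<^sub>m n)"
  using assms
proof (induction n arbitrary: u)
  case 0
  then show ?case using unit_zero_dim upath_refl unit_one by metis
next
  case (Suc n)
  note u = Suc.prems
  have c: "u \<in> carrier_mat (Suc n) (Suc n)" using u by (simp add: unit_def)
  let ?x = "\<lambda>i. u $$ (i, 0)"
  have "(madj u * u) $$ (0, 0) = (\<Sum>i<Suc n. cnj (?x i) * ?x i)"
    using c by (auto simp: scalar_prod_def atLeast0LessThan simp del: sum.lessThan_Suc)
  then have norm_x: "(\<Sum>i<Suc n. cnj (?x i) * ?x i) = 1" using u by (simp add: unit_def del: sum.lessThan_Suc)
  have "\<exists>g. upath (Suc n) (1\<^sub>m (Suc n)) g \<and> (\<forall>i<Suc n. (g * u) $$ (i, 0) = (if i = 0 then 1 else 0))"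
  proof (cases "?x 0 = 1")
    case True
    have "(\<Sum>i<Suc n. cnj (?x i) * ?x i) = 1 + (\<Sum>i<n. cnj (?x (Suc i)) * ?x (Suc i))"
      using True by (subst sum.lessThan_Suc_shift) simp
    then have "(\<Sum>i<n. cnj (?x (Suc i)) * ?x (Suc i)) = 0" using norm_x by simp
    then have "of_real (\<Sum>i<n. (cmod (?x (Suc i)))\<^sup>2) = (0 :: complex)"
      by (simp add: complex_norm_square mult.commute del: of_real_power)
    then have "(\<Sum>i<n. (cmod (?x (Suc i)))\<^sup>2) = 0" by (simp only: of_real_eq_0_iff)
    then have "\<forall>i<n. ?x (Suc i) = 0" by (subst (asm) sum_nonneg_eq_0_iff) auto
    then have "\<forall>i<Suc n. ?x i = (if i = 0 then 1 else 0)" using True by (auto simp: less_Suc_eq_0_disj)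
    then show ?thesis using c by (intro exI[of _ "1\<^sub>m (Suc n)"]) (simp add: upath_refl unit_one)
  next
    case False
    \<comment> \<open>y = x - e_0, for x the column 0 of u, is the direction along which the
      reflection has to act.\<close>
    define y where "y i = ?x i - (if i = 0 then 1 else 0)" for i
    have yx: "(\<Sum>i<Suc n. cnj (y i) * ?x i) = 1 - ?x 0"
    proof -
      have "(\<Sum>i<Suc n. cnj (y i) * ?x i) = (\<Sum>i<Suc n. cnj (?x i) * ?x i - (if i = 0 then ?x 0 else 0))"
        by (intro sum.cong) (auto simp: y_def algebra_simps)
      also have "\<dots> = 1 - (\<Sum>i<Suc n. if i = 0 then ?x 0 else 0)"
        by (simp only: sum_subtractf norm_x)
      also have "(\<Sum>i<Suc n. if i = 0 then ?x 0 else 0) = ?x 0" by (simp add: sum.delta)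
      finally show ?thesis .
    qed
    define s where "s = (\<Sum>i<Suc n. cnj (y i) * y i)"
    have s_eq: "s = (1 - ?x 0) + cnj (1 - ?x 0)"
    proof -
      have "s = (\<Sum>i<Suc n. cnj (y i) * ?x i - (if i = 0 then cnj (y 0) else 0))"
        unfolding s_def by (intro sum.cong) (auto simp: y_def algebra_simps)
      also have "\<dots> = (1 - ?x 0) - (\<Sum>i<Suc n. if i = 0 then cnj (y 0) else 0)"
        by (simp only: sum_subtractf yx)
      also have "(\<Sum>i<Suc n. if i = 0 then cnj (y 0) else 0) = cnj (y 0)" by (simp add: sum.delta)
      finally show ?thesis by (simp add: y_def)
    qed
    have s_real: "s = of_real (\<Sum>i<Suc n. (cmod (y i))\<^sup>2)"
      unfolding s_def by (simp add: complex_norm_square mult.commute del: of_real_power sum.lessThan_Suc)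
    have s0: "s \<noteq> 0"
    proof
      assume "s = 0"
      then have "(\<Sum>i<Suc n. (cmod (y i))\<^sup>2) = 0" unfolding s_real by (simp only: of_real_eq_0_iff)
      then have "(cmod (y 0))\<^sup>2 = 0" by (subst (asm) sum_nonneg_eq_0_iff) auto
      then show False using False by (simp add: y_def)
    qed
    have cs: "cnj s = s" unfolding s_real by simp
    define Q where "Q = mat (Suc n) (Suc n) (\<lambda>(i, j). y i * cnj (y j) / s)"
    have Q: "proj (Suc n) Q"
      unfolding proj_def
    proof (intro conjI)
      show "Q \<in> carrier_mat (Suc n) (Suc n)" by (simp add: Q_def)
      show "madj Q = Q" by (rule eq_matI) (auto simp: Q_def cs)
      show "Q * Q = Q"
      proof (rule eq_matI)
        fix i j assume "i < dim_row Q" "j < dim_col Q"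
        then have ij: "i < Suc n" "j < Suc n" by (simp_all add: Q_def)
        have "(Q * Q) $$ (i, j) = (\<Sum>k<Suc n. (y i * cnj (y j) / (s * s)) * (cnj (y k) * y k))"
          using ij by (simp add: Q_def scalar_prod_def atLeast0LessThan mult.commute mult.left_commute del: sum.lessThan_Suc)
        also have "\<dots> = (y i * cnj (y j) / (s * s)) * s" unfolding s_def by (rule sum_distrib_left[symmetric])
        finally show "(Q * Q) $$ (i, j) = Q $$ (i, j)" using ij s0 by (simp add: Q_def)
      qed (simp_all add: Q_def)
    qed
    \<comment> \<open>Forced by g x = x - y: the component of x along y has coefficient (1 - x_0) /
      s, and l - 1 is minus its inverse. The modulus is 1 because s is the sum of 1 - x_0 and its
      conjugate.\<close>
    define l where "l = 1 - s / (1 - ?x 0)"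
    have "l = - (cnj (1 - ?x 0) / (1 - ?x 0))"
      unfolding l_def s_eq using False by (simp add: field_simps)
    then have l: "cmod l = 1" using False by (simp add: norm_divide del: complex_cnj_diff)
    let ?g = "1\<^sub>m (Suc n) + (l - 1) \<cdot>\<^sub>m Q"
    have "(?g * u) $$ (i, 0) = (if i = 0 then 1 else 0)" if i: "i < Suc n" for i
    proof -
      have "(?g * u) $$ (i, 0) = (u + (l - 1) \<cdot>\<^sub>m (Q * u)) $$ (i, 0)"
        using c Q by (simp add: proj_def add_mult_distrib_mat[of _ "Suc n" "Suc n" _ _ "Suc n"] mult_smult_assoc_mat[of _ "Suc n" "Suc n" _ "Suc n"])
      also have "\<dots> = ?x i + (l - 1) * (\<Sum>k<Suc n. Q $$ (i, k) * ?x k)"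
        using c i by (auto simp: Q_def scalar_prod_def atLeast0LessThan simp del: sum.lessThan_Suc)
      also have "(\<Sum>k<Suc n. Q $$ (i, k) * ?x k) = (\<Sum>k<Suc n. (y i / s) * (cnj (y k) * ?x k))"
        using i by (intro sum.cong) (simp_all add: Q_def)
      also have "\<dots> = (y i / s) * (1 - ?x 0)" unfolding yx[symmetric] by (rule sum_distrib_left[symmetric])
      also have "?x i + (l - 1) * ((y i / s) * (1 - ?x 0)) = ?x i - y i"
        using False s0 by (simp add: l_def)
      finally show ?thesis by (simp add: y_def)
    qed
    then show ?thesis using upath_reflection[OF Q l] by blast
  qed
  then obtain g where g: "upath (Suc n) (1\<^sub>m (Suc n)) g" "\<And>i. i < Suc n \<Longrightarrow> (g * u) $$ (i, 0) = (if i = 0 then 1 else 0)"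
    by blast
  have ug: "unit (Suc n) g" by (rule upath_unit(2)[OF g(1)])
  define w where "w = g * u"
  have w: "unit (Suc n) w" unfolding w_def by (rule unit_mult[OF ug u])
  have wc: "w \<in> carrier_mat (Suc n) (Suc n)" using w by (simp add: unit_def)
  have w0: "w $$ (i, 0) = (if i = 0 then 1 else 0)" if "i < Suc n" for i using g(2)[OF that] by (simp add: w_def)
  \<comment> \<open>Row 0 has length 1, and its entry in column 0 is already 1.\<close>
  have "w $$ (0, Suc j) = 0" if "j < n" for j
  proof -
    have "(w * madj w) $$ (0, 0) = (\<Sum>k<Suc n. w $$ (0, k) * cnj (w $$ (0, k)))"
      using wc by (auto simp: scalar_prod_def atLeast0LessThan simp del: sum.lessThan_Suc)
    then have "1 = 1 + (\<Sum>k<n. w $$ (0, Suc k) * cnj (w $$ (0, Suc k)))"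
      using w w0[of 0] by (simp add: unit_def sum.lessThan_Suc_shift del: sum.lessThan_Suc)
    then have "of_real (\<Sum>k<n. (cmod (w $$ (0, Suc k)))\<^sup>2) = (0 :: complex)"
      by (simp add: complex_norm_square del: of_real_power)
    then have "(\<Sum>k<n. (cmod (w $$ (0, Suc k)))\<^sup>2) = 0" by (simp only: of_real_eq_0_iff)
    then show ?thesis using that by (subst (asm) sum_nonneg_eq_0_iff) auto
  qed
  note w0' = this
  define w' where "w' = mat n n (\<lambda>(i, j). w $$ (Suc i, Suc j))"
  have w'c: "w' \<in> carrier_mat n n" by (simp add: w'_def)
  have w_eq: "w = dsm (1\<^sub>m 1) w'"
  proof (rule eq_matI)
    fix i j assume "i < dim_row (dsm (1\<^sub>m 1) w')" "j < dim_col (dsm (1\<^sub>m 1) w')"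
    then have ij: "i < Suc n" "j < Suc n" by (auto simp: w'_def)
    show "w $$ (i, j) = dsm (1\<^sub>m 1) w' $$ (i, j)"
      using ij w0[OF ij(1)] w0' by (cases i; cases j) (auto simp: dsm_def w'_def)
  qed (use wc in \<open>auto simp: w'_def\<close>)
  have inj: "A = 1\<^sub>m n" if "A \<in> carrier_mat n n" "dsm (1\<^sub>m 1) A = 1\<^sub>m (Suc n)" for A :: "complex mat"
  proof (rule eq_matI)
    fix i j assume "i < dim_row (1\<^sub>m n :: complex mat)" "j < dim_col (1\<^sub>m n :: complex mat)"
    then have ij: "i < n" "j < n" by simp_all
    have "dsm (1\<^sub>m 1) A $$ (Suc i, Suc j) = A $$ (i, j)" using that(1) ij by (auto simp: dsm_def)
    then show "A $$ (i, j) = 1\<^sub>m n $$ (i, j)" using that(2) ij by simp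
  qed (use that in auto)
  have "unit n w'"
    using w w'c unfolding w_eq unit_def by (auto simp: dsm_madj dsm_mult intro!: inj)
  then have "upath (1 + n) (dsm (1\<^sub>m 1) w') (dsm (1\<^sub>m 1) (1\<^sub>m n))"
    by (intro upath_dsm upath_refl unit_one Suc.IH)
  then have wp: "upath (Suc n) (g * u) (1\<^sub>m (Suc n))" unfolding dsm_one w_eq[symmetric] w_def by simp
  have "upath (Suc n) (madj g * (g * u)) (madj g * 1\<^sub>m (Suc n))"
    by (intro upath_mult wp upath_refl unit_adj ug)
  moreover have "madj g * (g * u) = u"
  proof -
    have "madj g * (g * u) = (madj g * g) * u"
      by (rule assoc_mult_mat[symmetric, of _ "Suc n" "Suc n" _ "Suc n" _ "Suc n"]) (use c ug in \<open>auto simp: unit_def\<close>)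
    also have "madj g * g = 1\<^sub>m (Suc n)" using ug by (simp add: unit_def)
    finally show ?thesis using c by simp
  qed
  moreover have "upath (Suc n) (madj g * 1\<^sub>m (Suc n)) (madj g * g)"
    by (intro upath_mult g(1) upath_refl unit_adj ug)
  moreover have "madj g * g = 1\<^sub>m (Suc n)" using ug by (simp add: unit_def)
  ultimately show ?case using upath_trans by metis
qed

section \<open>The universal C*-algebra of three projections\<close>

datatype refl_gen = W1 | W2 | W3

text \<open>Symmetries serve as generators because they are what the crossed product offers; a
  symmetry w and the projection (1 + w) / 2 determine each other.\<close>

definition refl_rels :: "refl_gen free_star set" where
  "refl_rels = (\<Union>g. {adjoint (gen g) - gen g, gen g * gen g - 1})"

text \<open>Symmetries are unitary: modulo the relations \<open>adjoint (gen g) * gen g\<close> is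
  1, so the square of p (gen g) is at most p 1 <= 1.\<close>

lemma admissible_refl_rels: "admissible refl_rels"
  unfolding admissible_def
proof
  fix g
  have "p (gen g) \<le> 1" if p: "p \<in> cstar_seminorms refl_rels" for p
  proof -
    interpret cstar_seminorm p using p by (simp add: cstar_seminorm_def cstar_seminorms_def)
    have "p (adjoint (gen g) - gen g) = 0" "p (gen g * gen g - 1) = 0"
      using p by (auto simp: cstar_seminorms_def refl_rels_def)
    moreover have "adjoint (gen g) * gen g = (adjoint (gen g) - gen g) * gen g + ((gen g * gen g - 1) + 1)"
      by (simp add: algebra_simps)
    then have "(p (gen g))\<^sup>2 \<le> p (adjoint (gen g) - gen g) * p (gen g) + (p (gen g * gen g - 1) + p 1)"
      using tri_le[OF N_mult tri] by (metis N_cstar)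
    moreover have "p 1 * p 1 = p 1" using N_cstar[of 1] by (simp add: power2_eq_square)
    then have "p 1 \<le> 1" by auto
    ultimately have "(p (gen g))\<^sup>2 \<le> 1\<^sup>2" by simp
    then show ?thesis by (rule power2_le_imp_le) simp
  qed
  then show "bdd_above ((\<lambda>p. p (gen g)) ` cstar_seminorms refl_rels)"
    by (auto simp: bdd_above_def)
qed

instantiation refl_gen :: star_relations
begin
definition "relations = refl_rels"
instance
proof
  show "admissible (relations :: refl_gen free_star set)"
    by (simp add: relations_refl_gen_def admissible_refl_rels)
  show "universal_seminorm (relations :: refl_gen free_star set) 1 \<noteq> 0"
    unfolding relations_refl_gen_def
    by (rule universal_nontrivial[OF admissible_refl_rels, of "\<lambda>g. 1 :: complex"]) (auto simp: refl_rels_def)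
qed
end

instantiation f2_gen :: star_relations
begin
definition "relations = free_group_rels"
instance
proof
  show "admissible (relations :: f2_gen free_star set)"
    by (simp add: relations_f2_gen_def admissible_free_group_rels)
  show "universal_seminorm (relations :: f2_gen free_star set) 1 \<noteq> 0"
    unfolding relations_f2_gen_def
    by (rule universal_nontrivial[OF admissible_free_group_rels, of "\<lambda>g. 1 :: complex"]) (auto simp: free_group_rels_def)
qed
end

type_synonym refl_algebra = "refl_gen ucstar"

lemma ugen_refl: "adj (ugen g) = (ugen g :: refl_algebra)" "ugen g * ugen g = (1 :: refl_algebra)"
proof -
  have "adjoint (gen g) - gen g \<in> relations" "gen g * gen g - 1 \<in> relations"
    by (auto simp: relations_refl_gen_def refl_rels_def)
  from this[THEN eval_at_relation] show "adj (ugen g) = (ugen g :: refl_algebra)" "ugen g * ugen g = (1 :: refl_algebra)"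
    by simp_all
qed

section \<open>Projections as generators, characters and restrictions\<close>

definition isp :: "'a::unital_cstar \<Rightarrow> bool" where
  "isp p \<longleftrightarrow> adj p = p \<and> p * p = p"

lemma isp_simps [simp]: "isp 0" "isp 1" by (simp_all add: isp_def)

definition pr :: "refl_gen \<Rightarrow> refl_algebra" where
  "pr g = (1/2) *\<^sub>R (1 + ugen g)"

lemma isp_pr [simp]: "isp (pr g)"
  by (simp add: isp_def pr_def adj_scaleR adj_add ugen_refl algebra_simps flip: scaleR_2)

lemma ugen_pr: "ugen g = 2 *\<^sub>R pr g - 1"
  by (simp add: pr_def)

lemma refl_algebra_universal:
  fixes q :: "refl_gen \<Rightarrow> 'a::unital_cstar"
  assumes "\<And>g. isp (q g)"
  shows "\<exists>\<phi>. star_morphism \<phi> \<and> (\<forall>g. \<phi> (pr g) = q g)"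
proof -
  let ?f = "\<lambda>g. 2 *\<^sub>R q g - 1"
  have f: "adj (?f g) = ?f g" "?f g * ?f g = 1" for g
  proof -
    have "4 *\<^sub>R q g = 2 *\<^sub>R q g + 2 *\<^sub>R q g" by (simp flip: scaleR_add_left)
    then show "adj (?f g) = ?f g" "?f g * ?f g = 1"
      using assms[of g] by (simp_all add: isp_def adj_diff adj_scaleR algebra_simps)
  qed
  have "eval_at ?f r = 0" if "r \<in> relations" for r
    using that f by (auto simp: relations_refl_gen_def refl_rels_def)
  then obtain \<phi> where \<phi>: "star_morphism \<phi>" "\<And>g. \<phi> (ugen g) = ?f g" using ucstar_universal by blast
  interpret star_morphism \<phi> by fact
  have "\<phi> (pr g) = q g" for g by (simp add: pr_def scaleR add \<phi>(2))
  then show ?thesis using \<phi>(1) by blast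
qed

text \<open>The choice is harmless: by \<open>lift_unique\<close> the images of the three
  projections determine the morphism.\<close>

definition lift :: "(refl_gen \<Rightarrow> 'a::unital_cstar) \<Rightarrow> refl_algebra \<Rightarrow> 'a" where
  "lift q = (SOME \<phi>. star_morphism \<phi> \<and> (\<forall>g. \<phi> (pr g) = q g))"

lemma lift:
  assumes "\<And>g. isp (q g)" shows "star_morphism (lift q)" "lift q (pr g) = q g"
  using someI_ex[OF refl_algebra_universal[of q]] assms unfolding lift_def by auto

lemma lift_unique:
  assumes "star_morphism \<phi>" "\<And>g. isp (q g)" "\<And>g. \<phi> (pr g) = q g"
  shows "lift q x = \<phi> x"
proof (rule star_morphism_eq[OF lift(1) assms(1)])
  fix g
  have "lift q (2 *\<^sub>R pr g - 1) = \<phi> (2 *\<^sub>R pr g - 1)"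
    by (simp add: star_morphism.diff star_morphism.scaleR star_morphism.one lift assms)
  then show "lift q (ugen g) = \<phi> (ugen g)" by (simp add: ugen_pr)
qed (rule assms)

definition character :: "refl_gen set \<Rightarrow> refl_algebra \<Rightarrow> complex" where
  "character S = lift (\<lambda>g. if g \<in> S then 1 else 0)"

text \<open>The endomorphism \<open>e\<^sub>S\<close> of the overview; being unital, it keeps the
  scalars.\<close>

definition restrict_to :: "refl_gen set \<Rightarrow> refl_algebra \<Rightarrow> refl_algebra" where
  "restrict_to S = lift (\<lambda>g. if g \<in> S then pr g else 0)"

lemma character: "star_morphism (character S)" "character S (pr g) = (if g \<in> S then 1 else 0)"
  unfolding character_def by (rule lift; simp)+

lemma restrict_to: "star_morphism (restrict_to S)" "restrict_to S (pr g) = (if g \<in> S then pr g else 0)"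
  unfolding restrict_to_def by (rule lift; simp)+

lemma restrict_to_eqI:
  "star_morphism \<phi> \<Longrightarrow> (\<And>g. \<phi> (pr g) = (if g \<in> S then pr g else 0)) \<Longrightarrow> restrict_to S x = \<phi> x"
  unfolding restrict_to_def by (rule lift_unique) simp_all

lemma restrict_to_restrict_to: "restrict_to S (restrict_to T x) = restrict_to (T \<inter> S) x"
  by (rule restrict_to_eqI[symmetric])
    (simp_all add: star_morphism_comp restrict_to star_morphism.zero)

text \<open>The image of (a, b) under the unital homomorphism from C + C that sends (1, 0) to p. Its
  range is the commutative algebra spanned by p and 1 - p.\<close>

definition mix :: "'a::unital_cstar \<Rightarrow> complex \<Rightarrow> complex \<Rightarrow> 'a" where
  "mix p a b = cs a * p + cs b * (1 - p)"

lemma mix_add: "mix p (a + c) (b + d) = mix p a b + mix p c d"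
  by (simp add: mix_def cs_add algebra_simps)

lemma mix_zero [simp]: "mix p 0 0 = 0"
  by (simp add: mix_def)

lemma mix_same: "mix p a a = cs a"
  by (simp add: mix_def flip: distrib_left)

lemma mix_sum: "mix p (sum f S) (sum g S) = (\<Sum>x\<in>S. mix p (f x) (g x))"
  by (induction S rule: infinite_finite_induct) (simp_all add: mix_add)

lemma mix_mult:
  assumes "isp p" shows "mix p a b * mix p c d = mix p (a * c) (b * d)"
proof -
  have p: "p * p = p" using assms by (simp add: isp_def)
  have *: "cs a * x * (cs c * y) = cs (a * c) * (x * y)" for a c and x y :: 'a
    unfolding cs_times by (metis cs_comm mult.assoc)
  have "mix p a b * mix p c d = cs (a * c) * (p * p) + cs (b * c) * ((1 - p) * p)
      + (cs (a * d) * (p * (1 - p)) + cs (b * d) * ((1 - p) * (1 - p)))"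
    by (simp only: mix_def distrib_left distrib_right *)
  moreover have "p * (1 - p) = 0" "(1 - p) * p = 0" "(1 - p) * (1 - p) = 1 - p"
    by (simp_all add: algebra_simps p)
  ultimately show ?thesis by (simp add: p mix_def)
qed

lemma mix_adj: "isp p \<Longrightarrow> adj (mix p a b) = mix p (cnj a) (cnj b)"
  by (simp add: mix_def adj_add adj_mult adj_diff isp_def cs_adj cs_comm)

lemma cs_mult_mix: "cs c * mix p a b = mix p (c * a) (c * b)"
  by (simp add: mix_def cs_times distrib_left mult.assoc)

lemma star_morphism_mix:
  assumes "isp p" "star_morphism \<phi>" "star_morphism \<psi>" shows "star_morphism (\<lambda>x. mix p (\<phi> x) (\<psi> x))"
proof -
  interpret \<phi>: star_morphism \<phi> by fact
  interpret \<psi>: star_morphism \<psi> by fact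
  show ?thesis
    by standard (simp_all add: \<phi>.add \<psi>.add mix_add \<phi>.mult \<psi>.mult mix_mult assms(1) mix_same
        \<phi>.cs \<psi>.cs cs_mult_mix \<phi>.star \<psi>.star mix_adj)
qed

text \<open>With one projection left, the restriction factors through C + C, and its two coordinates
  are characters.\<close>

lemma restrict_to_singleton: "restrict_to {i} x = mix (pr i) (character {i} x) (character {} x)"
proof (rule restrict_to_eqI)
  show "star_morphism (\<lambda>x. mix (pr i) (character {i} x) (character {} x))"
    by (rule star_morphism_mix[OF isp_pr character(1) character(1)])
qed (simp add: character(2) mix_def)

lemma restrict_to_empty: "restrict_to {} x = cs (character {} x)"
  by (rule restrict_to_eqI) (auto simp: star_morphism_comp star_morphism_cs character)

text \<open>A matrix over C + C, given as a pair of complex matrices, pushed forward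
  entrywise.\<close>

definition tens :: "'a::unital_cstar \<Rightarrow> complex mat \<Rightarrow> complex mat \<Rightarrow> 'a mat" where
  "tens p M N = mat (dim_row M) (dim_col M) (\<lambda>(i, j). mix p (M $$ (i, j)) (N $$ (i, j)))"

lemma tens_dim [simp]: "dim_row (tens p M N) = dim_row M" "dim_col (tens p M N) = dim_col M"
  by (simp_all add: tens_def)

lemma tens_mult:
  assumes "isp p" "M \<in> carrier_mat l m" "N \<in> carrier_mat l m" "M' \<in> carrier_mat m n" "N' \<in> carrier_mat m n"
  shows "tens p M N * tens p M' N' = tens p (M * M') (N * N')"
  using assms by (intro eq_matI) (auto simp: tens_def scalar_prod_def mix_sum mix_mult)

lemma tens_madj:
  assumes "isp p" "M \<in> carrier_mat l m" "N \<in> carrier_mat l m"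
  shows "madj (tens p M N) = tens p (madj M) (madj N)"
  using assms by (intro eq_matI) (auto simp: tens_def mix_adj)

lemma tens_one: "tens p (1\<^sub>m n) (1\<^sub>m n) = 1\<^sub>m n"
  by (intro eq_matI) (auto simp: tens_def mix_same)

lemma tens_unit: "isp p \<Longrightarrow> unit n M \<Longrightarrow> unit n N \<Longrightarrow> unit n (tens p M N)"
  by (auto simp: unit_def tens_madj tens_mult[of _ _ n n _ _ n] tens_one intro: carrier_matI)

lemma tens_mvn:
  assumes p: "isp p" and MM: "mvn M M'" and NN: "mvn N N'"
    and M: "M \<in> carrier_mat m m" "N \<in> carrier_mat m m" and M': "M' \<in> carrier_mat n n" "N' \<in> carrier_mat n n"
  shows "mvn (tens p M N) (tens p M' N')"
proof -
  obtain v where v: "v \<in> carrier_mat n m" "madj v * v = M" "v * madj v = M'"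
    using MM M M' by (auto simp: mvn_def)
  obtain w where w: "w \<in> carrier_mat n m" "madj w * w = N" "w * madj w = N'"
    using NN M M' by (auto simp: mvn_def)
  have "madj (tens p v w) * tens p v w = tens p M N"
    using v w by (simp add: tens_madj[OF p v(1) w(1)] tens_mult[OF p, of _ m n _ _ m])
  moreover have "tens p v w * madj (tens p v w) = tens p M' N'"
    using v w by (simp add: tens_madj[OF p v(1) w(1)] tens_mult[OF p, of _ n m _ _ n])
  ultimately show ?thesis unfolding mvn_def
    by (intro bexI[of _ "tens p v w"]) (use v M M' in \<open>auto intro!: carrier_matI\<close>)
qed

lemma tens_upath:
  assumes p: "isp p" and M: "upath n M (1\<^sub>m n)" and N: "upath n N (1\<^sub>m n)"
  shows "upath n (tens p M N :: 'a::unital_cstar mat) (1\<^sub>m n)"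
proof -
  obtain \<gamma> where g: "\<And>t. t \<in> {0..1} \<Longrightarrow> unit n (\<gamma> t)" "mat_path n \<gamma>" "\<gamma> 0 = M" "\<gamma> 1 = 1\<^sub>m n"
    using M unfolding upath_def by blast
  obtain \<delta> where d: "\<And>t. t \<in> {0..1} \<Longrightarrow> unit n (\<delta> t)" "mat_path n \<delta>" "\<delta> 0 = N" "\<delta> 1 = 1\<^sub>m n"
    using N unfolding upath_def by blast
  have "continuous_on {0..1} (\<lambda>t. tens p (\<gamma> t) (\<delta> t) $$ (i, j))" if ij: "i < n" "j < n" for i j
  proof -
    have "continuous_on {0..1} (\<lambda>t. mix p (\<gamma> t $$ (i, j)) (\<delta> t $$ (i, j)))"
      unfolding mix_def using g(2) d(2) ij unfolding mat_path_def by (intro continuous_intros) blast+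
    moreover have "tens p (\<gamma> t) (\<delta> t) $$ (i, j) = mix p (\<gamma> t $$ (i, j)) (\<delta> t $$ (i, j))" if "t \<in> {0..1}" for t
      using g(1)[OF that] ij by (auto simp: unit_def tens_def)
    ultimately show ?thesis by (simp cong: continuous_on_cong_simp)
  qed
  then show ?thesis unfolding upath_def using g d
    by (intro exI[of _ "\<lambda>t. tens p (\<gamma> t) (\<delta> t)"]) (simp add: tens_unit[OF p] mat_path_def tens_one)
qed

lemma map_restrict_to_singleton:
  "map_mat (restrict_to {i}) P = tens (pr i) (map_mat (character {i}) P) (map_mat (character {}) P)"
  by (rule eq_matI) (auto simp: tens_def restrict_to_singleton)

text \<open>The rotation homotopy: the projection \<open>pr i\<close> moves from the first to the second diagonal
  entry while the others stay in the first one. Freeness allows to move them independently.\<close>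

definition rot_pr :: "real \<Rightarrow> 'a::unital_cstar \<Rightarrow> 'a m2" where
  "rot_pr t p = (let c = cos (pi / 2 * t); s = sin (pi / 2 * t) in
     M2 ((c * c) *\<^sub>R p) ((c * s) *\<^sub>R p) ((c * s) *\<^sub>R p) ((s * s) *\<^sub>R p))"

text \<open>\<open>rot_pr t p\<close> is p tensored with the projection onto the real unit vector
  (c, s); idempotence comes from c^2 + s^2 = 1.\<close>

lemma isp_rot_pr: assumes "isp p" shows "isp (rot_pr t p)"
proof -
  define c s where "c = cos (pi / 2 * t)" "s = sin (pi / 2 * t)"
  have cs: "c * c + s * s = 1" unfolding c_s_def by (simp flip: power2_eq_square)
  have "(c * c) * (c * c) + (c * s) * (c * s) = (c * c) * (c * c + s * s)"
    "(c * c) * (c * s) + (c * s) * (s * s) = (c * s) * (c * c + s * s)"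
    "(c * s) * (c * s) + (s * s) * (s * s) = (s * s) * (c * c + s * s)"
    by (simp_all add: algebra_simps)
  then have e: "(c * c) * (c * c) + (c * s) * (c * s) = c * c"
    "(c * c) * (c * s) + (c * s) * (s * s) = c * s"
    "(c * s) * (c * s) + (s * s) * (s * s) = s * s" by (simp_all add: cs)
  have "rot_pr t p = M2 ((c * c) *\<^sub>R p) ((c * s) *\<^sub>R p) ((c * s) *\<^sub>R p) ((s * s) *\<^sub>R p)"
    by (simp add: rot_pr_def c_s_def Let_def)
  moreover have "M2 ((c * c) *\<^sub>R p) ((c * s) *\<^sub>R p) ((c * s) *\<^sub>R p) ((s * s) *\<^sub>R p) *
      M2 ((c * c) *\<^sub>R p) ((c * s) *\<^sub>R p) ((c * s) *\<^sub>R p) ((s * s) *\<^sub>R p) =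
      M2 (((c * c) * (c * c) + (c * s) * (c * s)) *\<^sub>R p) (((c * c) * (c * s) + (c * s) * (s * s)) *\<^sub>R p)
         (((c * c) * (c * s) + (c * s) * (s * s)) *\<^sub>R p) (((c * s) * (c * s) + (s * s) * (s * s)) *\<^sub>R p)"
    using assms by (intro m2_eqI) (simp_all add: isp_def scaleR_add_left mult.commute)
  ultimately show ?thesis using assms unfolding e isp_def
    by (auto intro!: m2_eqI simp: adj_scaleR)
qed

definition corner :: "'a::unital_cstar \<Rightarrow> 'a m2" where
  "corner p = M2 p 0 0 0"

lemma isp_corner: "isp p \<Longrightarrow> isp (corner p)"
  by (auto simp: isp_def corner_def intro!: m2_eqI)

definition rotation :: "refl_gen \<Rightarrow> real \<Rightarrow> refl_algebra \<Rightarrow> refl_algebra m2" where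
  "rotation i t = lift (\<lambda>g. if g = i then rot_pr t (pr i) else corner (pr g))"

lemma rotation: "star_morphism (rotation i t)"
    "rotation i t (pr g) = (if g = i then rot_pr t (pr i) else corner (pr g))"
  unfolding rotation_def by (rule lift; simp add: isp_rot_pr isp_corner)+

lemma star_morphism_diag:
  assumes "star_morphism \<phi>" "star_morphism \<psi>" shows "star_morphism (\<lambda>x. M2 (\<phi> x) 0 0 (\<psi> x))"
proof -
  interpret \<phi>: star_morphism \<phi> by fact
  interpret \<psi>: star_morphism \<psi> by fact
  have cs: "cs c = M2 (cs c) 0 0 (cs c :: 'b)" for c
    by (rule m2_eqI) (simp_all add: cs_def of_real_def)
  show ?thesis
    by standard
     (auto intro!: m2_eqI simp: \<phi>.add \<psi>.add \<phi>.mult \<psi>.mult \<phi>.star \<psi>.star \<phi>.cs \<psi>.cs cs)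
qed

text \<open>At t = 0 every projection has image 0 in the second entry. A unital morphism with these
  values is the scalar part of x, hence \<open>restrict_to {}\<close>.\<close>

lemma rotation_start: "rotation i 0 x = M2 x 0 0 (restrict_to {} x)"
  unfolding rotation_def
proof (rule lift_unique)
  show "star_morphism (\<lambda>x. M2 x 0 0 (restrict_to {} x))"
    by (intro star_morphism_diag star_morphism_id restrict_to)
qed (simp_all add: isp_rot_pr isp_corner, simp_all add: restrict_to rot_pr_def corner_def)

text \<open>At t = 1 the first entry has lost \<open>pr i\<close>, and the second sees nothing but
  \<open>pr i\<close> and scalars.\<close>

lemma rotation_end: "rotation i 1 x = M2 (restrict_to (- {i}) x) 0 0 (restrict_to {i} x)"
  unfolding rotation_def
proof (rule lift_unique)
  show "star_morphism (\<lambda>x. M2 (restrict_to (- {i}) x) 0 0 (restrict_to {i} x))"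
    by (intro star_morphism_diag restrict_to)
qed (simp_all add: isp_rot_pr isp_corner, simp_all add: restrict_to rot_pr_def corner_def)

lemma flat_diag:
  fixes \<phi> \<psi> :: "'b \<Rightarrow> 'a::unital_cstar"
  shows "flat (map_mat (\<lambda>x. M2 (\<phi> x) 0 0 (\<psi> x)) P) = dsm (map_mat \<phi> P) (map_mat \<psi> P)"
  unfolding flat_def dsm_def by (intro cong_four_block_mat eq_matI) auto

lemma bounded_linear_m2_entries:
  "bounded_linear (e11 :: 'a::unital_cstar m2 \<Rightarrow> 'a)" "bounded_linear (e12 :: 'a m2 \<Rightarrow> 'a)"
  "bounded_linear (e21 :: 'a m2 \<Rightarrow> 'a)" "bounded_linear (e22 :: 'a m2 \<Rightarrow> 'a)"
  by (rule bounded_linear_intro[where K = 1]; simp add: norm_m2_entries)+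

lemma continuous_on_M2:
  fixes f11 f12 f21 f22 :: "real \<Rightarrow> 'a::unital_cstar"
  assumes "continuous_on S f11" "continuous_on S f12" "continuous_on S f21" "continuous_on S f22"
  shows "continuous_on S (\<lambda>t. M2 (f11 t) (f12 t) (f21 t) (f22 t))"
  unfolding continuous_on_def
proof
  fix s assume s: "s \<in> S"
  let ?M = "\<lambda>t. M2 (f11 t) (f12 t) (f21 t) (f22 t)"
  have l: "((\<lambda>t. f t - f s) \<longlongrightarrow> 0) (at s within S)" if "continuous_on S f" for f :: "real \<Rightarrow> 'a"
    using that s unfolding continuous_on_def by (intro LIM_zero) blast
  have "((\<lambda>t. norm (f11 t - f11 s) + norm (f12 t - f12 s) + norm (f21 t - f21 s) + norm (f22 t - f22 s)) \<longlongrightarrow> 0 + 0 + 0 + 0) (at s within S)"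
    by (intro tendsto_add tendsto_norm_zero l assms)
  then have lim: "((\<lambda>t. norm (f11 t - f11 s) + norm (f12 t - f12 s) + norm (f21 t - f21 s) + norm (f22 t - f22 s)) \<longlongrightarrow> 0) (at s within S)"
    by simp
  have "norm (?M t - ?M s) \<le> norm (f11 t - f11 s) + norm (f12 t - f12 s) + norm (f21 t - f21 s) + norm (f22 t - f22 s)" for t
    using norm_m2_le_sum[of "?M t - ?M s"] by simp
  then have "((\<lambda>t. norm (?M t - ?M s)) \<longlongrightarrow> 0) (at s within S)"
    by (intro tendsto_sandwich[OF _ _ tendsto_const lim]) auto
  then show "(?M \<longlongrightarrow> ?M s) (at s within S)" by (simp add: tendsto_norm_zero_iff LIM_zero_iff)
qed

lemma continuous_on_rotation: "continuous_on S (\<lambda>t. rotation i t x)"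
proof (rule continuous_on_star_morphisms[OF rotation(1)])
  fix g
  have "continuous_on S (\<lambda>t. rot_pr t (pr i))"
    unfolding rot_pr_def Let_def by (intro continuous_on_M2 continuous_intros)
  then have "continuous_on S (\<lambda>t. rotation i t (pr g))"
    by (cases "g = i") (simp_all add: rotation(2))
  then have "continuous_on S (\<lambda>t. 2 *\<^sub>R rotation i t (pr g) - 1)" by (intro continuous_intros)
  then show "continuous_on S (\<lambda>t. rotation i t (ugen g))"
    by (simp add: ugen_pr star_morphism.diff[OF rotation(1)] star_morphism.scaleR[OF rotation(1)] star_morphism.one[OF rotation(1)])
qed

lemma mat_path_rotation:
  assumes "P \<in> carrier_mat n n" shows "mat_path (n + n) (\<lambda>t. flat (map_mat (rotation i t) P))"
  unfolding mat_path_def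
proof (intro allI impI)
  fix a b assume ab: "a < n + n" "b < n + n"
  note c = bounded_linear_m2_entries[THEN bounded_linear.continuous_on, OF continuous_on_rotation]
  have "flat (map_mat (rotation i t) P) $$ (a, b) =
     (if a < n then if b < n then e11 (rotation i t (P $$ (a, b))) else e12 (rotation i t (P $$ (a, b - n)))
      else if b < n then e21 (rotation i t (P $$ (a - n, b))) else e22 (rotation i t (P $$ (a - n, b - n))))" for t
    using ab assms unfolding flat_def by (subst index_mat_four_block) auto
  then show "continuous_on {0..1} (\<lambda>t. flat (map_mat (rotation i t) P) $$ (a, b))"
    by (cases "a < n"; cases "b < n") (simp_all add: c)
qed

lemma rotation_mvn:
  assumes P: "proj n P"
  shows "mvn (dsm P (map_mat (restrict_to {}) P)) (dsm (map_mat (restrict_to (- {i})) P) (map_mat (restrict_to {i}) P))"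
proof -
  have c: "P \<in> carrier_mat n n" using P by (simp add: proj_def)
  have "mvn (flat (map_mat (rotation i 0) P)) (flat (map_mat (rotation i 1) P))"
    by (rule homotopic_projections[OF flat_proj[OF star_morphism.map_mat_proj[OF rotation(1) P]] mat_path_rotation[OF c]])
  moreover have "map_mat (\<lambda>x. x) P = P" by (rule eq_matI) auto
  ultimately show ?thesis unfolding rotation_start rotation_end flat_diag by simp
qed

lemma rotation_upath:
  assumes u: "unit n u"
  shows "upath (n + n) (dsm u (map_mat (restrict_to {}) u)) (dsm (map_mat (restrict_to (- {i})) u) (map_mat (restrict_to {i}) u))"
proof -
  have c: "u \<in> carrier_mat n n" using u by (simp add: unit_def)
  have "upath (n + n) (flat (map_mat (rotation i 0) u)) (flat (map_mat (rotation i 1) u))"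
    unfolding upath_def
    by (rule exI[of _ "\<lambda>t. flat (map_mat (rotation i t) u)"])
      (simp add: mat_path_rotation[OF c] flat_unit star_morphism.map_mat_unit[OF rotation(1) u])
  moreover have "map_mat (\<lambda>x. x) u = u" by (rule eq_matI) auto
  ultimately show ?thesis unfolding rotation_start rotation_end flat_diag by simp
qed

section \<open>Stable classification of projections and unitaries\<close>

abbreviation "restr S \<equiv> map_mat (restrict_to S)"

lemma restr_restr: "restr S (restr T P) = restr (T \<inter> S) P"
  by (rule eq_matI) (auto simp: restrict_to_restrict_to)

lemma refl_gen_sets: "- {W1} \<inter> {} = {}" "- {W1} \<inter> - {W2} = {W3}" "- {W1} \<inter> {W2} = {W2}"
  by (auto, (metis refl_gen.exhaust)+)

text \<open>\<open>mvn\<close> confined to projections, where it is transitive and equations can be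
  chained.\<close>

definition eqv :: "'a::unital_cstar mat \<Rightarrow> 'a mat \<Rightarrow> bool" where
  "eqv P Q \<longleftrightarrow> (\<exists>m n. proj m P \<and> proj n Q) \<and> mvn P Q"

lemma eqvI: "mvn P Q \<Longrightarrow> proj m P \<Longrightarrow> proj n Q \<Longrightarrow> eqv P Q"
  by (auto simp: eqv_def)

lemma eqv_refl: "proj n P \<Longrightarrow> eqv P P" by (auto simp: eqv_def mvn_refl)
lemma eqv_sym: "eqv P Q \<Longrightarrow> eqv Q P" by (auto simp: eqv_def mvn_sym)
lemma eqv_trans [trans]: "eqv P Q \<Longrightarrow> eqv Q R \<Longrightarrow> eqv P R"
  unfolding eqv_def using mvn_trans by blast
lemma eqv_dsm: "eqv P Q \<Longrightarrow> eqv P' Q' \<Longrightarrow> eqv (dsm P P') (dsm Q Q')"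
  unfolding eqv_def using mvn_dsm proj_dsm by blast
lemma eqv_comm: "proj m P \<Longrightarrow> proj n Q \<Longrightarrow> eqv (dsm P Q) (dsm Q P)"
  by (rule eqvI[OF mvn_dsm_comm proj_dsm proj_dsm])

lemma restr_proj: "proj n P \<Longrightarrow> proj n (restr S P)"
  by (rule star_morphism.map_mat_proj[OF restrict_to(1)])

lemma rotation_eqv: "proj n P \<Longrightarrow> eqv (dsm P (restr {} P)) (dsm (restr (- {i}) P) (restr {i} P))"
  by (rule eqvI[OF rotation_mvn]) (auto intro: proj_dsm restr_proj)

text \<open>Two rotations separate the three projections: W1 is split off from P, then W2 from
  \<open>restr (- {W1}) P\<close>, which leaves W3. Each rotation consumes one copy of
  \<open>restr {} P\<close>, hence the two copies on the left.\<close>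

lemma stable_decomposition:
  assumes P: "proj n P"
  shows "eqv (dsm P (dsm (restr {} P) (restr {} P))) (dsm (restr {W1} P) (dsm (restr {W3} P) (restr {W2} P)))"
proof -
  note R = restr_proj[OF P]
  have "eqv (dsm (dsm P (restr {} P)) (restr {} P)) (dsm (dsm (restr (- {W1}) P) (restr {W1} P)) (restr {} P))"
    by (rule eqv_dsm[OF rotation_eqv[OF P] eqv_refl[OF R]])
  also have "eqv \<dots> (dsm (dsm (restr {W1} P) (restr (- {W1}) P)) (restr {} P))"
    by (rule eqv_dsm[OF eqv_comm[OF R R] eqv_refl[OF R]])
  also have "dsm (dsm (restr {W1} P) (restr (- {W1}) P)) (restr {} P) = dsm (restr {W1} P) (dsm (restr (- {W1}) P) (restr {} P))"
    by (simp add: dsm_assoc)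
  also have "eqv \<dots> (dsm (restr {W1} P) (dsm (restr {W3} P) (restr {W2} P)))"
    using rotation_eqv[OF R[of "- {W1}"], of W2]
    by (intro eqv_dsm[OF eqv_refl[OF R]]) (simp add: restr_restr refl_gen_sets)
  finally show ?thesis by (simp add: dsm_assoc)
qed

abbreviation "rank_at S P \<equiv> mtr (map_mat (character S) P)"

lemma character_eqv:
  assumes "proj m P" "proj n Q" "rank_at S P = rank_at S Q"
  shows "mvn (map_mat (character S) P) (map_mat (character S) Q)"
  by (rule complex_proj_mvn[OF star_morphism.map_mat_proj[OF character(1) assms(1)]
        star_morphism.map_mat_proj[OF character(1) assms(2)] assms(3)])

text \<open>Both restrictions are images of the complex projections obtained from P by the two
  characters, and complex projections are classified by their trace.\<close>

lemma restr_eqv: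
  assumes P: "proj m P" and Q: "proj n Q"
    and r: "rank_at {} P = rank_at {} Q" "rank_at {i} P = rank_at {i} Q"
  shows "eqv (restr {i} P) (restr {i} Q)" "eqv (restr {} P) (restr {} Q)"
proof -
  have "mvn (restr {i} P) (restr {i} Q)"
    unfolding map_restrict_to_singleton
    by (rule tens_mvn[OF isp_pr character_eqv[OF P Q r(2)] character_eqv[OF P Q r(1)]])
      (use P Q in \<open>auto simp: proj_def\<close>)
  then show "eqv (restr {i} P) (restr {i} Q)" by (rule eqvI[OF _ restr_proj[OF P] restr_proj[OF Q]])
  have e: "restr {} P = map_mat cs (map_mat (character {}) P)" for P
    by (rule eq_matI) (auto simp: restrict_to_empty)
  have "mvn (restr {} P) (restr {} Q)" unfolding e
    by (rule star_morphism.map_mat_mvn[OF star_morphism_cs character_eqv[OF P Q r(1)]])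
  then show "eqv (restr {} P) (restr {} Q)" by (rule eqvI[OF _ restr_proj[OF P] restr_proj[OF Q]])
qed

text \<open>Up to equivalence, the right side of \<open>stable_decomposition\<close> and the summand
  added to P depend only on the ranks, so one E serves both P and Q.\<close>

theorem stably_equivalent:
  assumes P: "proj m P" and Q: "proj n Q"
    and r0: "rank_at {} P = rank_at {} Q" and r: "\<And>i. rank_at {i} P = rank_at {i} Q"
  shows "\<exists>k E. proj k E \<and> mvn (dsm P E) (dsm Q E)"
proof -
  let ?E = "\<lambda>P. dsm (restr {} P) (restr {} P)" and ?T = "\<lambda>P. dsm (restr {W1} P) (dsm (restr {W3} P) (restr {W2} P))"
  note e = restr_eqv[OF P Q r0 r]
  have "eqv (dsm P (?E P)) (?T P)" by (rule stable_decomposition[OF P])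
  also have "eqv \<dots> (?T Q)" by (intro eqv_dsm e)
  also have "eqv \<dots> (dsm Q (?E Q))" by (rule eqv_sym[OF stable_decomposition[OF Q]])
  also have "eqv \<dots> (dsm Q (?E P))" by (intro eqv_dsm eqv_refl[OF Q] eqv_sym[OF e(2)])
  finally have "mvn (dsm P (?E P)) (dsm Q (?E P))" by (simp add: eqv_def)
  then show ?thesis using proj_dsm[OF restr_proj[OF P] restr_proj[OF P]] by blast
qed

text \<open>The two rotations of \<open>stable_decomposition\<close>, for unitaries. As
  \<open>restr {} u\<close> is connected to the identity, a single block \<open>1\<^sub>m n\<close>
  can be exchanged for it before each rotation.\<close>

theorem stably_trivial:
  assumes u: "unit n (u :: refl_algebra mat)" shows "upath (n + n) (dsm u (1\<^sub>m n)) (1\<^sub>m (n + n))"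
proof -
  have R: "unit n (restr S u)" for S by (rule star_morphism.map_mat_unit[OF restrict_to(1) u])
  have c: "upath n (map_mat (character S) u) (1\<^sub>m n)" for S
    by (rule complex_unit_path[OF star_morphism.map_mat_unit[OF character(1) u]])
  have "restr {} u = map_mat cs (map_mat (character {}) u)" by (rule eq_matI) (auto simp: restrict_to_empty)
  moreover have "upath n (map_mat cs (map_mat (character {}) u)) (map_mat cs (1\<^sub>m n) :: refl_algebra mat)"
    by (rule star_morphism.map_mat_upath[OF star_morphism_cs c])
  ultimately have R0: "upath n (restr {} u) (1\<^sub>m n)"
    unfolding star_morphism.map_mat_one[OF star_morphism_cs] by simp
  have R1: "upath n (restr {i} u) (1\<^sub>m n)" for i
    unfolding map_restrict_to_singleton by (rule tens_upath[OF isp_pr c c])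
  have "upath (n + n) (dsm u (1\<^sub>m n)) (dsm u (restr {} u))" by (intro upath_dsm upath_refl u upath_sym[OF R0])
  moreover have "upath (n + n) (dsm u (restr {} u)) (dsm (restr (- {W1}) u) (restr {W1} u))" by (rule rotation_upath[OF u])
  moreover have "upath (n + n) (dsm (restr (- {W1}) u) (restr {W1} u)) (dsm (restr (- {W1}) u) (1\<^sub>m n))"
    by (intro upath_dsm upath_refl R R1)
  moreover have "upath (n + n) (dsm (restr (- {W1}) u) (1\<^sub>m n)) (dsm (restr (- {W1}) u) (restr {} u))"
    by (intro upath_dsm upath_refl R upath_sym[OF R0])
  moreover have "upath (n + n) (dsm (restr (- {W1}) u) (restr {} u)) (dsm (restr {W3} u) (restr {W2} u))"
    using rotation_upath[OF R[of "- {W1}"], of W2] by (simp add: restr_restr refl_gen_sets)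
  moreover have "upath (n + n) (dsm (restr {W3} u) (restr {W2} u)) (dsm (1\<^sub>m n) (1\<^sub>m n))"
    by (intro upath_dsm R1)
  ultimately show ?thesis unfolding dsm_one by (blast intro: upath_trans)
qed

section \<open>The crossed product\<close>

context cstar_algebra
begin

lemma eq_if_minus_zero: "x \<in> carrier A \<Longrightarrow> y \<in> carrier A \<Longrightarrow> x \<ominus> y = \<zero> \<Longrightarrow> x = y"
  by (metis a_minus_def add.inv_closed add.inv_equality add.inv_inv)

lemma cnorm_minus_triangle:
  assumes "x \<in> carrier A" "y \<in> carrier A" "z \<in> carrier A"
  shows "cnorm A (x \<ominus> z) \<le> cnorm A (x \<ominus> y) + cnorm A (y \<ominus> z)"
proof -
  have "x \<ominus> z = (x \<ominus> y) \<oplus> (y \<ominus> z)" using assms by (simp add: a_minus_def a_assoc r_neg1)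
  then show ?thesis using cnorm_triangle[of "x \<ominus> y" "y \<ominus> z"] assms by simp
qed

lemma eq_if_close:
  assumes "x \<in> carrier A" "y \<in> carrier A" "\<And>n::nat. cnorm A (x \<ominus> y) \<le> K * e n" "e \<longlonglongrightarrow> 0"
  shows "x = y"
proof -
  have "cnorm A (x \<ominus> y) \<le> K * 0"
    by (rule LIMSEQ_le_const[OF tendsto_mult_left[OF assms(4)]]) (use assms(3) in auto)
  then have "cnorm A (x \<ominus> y) \<le> 0" by simp
  then have "cnorm A (x \<ominus> y) = 0" by (rule antisym) (simp add: assms(1,2))
  then show ?thesis by (rule eq_if_minus_zero[OF assms(1,2) cnorm_eq_0, rotated]) (simp add: assms(1,2))
qed

end

text \<open>The crossed product is a record, so morphisms into it go from a typed algebra to a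
  record.\<close>

locale star_rep = X: cstar_algebra X for X :: "('x, 'm) cstar_scheme" +
  fixes f :: "'a::unital_cstar \<Rightarrow> 'x"
  assumes hom: "f \<in> star_hom (cstar_rec :: 'a cstar) X"
begin

lemma closed [simp]: "f x \<in> carrier X"
  and add: "f (x + y) = f x \<oplus>\<^bsub>X\<^esub> f y" and mult: "f (x * y) = f x \<otimes>\<^bsub>X\<^esub> f y"
  and one: "f 1 = \<one>\<^bsub>X\<^esub>" and smult: "f (cs c * x) = c \<odot>\<^bsub>X\<^esub> f x" and star: "f (adj x) = star X (f x)"
  using hom by (auto simp: star_hom_def Ring.ring_hom_def)

lemma scaleR: "f (r *\<^sub>R x) = complex_of_real r \<odot>\<^bsub>X\<^esub> f x"
  using smult[of "of_real r" x] by (simp add: scaleR_conv_of_real)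

lemma zero: "f 0 = \<zero>\<^bsub>X\<^esub>" using scaleR[of 0 0] by simp

lemma minus: "f (- x) = \<ominus>\<^bsub>X\<^esub> f x" using scaleR[of "-1" x] by (simp add: X.smult_minus_one)

lemma diff: "f (x - y) = f x \<ominus>\<^bsub>X\<^esub> f y" using add[of x "- y"] by (simp add: minus a_minus_def)

lemma cnorm_le: "cnorm X (f x) \<le> norm x"
  by (rule seminorm_le_norm[of "\<lambda>x. cnorm X (f x)"])
    (simp_all add: add scaleR mult star X.cstar_identity X.cnorm_triangle X.cnorm_smult)

end

lemma star_rep_eq:
  fixes f g :: "'g::star_relations ucstar \<Rightarrow> 'x"
  assumes f: "star_rep X f" and g: "star_rep X g" and gens: "\<And>s. f (ugen s) = g (ugen s)"
  shows "f x = g x"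
proof -
  interpret f: star_rep X f by (rule f)
  interpret g: star_rep X g by (rule g)
  show ?thesis
  proof (induction x rule: ucstar_induct)
    case (closed z x)
    have "cnorm X (f x \<ominus>\<^bsub>X\<^esub> g x) \<le> 2 * norm (z n - x)" for n
    proof -
      have "cnorm X (f x \<ominus>\<^bsub>X\<^esub> g x) \<le> cnorm X (f x \<ominus>\<^bsub>X\<^esub> f (z n)) + cnorm X (f (z n) \<ominus>\<^bsub>X\<^esub> g x)"
        by (rule f.X.cnorm_minus_triangle) simp_all
      also have "f (z n) \<ominus>\<^bsub>X\<^esub> g x = g (z n - x)" using closed(1)[of n] by (simp add: g.diff)
      also have "f x \<ominus>\<^bsub>X\<^esub> f (z n) = f (x - z n)" by (simp add: f.diff)
      finally show ?thesis using f.cnorm_le[of "x - z n"] g.cnorm_le[of "z n - x"] by (simp add: norm_minus_commute)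
    qed
    moreover have "(\<lambda>n. norm (z n - x)) \<longlonglongrightarrow> 0" using closed(2) by (simp add: LIM_zero tendsto_norm_zero)
    ultimately show ?case by (rule f.X.eq_if_close[rotated 2]) simp_all
  next
    case (cs c x)
    then show ?case unfolding f.smult g.smult by simp
  qed (simp_all add: gens f.add g.add f.mult g.mult f.one g.one f.star g.star)
qed

section \<open>The crossed product and the algebra of three symmetries\<close>

lemma CstarF2_uni: "CstarF2 = (uni :: (nat \<Rightarrow> f2_gen free_star) set cstar)"
  by (simp add: CstarF2_def relations_f2_gen_def)

lemma f2_gens: "F2_U = rep_u (ugen U_gen)" "F2_V = rep_u (ugen V_gen)"
  by (simp_all add: F2_U_def F2_V_def relations_f2_gen_def)

lemma ugen_f2: "adj (ugen g) * ugen g = (1 :: f2_gen ucstar)" "ugen g * adj (ugen g) = (1 :: f2_gen ucstar)"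
proof -
  have "adjoint (gen g) * gen g - 1 \<in> relations" "gen g * adjoint (gen g) - 1 \<in> relations"
    by (auto simp: relations_f2_gen_def free_group_rels_def)
  from this[THEN eval_at_relation] show "adj (ugen g) * ugen g = (1 :: f2_gen ucstar)"
    "ugen g * adj (ugen g) = (1 :: f2_gen ucstar)" by simp_all
qed

lemma refl_cancel: "ugen g * (ugen g * x) = (x :: refl_algebra)"
  by (simp add: ugen_refl flip: mult.assoc)

text \<open>Solves W1 = W, W2 = U W, W3 = V W for U and V.\<close>

primrec f2_image :: "f2_gen \<Rightarrow> refl_algebra" where
  "f2_image U_gen = ugen W2 * ugen W1"
| "f2_image V_gen = ugen W3 * ugen W1"

lemma f2_embedding: "\<exists>\<phi>. star_morphism \<phi> \<and> (\<forall>g. \<phi> (ugen g) = f2_image g)"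
proof -
  have "adj (f2_image g) * f2_image g = 1" "f2_image g * adj (f2_image g) = 1" for g
    by (cases g; simp add: adj_mult ugen_refl mult.assoc refl_cancel)+
  then have "eval_at f2_image r = 0" if "r \<in> relations" for r
    using that by (auto simp: relations_f2_gen_def free_group_rels_def)
  then show ?thesis using ucstar_universal by blast
qed

locale inversion_action =
  fixes \<alpha> :: "(nat \<Rightarrow> f2_gen free_star) set \<Rightarrow> (nat \<Rightarrow> f2_gen free_star) set"
  assumes aut: "\<alpha> \<in> star_aut CstarF2"
    and inv: "\<alpha> F2_U = star CstarF2 F2_U" "\<alpha> F2_V = star CstarF2 F2_V"
begin

abbreviation "rels \<equiv> crossed_rels CstarF2 \<alpha>"
abbreviation "X \<equiv> crossed_product CstarF2 \<alpha>"

definition act :: "f2_gen ucstar \<Rightarrow> f2_gen ucstar" where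
  "act x = abs_u (\<alpha> (rep_u x))"

lemma alpha_hom: "\<alpha> \<in> star_hom uni uni"
  using aut by (simp add: star_aut_def CstarF2_uni)

lemma rep_act: "rep_u (act x) = \<alpha> (rep_u x)"
  using alpha_hom unfolding act_def star_hom_def Ring.ring_hom_def
  by (intro rep_abs_u) (auto simp: Pi_iff)

lemma star_morphism_act: "star_morphism act"
  using star_hom_comp[OF star_hom_comp[OF star_hom_rep_u alpha_hom] star_hom_abs_u]
  unfolding star_morphism_star_hom[symmetric] act_def .

lemma act_ugen: "act (ugen g) = adj (ugen g)"
  using inv by (cases g) (simp_all add: rep_act f2_gens CstarF2_uni flip: rep_u_inject)

definition el :: "f2_gen ucstar \<Rightarrow> (nat \<Rightarrow> f2_gen free_star) set crossed_gen free_star" where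
  "el x = gen (Elt (rep_u x))"

text \<open>With quantifiers ranging over a type in place of the carrier, each relation becomes a
  law of morphisms, which can be checked by rewriting.\<close>

lemma rels_eq:
  "rels = {gen (Elt a) |a. a \<notin> carrier CstarF2} \<union> {el (x + y) - (el x + el y) |x y. True} \<union>
     {el (cs c * x) - scale c (el x) |c x. True} \<union> {el (x * y) - el x * el y |x y. True} \<union>
     {el (adj x) - adjoint (el x) |x. True} \<union> {el 1 - 1} \<union>
     {adjoint (gen W_gen) * gen W_gen - 1, gen W_gen * adjoint (gen W_gen) - 1, gen W_gen * gen W_gen - 1} \<union>
     {gen W_gen * el x * adjoint (gen W_gen) - el (act x) |x. True}"
proof -
  have c: "a \<in> carrier CstarF2 \<longleftrightarrow> a \<in> range rep_u" for a
    using rep_abs_u[of a] rep_u_closed unfolding CstarF2_uni by (metis rangeE rangeI)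
  have sets: "{F a |a. a \<in> range r} = {F (r x) |x. True}" "{G k a |k a. a \<in> range r} = {G k (r x) |k x. True}"
    "{H a b |a b. a \<in> range r \<and> b \<in> range r} = {H (r x) (r y) |x y. True}"
    for r :: "'d \<Rightarrow> 'e" and F :: "'e \<Rightarrow> 'f" and G :: "'h \<Rightarrow> 'e \<Rightarrow> 'f" and H :: "'e \<Rightarrow> 'e \<Rightarrow> 'f" by blast+
  have e: "el (x + y) = gen (Elt (rep_u x \<oplus>\<^bsub>CstarF2\<^esub> rep_u y))" "el (x * y) = gen (Elt (rep_u x \<otimes>\<^bsub>CstarF2\<^esub> rep_u y))"
    "el (adj x) = gen (Elt (star CstarF2 (rep_u x)))"
    "el 1 = gen (Elt \<one>\<^bsub>CstarF2\<^esub>)" "el (act x) = gen (Elt (\<alpha> (rep_u x)))" for x y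
    unfolding el_def CstarF2_uni by (simp_all add: rep_act)
  have e': "el (cs k * x) = gen (Elt (k \<odot>\<^bsub>CstarF2\<^esub> rep_u x))" for k x
    unfolding el_def rep_u_cs CstarF2_uni ..
  show ?thesis
    unfolding e' unfolding e unfolding el_def crossed_rels_def c sets ..
qed

lemma el_rels:
  "el (x + y) - (el x + el y) \<in> rels" "el (cs c * x) - scale c (el x) \<in> rels"
  "el (x * y) - el x * el y \<in> rels" "el (adj x) - adjoint (el x) \<in> rels" "el 1 - 1 \<in> rels"
  "gen W_gen * el x * adjoint (gen W_gen) - el (act x) \<in> rels"
  unfolding rels_eq by blast+

lemma W_rels:
  "adjoint (gen W_gen) * gen W_gen - 1 \<in> rels" "gen W_gen * adjoint (gen W_gen) - 1 \<in> rels"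
  "gen W_gen * gen W_gen - 1 \<in> rels"
  by (auto simp: crossed_rels_def)

text \<open>A seminorm p respecting the relations pulls back along \<open>el\<close> to a
  C*-seminorm on the free group algebra, which \<open>seminorm_le_norm\<close> bounds by the norm.
  Symbols outside the carrier are themselves relations, and W is unitary.\<close>

lemma admissible_rels: "admissible rels"
  unfolding admissible_def
proof
  fix g
  show "bdd_above ((\<lambda>p. p (gen g)) ` cstar_seminorms rels)"
  proof (cases g)
    case W_gen
    have "p (gen W_gen) \<le> 1" if p: "p \<in> cstar_seminorms rels" for p
    proof -
      interpret cstar_seminorm p using p by (simp add: cstar_seminorm_def cstar_seminorms_def)
      have "p (adjoint (gen W_gen) * gen W_gen - 1) = 0" using p W_rels(1) by (simp add: cstar_seminorms_def)
      then have "(p (gen W_gen))\<^sup>2 \<le> p 1"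
        using tri[of "adjoint (gen W_gen) * gen W_gen - 1" 1] by (simp add: N_cstar)
      moreover have "p 1 * p 1 = p 1" using N_cstar[of 1] by (simp add: power2_eq_square)
      then have "p 1 \<le> 1" by auto
      ultimately have "(p (gen W_gen))\<^sup>2 \<le> 1\<^sup>2" by simp
      then show ?thesis by (rule power2_le_imp_le) simp
    qed
    then show ?thesis unfolding W_gen by (auto simp: bdd_above_def)
  next
    case (Elt a)
    show ?thesis
    proof (cases "a \<in> carrier CstarF2")
      case False
      then have "gen g \<in> rels" by (auto simp: Elt crossed_rels_def)
      then show ?thesis by (auto simp: bdd_above_def cstar_seminorms_def)
    next
      case True
      define x where "x = (abs_u a :: f2_gen ucstar)"
      have x: "gen g = el x" using True by (simp add: Elt el_def x_def CstarF2_uni)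
      have "p (el x) \<le> norm x" if p: "p \<in> cstar_seminorms rels" for p
      proof -
        interpret cstar_seminorm p using p by (simp add: cstar_seminorm_def cstar_seminorms_def)
        have eq: "p u = p v" if "u - v \<in> rels" for u v
        proof -
          have "p (u - v) = 0" using p that by (simp add: cstar_seminorms_def)
          then show ?thesis using N_abs_diff[of u v] by simp
        qed
        show ?thesis
        proof (rule seminorm_le_norm[of "\<lambda>x. p (el x)"])
          fix x y :: "f2_gen ucstar" and r :: real
          show "p (el (x + y)) \<le> p (el x) + p (el y)" using eq[OF el_rels(1), of x y] tri by simp
          show "p (el (r *\<^sub>R x)) = \<bar>r\<bar> * p (el x)"
            using eq[OF el_rels(2), of "of_real r" x] by (simp add: N_scale scaleR_conv_of_real)
          have "p ((el (adj x) - adjoint (el x)) * el x) \<le> 0"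
            using N_mult[of "el (adj x) - adjoint (el x)" "el x"] p el_rels(4)[of x] by (simp add: cstar_seminorms_def)
          then have "p (el (adj x) * el x - adjoint (el x) * el x) = 0"
            by (intro antisym N_nonneg) (simp add: left_diff_distrib)
          then have "p (el (adj x) * el x) = p (adjoint (el x) * el x)"
            using N_abs_diff[of "el (adj x) * el x" "adjoint (el x) * el x"] by simp
          then show "p (el (adj x * x)) = (p (el x))\<^sup>2" using eq[OF el_rels(3), of "adj x" x] by (simp add: N_cstar)
        qed
      qed
      then show ?thesis unfolding x by (auto simp: bdd_above_def)
    qed
  qed
qed

sublocale X: cstar_algebra X
  unfolding crossed_product_def by (rule cstar_algebra_universal[OF admissible_rels])

abbreviation "xgen \<equiv> universal_gen rels"

sublocale E: cstar_evaluation X xgen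
  by unfold_locales (simp add: crossed_product_def universal_gen_closed admissible_rels)

definition iota :: "f2_gen ucstar \<Rightarrow> (nat \<Rightarrow> (nat \<Rightarrow> f2_gen free_star) set crossed_gen free_star) set" where
  "iota x = xgen (Elt (rep_u x))"

definition w :: "(nat \<Rightarrow> (nat \<Rightarrow> f2_gen free_star) set crossed_gen free_star) set" where
  "w = xgen W_gen"

lemma iota_closed [simp]: "iota x \<in> carrier X" and w_closed [simp]: "w \<in> carrier X"
  by (simp_all add: iota_def w_def)

lemma eval_el: "X.eval_poly xgen (el x) = iota x"
  by (simp add: el_def iota_def)

lemma eval_eq: assumes "u - v \<in> rels" shows "X.eval_poly xgen u = X.eval_poly xgen v"
proof (rule X.eq_if_minus_zero)
  show "X.eval_poly xgen u \<ominus>\<^bsub>X\<^esub> X.eval_poly xgen v = \<zero>\<^bsub>X\<^esub>"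
    unfolding E.eval_diff[symmetric] unfolding crossed_product_def
    by (rule universal_relations[OF admissible_rels assms])
qed simp_all

lemma star_rep_iota: "star_rep X iota"
proof
  have "iota (x + y) = iota x \<oplus>\<^bsub>X\<^esub> iota y" "iota (x * y) = iota x \<otimes>\<^bsub>X\<^esub> iota y"
      "iota (cs c * x) = c \<odot>\<^bsub>X\<^esub> iota x" "iota (adj x) = star X (iota x)" for x y c
    using eval_eq[OF el_rels(1), of x y] eval_eq[OF el_rels(3), of x y] eval_eq[OF el_rels(2), of c x]
      eval_eq[OF el_rels(4), of x]
    by (simp_all only: E.eval_add E.eval_mult E.eval_scale E.eval_adjoint eval_el)
  moreover have "iota 1 = \<one>\<^bsub>X\<^esub>"
    using eval_eq[OF el_rels(5)] by (simp add: eval_el)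
  ultimately show "iota \<in> star_hom cstar_rec X"
    unfolding star_hom_def Ring.ring_hom_def by (simp only: mem_Collect_eq cstar_rec_simps) simp
qed

sublocale iota: star_rep X iota by (rule star_rep_iota)

lemma w_simps: "star X w = w" "w \<otimes>\<^bsub>X\<^esub> w = \<one>\<^bsub>X\<^esub>"
proof -
  have 1: "star X w \<otimes>\<^bsub>X\<^esub> w = \<one>\<^bsub>X\<^esub>" "w \<otimes>\<^bsub>X\<^esub> w = \<one>\<^bsub>X\<^esub>"
    using eval_eq[OF W_rels(1)] eval_eq[OF W_rels(3)] by (simp_all add: E.eval_mult E.eval_adjoint w_def)
  then show "w \<otimes>\<^bsub>X\<^esub> w = \<one>\<^bsub>X\<^esub>" by simp
  have "star X w = star X w \<otimes>\<^bsub>X\<^esub> (w \<otimes>\<^bsub>X\<^esub> w)" by (simp add: 1 X.star_closed)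
  also have "\<dots> = star X w \<otimes>\<^bsub>X\<^esub> w \<otimes>\<^bsub>X\<^esub> w" by (rule X.m_assoc[symmetric]) (simp_all add: X.star_closed)
  also have "\<dots> = w" unfolding 1(1) by simp
  finally show "star X w = w" .
qed

lemma covariance: "w \<otimes>\<^bsub>X\<^esub> iota x \<otimes>\<^bsub>X\<^esub> w = iota (act x)"
  using eval_eq[OF el_rels(6), of x] w_simps(1)
  by (simp add: E.eval_mult E.eval_adjoint eval_el w_def)

text \<open>From w g w = g^* and w^2 = 1. This identity makes g w self-adjoint with square
  1.\<close>

lemma covariance_gen: "iota (ugen g) \<otimes>\<^bsub>X\<^esub> w = w \<otimes>\<^bsub>X\<^esub> star X (iota (ugen g))"
proof -
  have "w \<otimes>\<^bsub>X\<^esub> star X (iota (ugen g)) = w \<otimes>\<^bsub>X\<^esub> (w \<otimes>\<^bsub>X\<^esub> iota (ugen g) \<otimes>\<^bsub>X\<^esub> w)"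
    by (simp add: covariance act_ugen iota.star)
  also have "\<dots> = (w \<otimes>\<^bsub>X\<^esub> w) \<otimes>\<^bsub>X\<^esub> iota (ugen g) \<otimes>\<^bsub>X\<^esub> w" by (simp add: X.m_assoc)
  finally show ?thesis by (simp add: w_simps)
qed

primrec refl_image :: "refl_gen \<Rightarrow> (nat \<Rightarrow> (nat \<Rightarrow> f2_gen free_star) set crossed_gen free_star) set" where
  "refl_image W1 = w"
| "refl_image W2 = iota (ugen U_gen) \<otimes>\<^bsub>X\<^esub> w"
| "refl_image W3 = iota (ugen V_gen) \<otimes>\<^bsub>X\<^esub> w"

lemma refl_image_closed [simp]: "refl_image g \<in> carrier X"
  by (cases g) simp_all

lemma refl_image_simps: "star X (refl_image g) = refl_image g" "refl_image g \<otimes>\<^bsub>X\<^esub> refl_image g = \<one>\<^bsub>X\<^esub>"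
proof -
  have 1: "star X (iota (ugen h) \<otimes>\<^bsub>X\<^esub> w) = iota (ugen h) \<otimes>\<^bsub>X\<^esub> w" for h
    unfolding covariance_gen by (simp add: X.star_mult w_simps X.star_star X.star_closed covariance_gen[symmetric])
  have 2: "iota (ugen h) \<otimes>\<^bsub>X\<^esub> w \<otimes>\<^bsub>X\<^esub> (iota (ugen h) \<otimes>\<^bsub>X\<^esub> w) = \<one>\<^bsub>X\<^esub>" for h
  proof -
    have "iota (ugen h) \<otimes>\<^bsub>X\<^esub> w \<otimes>\<^bsub>X\<^esub> (iota (ugen h) \<otimes>\<^bsub>X\<^esub> w)
        = iota (ugen h) \<otimes>\<^bsub>X\<^esub> w \<otimes>\<^bsub>X\<^esub> (w \<otimes>\<^bsub>X\<^esub> star X (iota (ugen h)))"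
      by (simp only: covariance_gen[symmetric])
    also have "\<dots> = iota (ugen h) \<otimes>\<^bsub>X\<^esub> (w \<otimes>\<^bsub>X\<^esub> w) \<otimes>\<^bsub>X\<^esub> star X (iota (ugen h))"
      by (simp add: X.m_assoc X.star_closed)
    also have "\<dots> = iota (ugen h * adj (ugen h))" by (simp add: w_simps iota.mult iota.star)
    finally show ?thesis by (simp add: ugen_f2 iota.one)
  qed
  show "star X (refl_image g) = refl_image g" "refl_image g \<otimes>\<^bsub>X\<^esub> refl_image g = \<one>\<^bsub>X\<^esub>"
    by (cases g; simp add: 1 2 w_simps)+
qed

lemma from_refl: "\<exists>\<Phi>. star_rep X \<Phi> \<and> (\<forall>g. \<Phi> (ugen g) = refl_image g)"
proof -
  interpret F: cstar_evaluation X refl_image by unfold_locales simp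
  have "X.eval_poly refl_image r = \<zero>\<^bsub>X\<^esub>" if "r \<in> relations" for r
    using that by (auto simp: relations_refl_gen_def refl_rels_def F.eval_diff F.eval_mult F.eval_adjoint
        refl_image_simps a_minus_def X.r_neg)
  then obtain \<phi> where \<phi>: "\<phi> \<in> star_hom uni X" "\<And>g. \<phi> (universal_gen relations g) = refl_image g"
    using universal_property[OF admissible_relations X.cstar_algebra_axioms, of refl_image] by auto
  have "star_rep X (\<lambda>x. \<phi> (rep_u x))"
    by unfold_locales (rule star_hom_comp[OF star_hom_rep_u \<phi>(1)])
  then show ?thesis using \<phi>(2) by (intro exI[of _ "\<lambda>x. \<phi> (rep_u x)"]) simp
qed

text \<open>Covariance is required for all elements of the free group algebra; both sides are
  morphisms, so comparing them on U and V is enough. There it holds because conjugation by W1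
  inverts W2 W1 and W3 W1.\<close>

lemma to_refl:
  assumes \<theta>: "star_morphism \<theta>" "\<And>g. \<theta> (ugen g) = f2_image g"
  shows "\<exists>\<Psi>\<in>star_hom X cstar_rec. \<Psi> w = ugen W1 \<and> (\<forall>x. \<Psi> (iota x) = \<theta> x) \<and>
    (\<forall>y\<in>carrier X. norm (\<Psi> y) \<le> cnorm X y)"
proof -
  interpret \<theta>: star_morphism \<theta> by (rule \<theta>(1))
  have "star_morphism (\<lambda>x. ugen W1 * x * ugen W1 :: refl_algebra)"
  proof
    fix x y :: refl_algebra and c
    show "ugen W1 * (cs c * x) * ugen W1 = cs c * (ugen W1 * x * ugen W1)" by (metis cs_comm mult.assoc)
    show "ugen W1 * (x * y) * ugen W1 = ugen W1 * x * ugen W1 * (ugen W1 * y * ugen W1)"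
      by (simp add: mult.assoc refl_cancel)
  qed (simp_all add: algebra_simps ugen_refl adj_mult)
  then have "star_morphism (\<lambda>x. ugen W1 * \<theta> x * ugen W1)" by (rule star_morphism_comp[OF _ \<theta>(1)])
  moreover have "ugen W1 * \<theta> (ugen g) * ugen W1 = \<theta> (act (ugen g))" for g
    by (cases g) (simp_all add: act_ugen \<theta>.star \<theta>(2) adj_mult ugen_refl mult.assoc refl_cancel)
  ultimately have cov: "ugen W1 * \<theta> x * ugen W1 = \<theta> (act x)" for x
    by (rule star_morphism_eq[OF _ star_morphism_comp[OF \<theta>(1) star_morphism_act]])
  \<comment> \<open>The value 0 off the carrier matches the relations for such symbols.\<close>
  define f where "f g = (case g of W_gen \<Rightarrow> ugen W1 | Elt a \<Rightarrow> if a \<in> carrier CstarF2 then \<theta> (abs_u a) else 0)" for g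
  have f: "f (Elt (rep_u x)) = \<theta> x" "f W_gen = ugen W1" for x by (simp_all add: f_def CstarF2_uni)
  have f_el: "eval_at f (el x) = \<theta> x" for x by (simp add: el_def f)
  have "eval_at f r = 0" if "r \<in> rels" for r
  proof -
    have "eval_at f (gen (Elt a)) = 0" if "a \<notin> carrier CstarF2" for a using that by (simp add: f_def)
    then show ?thesis using that unfolding rels_eq
      by (elim UnE) (auto simp: f_el f \<theta>.add \<theta>.cs \<theta>.mult \<theta>.star ugen_refl cov)
  qed
  then obtain \<Psi> where \<Psi>: "\<Psi> \<in> star_hom X cstar_rec" "\<And>g. \<Psi> (xgen g) = f g"
    "\<And>y. y \<in> carrier X \<Longrightarrow> norm (\<Psi> y) \<le> cnorm X y"
    using universal_property[OF admissible_rels cstar_algebra_rec, of f]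
    unfolding crossed_product_def[symmetric] eval_at_def by auto
  then show ?thesis by (intro bexI[of _ \<Psi>]) (simp_all add: w_def iota_def f)
qed

text \<open>\<open>\<Psi>\<close> after \<open>\<Phi>\<close> is a morphism of typed algebras and is
  settled on generators. The other composite fixes every *-polynomial in the generators, and
  contractivity of both maps extends this to the closure.\<close>

theorem crossed_product_iso:
  "\<exists>\<Phi> :: refl_algebra \<Rightarrow> _. star_rep X \<Phi> \<and> bij_betw \<Phi> UNIV (carrier X)"
proof -
  obtain \<theta> where \<theta>: "star_morphism \<theta>" "\<And>g. \<theta> (ugen g) = f2_image g" using f2_embedding by blast
  obtain \<Phi> where \<Phi>: "star_rep X \<Phi>" "\<And>g. \<Phi> (ugen g) = refl_image g" using from_refl by blast
  obtain \<Psi> where \<Psi>: "\<Psi> \<in> star_hom X cstar_rec" "\<Psi> w = ugen W1" "\<And>x. \<Psi> (iota x) = \<theta> x"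
    "\<And>y. y \<in> carrier X \<Longrightarrow> norm (\<Psi> y) \<le> cnorm X y" using to_refl[OF \<theta>] by blast
  interpret \<Phi>: star_rep X \<Phi> by (rule \<Phi>(1))
  have \<Psi>_simps: "\<Psi> (x \<otimes>\<^bsub>X\<^esub> y) = \<Psi> x * \<Psi> y" "\<Psi> (x \<oplus>\<^bsub>X\<^esub> y) = \<Psi> x + \<Psi> y" if "x \<in> carrier X" "y \<in> carrier X" for x y
    using \<Psi>(1) that by (auto simp: star_hom_def Ring.ring_hom_def)
  have \<Psi>_unary: "\<Psi> (c \<odot>\<^bsub>X\<^esub> x) = cs c * \<Psi> x" "\<Psi> (star X x) = adj (\<Psi> x)" if "x \<in> carrier X" for x c
    using \<Psi>(1) that by (auto simp: star_hom_def Ring.ring_hom_def)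
  have \<Psi>_one: "\<Psi> \<one>\<^bsub>X\<^esub> = 1"
    using \<Psi>(1) by (auto simp: star_hom_def Ring.ring_hom_def)
  have "star_morphism (\<lambda>x. \<Psi> (\<Phi> x))"
    unfolding star_morphism_star_hom[symmetric] by (rule star_hom_comp[OF \<Phi>.hom \<Psi>(1)])
  moreover have "\<Psi> (\<Phi> (ugen g)) = ugen g" for g
    by (cases g) (simp_all add: \<Phi>(2) \<Psi>_simps \<Psi>(2,3) \<theta>(2) mult.assoc ugen_refl)
  ultimately have left: "\<Psi> (\<Phi> x) = x" for x
    by (rule star_morphism_eq[OF _ star_morphism_id])
  have "star_rep X (\<lambda>x. \<Phi> (\<theta> x))"
    by unfold_locales (rule star_hom_comp[OF _ \<Phi>.hom], simp add: star_morphism_star_hom \<theta>(1))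
  moreover have "\<Phi> (\<theta> (ugen g)) = iota (ugen g)" for g
    by (cases g) (simp_all add: \<theta>(2) \<Phi>.mult \<Phi>(2) X.m_assoc w_simps)
  ultimately have \<theta>_iota: "\<Phi> (\<theta> x) = iota x" for x
    by (rule star_rep_eq[OF _ star_rep_iota])
  have gens: "\<Phi> (\<Psi> (xgen g)) = xgen g" for g
  proof (cases g)
    case W_gen
    then show ?thesis using \<Psi>(2) by (simp add: w_def[symmetric] \<Phi>(2))
  next
    case (Elt a)
    show ?thesis
    proof (cases "a \<in> carrier CstarF2")
      case True
      then have "xgen g = iota (abs_u a)" by (simp add: Elt iota_def CstarF2_uni)
      then show ?thesis by (simp add: \<Psi>(3) \<theta>_iota)
    next
      case False
      then have "gen g \<in> rels" by (auto simp: Elt crossed_rels_def)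
      then have "xgen g = \<zero>\<^bsub>X\<^esub>"
        using universal_relations[OF admissible_rels, of "gen g"] by (simp flip: crossed_product_def)
      moreover have "\<Psi> \<zero>\<^bsub>X\<^esub> = 0" using \<Psi>(4)[of "\<zero>\<^bsub>X\<^esub>"] by simp
      ultimately show ?thesis by (simp add: \<Phi>.zero)
    qed
  qed
  have poly: "\<Phi> (\<Psi> (X.eval_poly xgen z)) = X.eval_poly xgen z" for z
  proof (induction z rule: free_star_induct)
    case (scale c z)
    have "\<Psi> (c \<odot>\<^bsub>X\<^esub> X.eval_poly xgen z) = cs c * \<Psi> (X.eval_poly xgen z)" by (rule \<Psi>_unary(1)[OF E.eval_closed])
    then show ?case by (simp only: E.eval_scale \<Phi>.smult scale)
  qed (simp_all add: gens E.eval_add E.eval_mult E.eval_adjoint \<Psi>_simps \<Phi>.add \<Phi>.mult \<Phi>.star \<Phi>.one \<Psi>_unary \<Psi>_one)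
  have right: "\<Phi> (\<Psi> y) = y" if y: "y \<in> carrier X" for y
  proof (rule X.eq_if_close[OF \<Phi>.closed y])
    fix n
    obtain z where z: "cnorm X (y \<ominus>\<^bsub>X\<^esub> X.eval_poly xgen z) \<le> inverse (real (Suc n))"
      using universal_dense[OF admissible_rels, of y "inverse (real (Suc n))"] y
      by (auto simp flip: crossed_product_def)
    let ?z = "X.eval_poly xgen z"
    have "\<Psi> (y \<ominus>\<^bsub>X\<^esub> ?z) = \<Psi> y - \<Psi> ?z"
      using y \<Psi>_unary(1)[of ?z "-1"] by (simp add: a_minus_def \<Psi>_simps X.smult_minus_one)
    then have "\<Phi> (\<Psi> (y \<ominus>\<^bsub>X\<^esub> ?z)) = \<Phi> (\<Psi> y) \<ominus>\<^bsub>X\<^esub> ?z" by (simp add: \<Phi>.diff poly)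
    then have "cnorm X (\<Phi> (\<Psi> y) \<ominus>\<^bsub>X\<^esub> ?z) \<le> cnorm X (y \<ominus>\<^bsub>X\<^esub> ?z)"
      using order_trans[OF \<Phi>.cnorm_le \<Psi>(4)[of "y \<ominus>\<^bsub>X\<^esub> ?z"]] y by simp
    moreover have "cnorm X (\<Phi> (\<Psi> y) \<ominus>\<^bsub>X\<^esub> y) \<le> cnorm X (\<Phi> (\<Psi> y) \<ominus>\<^bsub>X\<^esub> ?z) + cnorm X (?z \<ominus>\<^bsub>X\<^esub> y)"
      using y by (intro X.cnorm_minus_triangle) simp_all
    ultimately show "cnorm X (\<Phi> (\<Psi> y) \<ominus>\<^bsub>X\<^esub> y) \<le> 2 * inverse (real (Suc n))"
      using z y by (simp add: X.cnorm_minus_commute[of ?z])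
  qed (rule LIMSEQ_inverse_real_of_nat)
  have "bij_betw \<Phi> UNIV (carrier X)"
    by (rule bij_betwI[where g = \<Psi>]) (use left right in auto)
  then show ?thesis using \<Phi>(1) by blast
qed

end

section \<open>K-theory\<close>

text \<open>A formal difference is classified by its \<rho>-value in G. Two differences have the
  same value when \<rho> agrees on the crosswise sums: \<open>stable\<close> turns this into the
  relation, cancellation in G gives the converse, and \<open>surj\<close> makes every value
  occur.\<close>

lemma (in comm_group) K0_classification:
  fixes A :: "('c, 'm) cstar_scheme" and \<rho> :: "'c mat \<Rightarrow> 'a"
  assumes closed: "\<And>p. p \<in> projections A \<Longrightarrow> \<rho> p \<in> carrier G"
    and id0: "mat_id A 0 \<in> projections A"
    and dsum: "\<And>p q. p \<in> projections A \<Longrightarrow> q \<in> projections A \<Longrightarrow> dsum A p q \<in> projections A \<and> \<rho> (dsum A p q) = \<rho> p \<otimes> \<rho> q"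
    and mvn: "\<And>p q. p \<in> projections A \<Longrightarrow> q \<in> projections A \<Longrightarrow> mvn_equiv A p q \<Longrightarrow> \<rho> p = \<rho> q"
    and stable: "\<And>p q. p \<in> projections A \<Longrightarrow> q \<in> projections A \<Longrightarrow> \<rho> p = \<rho> q \<Longrightarrow>
      \<exists>r\<in>projections A. mvn_equiv A (dsum A p r) (dsum A q r)"
    and surj: "\<And>z. z \<in> carrier G \<Longrightarrow> \<exists>p\<in>projections A. \<exists>q\<in>projections A. \<rho> p = z \<otimes> \<rho> q"
  shows "comm_group (K0 A) \<and> K0 A \<cong> G"
proof -
  let ?P = "projections A"
  \<comment> \<open>The class of formal differences of value z, written without inverses.\<close>
  define C where "C z = {(p, q). p \<in> ?P \<and> q \<in> ?P \<and> \<rho> p = z \<otimes> \<rho> q}" for z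
  have cancel: "x \<otimes> z = y \<otimes> z \<longleftrightarrow> x = y" if "x \<in> carrier G" "y \<in> carrier G" "z \<in> carrier G" for x y z
    using that by simp
  have rel: "((p, q), (p', q')) \<in> K0_rel A \<longleftrightarrow>
      p \<in> ?P \<and> q \<in> ?P \<and> p' \<in> ?P \<and> q' \<in> ?P \<and> \<rho> p \<otimes> \<rho> q' = \<rho> p' \<otimes> \<rho> q" for p q p' q'
  proof (cases "p \<in> ?P \<and> q \<in> ?P \<and> p' \<in> ?P \<and> q' \<in> ?P")
    case True
    then have d: "dsum A p q' \<in> ?P" "dsum A p' q \<in> ?P" "\<rho> (dsum A p q') = \<rho> p \<otimes> \<rho> q'" "\<rho> (dsum A p' q) = \<rho> p' \<otimes> \<rho> q"
      using dsum by blast+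
    show ?thesis
    proof
      assume "((p, q), (p', q')) \<in> K0_rel A"
      then obtain r where r: "r \<in> ?P" "mvn_equiv A (dsum A (dsum A p q') r) (dsum A (dsum A p' q) r)"
        by (auto simp: K0_rel_def)
      have "\<rho> (dsum A (dsum A p q') r) = \<rho> (dsum A (dsum A p' q) r)"
        using mvn[OF _ _ r(2)] dsum[OF d(1) r(1)] dsum[OF d(2) r(1)] by blast
      then have "(\<rho> p \<otimes> \<rho> q') \<otimes> \<rho> r = (\<rho> p' \<otimes> \<rho> q) \<otimes> \<rho> r"
        using dsum[OF d(1) r(1)] dsum[OF d(2) r(1)] d by simp
      then show "p \<in> ?P \<and> q \<in> ?P \<and> p' \<in> ?P \<and> q' \<in> ?P \<and> \<rho> p \<otimes> \<rho> q' = \<rho> p' \<otimes> \<rho> q"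
        using True r(1) closed by (simp add: cancel)
    next
      assume "p \<in> ?P \<and> q \<in> ?P \<and> p' \<in> ?P \<and> q' \<in> ?P \<and> \<rho> p \<otimes> \<rho> q' = \<rho> p' \<otimes> \<rho> q"
      then show "((p, q), (p', q')) \<in> K0_rel A"
        using stable[OF d(1,2)] d by (auto simp: K0_rel_def)
    qed
  qed (auto simp: K0_rel_def)
  have class_eq: "K0_rel A `` {(p, q)} = C z" if "(p, q) \<in> C z" "z \<in> carrier G" for p q z
  proof -
    have z: "z \<in> carrier G" and pq: "p \<in> ?P" "q \<in> ?P" "\<rho> p = z \<otimes> \<rho> q" using that by (auto simp: C_def)
    have "\<rho> p \<otimes> \<rho> q' = \<rho> p' \<otimes> \<rho> q \<longleftrightarrow> \<rho> p' = z \<otimes> \<rho> q'" if "p' \<in> ?P" "q' \<in> ?P" for p' q'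
    proof -
      have "\<rho> p \<otimes> \<rho> q' = (z \<otimes> \<rho> q') \<otimes> \<rho> q"
        using pq that closed z by (simp add: m_ac)
      then show ?thesis using pq that closed z by (auto simp: cancel)
    qed
    then have "((p, q), (p', q')) \<in> K0_rel A \<longleftrightarrow> (p', q') \<in> C z" for p' q'
      using pq by (auto simp: rel C_def)
    then show ?thesis by auto
  qed
  have nonempty: "\<exists>p q. (p, q) \<in> C z" if "z \<in> carrier G" for z using surj[OF that] by (auto simp: C_def)
  have inj: "z = z'" if e: "C z = C z'" and z: "z \<in> carrier G" "z' \<in> carrier G" for z z'
  proof -
    obtain p q where "(p, q) \<in> C z" "(p, q) \<in> C z'" using nonempty[OF z(1)] e by auto
    then show ?thesis using z closed by (auto simp: C_def cancel)
  qed
  have carrier: "carrier (K0 A) = C ` carrier G"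
  proof
    show "C ` carrier G \<subseteq> carrier (K0 A)"
    proof
      fix X assume "X \<in> C ` carrier G"
      then obtain z where z: "z \<in> carrier G" "X = C z" by blast
      obtain p q where pq: "(p, q) \<in> C z" using nonempty[OF z(1)] by blast
      then have "(p, q) \<in> ?P \<times> ?P" by (auto simp: C_def)
      then have "K0_rel A `` {(p, q)} \<in> (?P \<times> ?P) // K0_rel A" by (rule quotientI)
      then show "X \<in> carrier (K0 A)" using class_eq[OF pq z(1)] z(2) by (simp add: K0_def)
    qed
    show "carrier (K0 A) \<subseteq> C ` carrier G"
    proof
      fix X assume "X \<in> carrier (K0 A)"
      then obtain p q where pq: "p \<in> ?P" "q \<in> ?P" "X = K0_rel A `` {(p, q)}"
        by (auto simp: K0_def elim!: quotientE)
      let ?z = "\<rho> p \<otimes> inv (\<rho> q)"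
      have "?z \<in> carrier G" "(p, q) \<in> C ?z" using pq closed by (auto simp: C_def m_assoc)
      then show "X \<in> C ` carrier G" using class_eq pq(3) by blast
    qed
  qed
  have mult: "C z \<otimes>\<^bsub>K0 A\<^esub> C z' = C (z \<otimes> z')" if z: "z \<in> carrier G" "z' \<in> carrier G" for z z'
  proof -
    have d: "K0_rel A `` {(dsum A p p', dsum A q q')} = C (z \<otimes> z')" if "(p, q) \<in> C z" "(p', q') \<in> C z'" for p q p' q'
    proof (rule class_eq)
      have "p \<in> ?P" "q \<in> ?P" "p' \<in> ?P" "q' \<in> ?P" "\<rho> p = z \<otimes> \<rho> q" "\<rho> p' = z' \<otimes> \<rho> q'"
        using that by (auto simp: C_def)
      then show "(dsum A p p', dsum A q q') \<in> C (z \<otimes> z')"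
        using dsum[of p p'] dsum[of q q'] z closed by (simp add: C_def m_ac)
    qed (use z in simp)
    obtain x x' where x: "x \<in> C z" "x' \<in> C z'" using nonempty z by blast
    have "(\<Union>(p', q')\<in>C z'. K0_rel A `` {(dsum A p p', dsum A q q')}) = C (z \<otimes> z')" if "(p, q) \<in> C z" for p q
      by (rule UN_constant_eq[OF x(2)]) (clarsimp simp: d[OF that])
    note e = this
    have "(\<Union>(p, q)\<in>C z. \<Union>(p', q')\<in>C z'. K0_rel A `` {(dsum A p p', dsum A q q')}) = C (z \<otimes> z')"
      by (rule UN_constant_eq[OF x(1)]) (clarsimp simp: e)
    then show ?thesis by (simp add: K0_def)
  qed
  have one: "\<one>\<^bsub>K0 A\<^esub> = C \<one>"
    using class_eq[of "mat_id A 0" "mat_id A 0" \<one>] id0 closed by (simp add: K0_def C_def)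
  have comm: "comm_group (K0 A)"
  proof (rule comm_groupI)
    fix x assume "x \<in> carrier (K0 A)"
    then obtain z where z: "z \<in> carrier G" "x = C z" using carrier by blast
    then have "C (inv z) \<in> carrier (K0 A)" "C (inv z) \<otimes>\<^bsub>K0 A\<^esub> x = \<one>\<^bsub>K0 A\<^esub>"
      by (simp_all add: carrier mult one)
    then show "\<exists>y\<in>carrier (K0 A). y \<otimes>\<^bsub>K0 A\<^esub> x = \<one>\<^bsub>K0 A\<^esub>" by blast
  qed (auto simp: carrier mult one m_ac)
  have "C \<in> iso G (K0 A)"
    by (rule isoI) (auto simp: hom_def mult carrier bij_betw_def inj_on_def intro: inj)
  then have "G \<cong> K0 A" by (rule is_isoI)
  then show ?thesis using comm iso_sym by blast
qed

text \<open>If any two unitaries of any sizes are related, the set of all unitaries is the only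
  class.\<close>

lemma trivial_K1:
  assumes id0: "mat_id A 0 \<in> unitaries A 0"
    and dsum: "\<And>m n u v. u \<in> unitaries A m \<Longrightarrow> v \<in> unitaries A n \<Longrightarrow> dsum A u v \<in> unitaries A (m + n)"
    and path: "\<And>m n u v. u \<in> unitaries A m \<Longrightarrow> v \<in> unitaries A n \<Longrightarrow> (u, v) \<in> K1_rel A"
  shows "trivial_group (K1 A)"
proof -
  define T where "T = (\<Union>n. unitaries A n)"
  have rel: "K1_rel A `` {u} = T" if "u \<in> T" for u
    using that path by (auto simp: K1_rel_def T_def)
  have T: "mat_id A 0 \<in> T" using id0 by (auto simp: T_def)
  have carrier: "carrier (K1 A) = {T}"
    using rel T by (auto simp: K1_def quotient_def T_def[symmetric])
  have one: "\<one>\<^bsub>K1 A\<^esub> = T" using rel[OF T] by (simp add: K1_def)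
  have "K1_rel A `` {dsum A u v} = T" if "u \<in> T" "v \<in> T" for u v
    using dsum that unfolding T_def by (intro rel[unfolded T_def]) blast
  then have mult: "T \<otimes>\<^bsub>K1 A\<^esub> T = T" using T by (auto simp: K1_def)
  have "group (K1 A)"
    by (rule groupI) (auto simp: carrier mult one)
  then show ?thesis by (simp add: trivial_group_def carrier one)
qed

section \<open>Transport of matrices, projections and unitaries along an isomorphism\<close>

locale star_iso = star_rep X f for X :: "('x, 'm) cstar_scheme" and f :: "'a::unital_cstar \<Rightarrow> 'x" +
  assumes bij: "bij_betw f UNIV (carrier X)"
begin

lemma f_inject [simp]: "f x = f y \<longleftrightarrow> x = y"
  using bij by (auto simp: bij_betw_def inj_def)

abbreviation "F \<equiv> map_mat f"

lemma F_inject: "F M = F N \<longleftrightarrow> M = N"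
proof
  assume e: "F M = F N"
  then have d: "dim_row M = dim_row N" "dim_col M = dim_col N"
    by (metis index_map_mat(2)) (metis e index_map_mat(3))
  show "M = N"
  proof (rule eq_matI)
    fix i j assume "i < dim_row N" "j < dim_col N"
    then have "f (M $$ (i, j)) = f (N $$ (i, j))" using e d by (metis index_map_mat(1))
    then show "M $$ (i, j) = N $$ (i, j)" by simp
  qed (use d in auto)
qed simp

lemma mats_F: "mats X m n = F ` carrier_mat m n"
proof
  show "F ` carrier_mat m n \<subseteq> mats X m n"
    by (auto simp: mats_def elements_mat_def)
  show "mats X m n \<subseteq> F ` carrier_mat m n"
  proof
    fix M assume M: "M \<in> mats X m n"
    then have c: "M \<in> carrier_mat m n" by (simp add: mats_def)
    define N where "N = map_mat (inv_into UNIV f) M"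
    have "M $$ (i, j) \<in> carrier X" if "i < m" "j < n" for i j
      using M that by (force simp: mats_def elements_mat_def)
    then have "f (inv_into UNIV f (M $$ (i, j))) = M $$ (i, j)" if "i < m" "j < n" for i j
      using that bij by (metis bij_betw_def f_inv_into_f)
    then have "F N = M" using c by (intro eq_matI) (auto simp: N_def)
    moreover have "N \<in> carrier_mat m n" using c by (simp add: N_def)
    ultimately show "M \<in> F ` carrier_mat m n" by blast
  qed
qed

lemma f_sum: "finite S \<Longrightarrow> f (sum g S) = (\<Oplus>\<^bsub>X\<^esub>k\<in>S. f (g k))"
  by (induction S rule: finite_induct) (simp_all add: zero add)

lemma mat_times_F: "dim_col M = dim_row N \<Longrightarrow> mat_times X (F M) (F N) = F (M * N)"
  by (rule eq_matI) (auto simp: mat_times_def scalar_prod_def f_sum mult atLeast0LessThan intro!: X.finsum_cong')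

lemma mat_star_F: "mat_star X (F M) = F (madj M)"
  by (rule eq_matI) (auto simp: mat_star_def star)

lemma mat_id_F: "mat_id X n = F (1\<^sub>m n)"
  by (rule eq_matI) (auto simp: mat_id_def zero one)

lemma mat_zero_F: "mat_zero X m n = F (0\<^sub>m m n)"
  by (rule eq_matI) (auto simp: mat_zero_def zero)

lemma dsum_F: "dsum X (F M) (F N) = F (dsm M N)"
  unfolding dsum_def dsm_def mat_zero_F by (rule eq_matI) auto

lemma projections_F: "projections X = F ` {P. \<exists>n. proj n P}"
proof -
  have "F P \<in> projections X \<longleftrightarrow> (\<exists>n. proj n P)" for P
    unfolding projections_def mats_F
    by (auto simp: proj_def mat_star_F mat_times_F F_inject)
  moreover have "p \<in> range F" if "p \<in> projections X" for p
    using that unfolding projections_def mats_F by auto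
  ultimately show ?thesis by blast
qed

lemma unitaries_F: "unitaries X n = F ` {u. unit n u}"
proof -
  have "F u \<in> unitaries X n \<longleftrightarrow> unit n u" for u
    unfolding unitaries_def mats_F unit_def
    by (auto simp: mat_star_F mat_times_F mat_id_F F_inject)
  moreover have "p \<in> range F" if "p \<in> unitaries X n" for p
    using that unfolding unitaries_def mats_F by auto
  ultimately show ?thesis by blast
qed

lemma mvn_equiv_F: "mvn_equiv X (F P) (F Q) \<longleftrightarrow> mvn P Q"
  unfolding mvn_equiv_def mvn_def mats_F
  by (auto simp: mat_star_F mat_times_F F_inject)

lemma upath_F: assumes "upath n u v" shows "\<exists>\<gamma>. unitary_path X n \<gamma> \<and> \<gamma> 0 = F u \<and> \<gamma> 1 = F v"
proof -
  obtain \<gamma> where g: "\<And>t. t \<in> {0..1} \<Longrightarrow> unit n (\<gamma> t)" "mat_path n \<gamma>" "\<gamma> 0 = u" "\<gamma> 1 = v"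
    using assms unfolding upath_def by blast
  have c: "\<gamma> t \<in> carrier_mat n n" if "t \<in> {0..1}" for t using g(1)[OF that] by (simp add: unit_def)
  have "((\<lambda>t. cnorm X (F (\<gamma> t) $$ (i, j) \<ominus>\<^bsub>X\<^esub> F (\<gamma> s) $$ (i, j))) \<longlongrightarrow> 0) (at s within {0..1})"
    if ij: "i < n" "j < n" and s: "s \<in> {0..1}" for i j s
  proof -
    have "((\<lambda>t. \<gamma> t $$ (i, j)) \<longlongrightarrow> \<gamma> s $$ (i, j)) (at s within {0..1})"
      using g(2) ij s unfolding mat_path_def continuous_on_def by blast
    then have lim: "((\<lambda>t. norm (\<gamma> t $$ (i, j) - \<gamma> s $$ (i, j))) \<longlongrightarrow> 0) (at s within {0..1})"
      by (intro tendsto_norm_zero LIM_zero)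
    have "cnorm X (F (\<gamma> t) $$ (i, j) \<ominus>\<^bsub>X\<^esub> F (\<gamma> s) $$ (i, j)) = cnorm X (f (\<gamma> t $$ (i, j) - \<gamma> s $$ (i, j)))"
      if "t \<in> {0..1}" for t using c[OF that] c[OF s] ij by (simp add: diff)
    then have ev: "\<forall>\<^sub>F t in at s within {0..1}. cnorm X (F (\<gamma> t) $$ (i, j) \<ominus>\<^bsub>X\<^esub> F (\<gamma> s) $$ (i, j))
        = cnorm X (f (\<gamma> t $$ (i, j) - \<gamma> s $$ (i, j)))"
      by (simp add: eventually_at_filter)
    have "((\<lambda>t. cnorm X (f (\<gamma> t $$ (i, j) - \<gamma> s $$ (i, j)))) \<longlongrightarrow> 0) (at s within {0..1})"
      by (rule tendsto_sandwich[OF _ _ tendsto_const lim]) (simp_all add: cnorm_le)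
    then show ?thesis using tendsto_cong[OF ev] by blast
  qed
  then have "unitary_path X n (\<lambda>t. F (\<gamma> t))"
    unfolding unitary_path_def unitaries_F using g(1) by auto
  then show ?thesis using g(3,4) by blast
qed

text \<open>Contracting u needs size 2m and contracting v needs size 2n. Both are padded to the
  common size 2m + 2n and joined through the identity.\<close>

lemma trivial_K1_if_stably_trivial:
  assumes triv: "\<And>n u. unit n (u :: 'a mat) \<Longrightarrow> upath (n + n) (dsm u (1\<^sub>m n)) (1\<^sub>m (n + n))"
  shows "trivial_group (K1 X)"
proof (rule trivial_K1)
  show "mat_id X 0 \<in> unitaries X 0" unfolding unitaries_F mat_id_F using unit_one by blast
next
  fix m n u v assume "u \<in> unitaries X m" "v \<in> unitaries X n"
  then show "dsum X u v \<in> unitaries X (m + n)" unfolding unitaries_F by (auto simp: dsum_F intro!: imageI unit_dsm)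
next
  fix m n p q assume pq: "p \<in> unitaries X m" "q \<in> unitaries X n"
  then obtain u v where u: "p = F u" "unit m u" and v: "q = F v" "unit n v" by (auto simp: unitaries_F)
  have *: "upath (m + m + k) (dsm u (1\<^sub>m (m + k))) (1\<^sub>m (m + m + k))" if "unit m u" for m k and u :: "'a mat"
  proof -
    have "upath (m + m + k) (dsm (dsm u (1\<^sub>m m)) (1\<^sub>m k)) (dsm (1\<^sub>m (m + m)) (1\<^sub>m k))"
      by (intro upath_dsm triv that upath_refl unit_one)
    then show ?thesis unfolding dsm_assoc[symmetric] dsm_one .
  qed
  have e: "m + (m + (n + n)) = m + m + (n + n)" "m + (m + (n + n)) = n + (n + (m + m))" "n + n + (m + m) = m + m + (n + n)" by simp_all
  have "upath (m + (m + (n + n))) (dsm u (1\<^sub>m (m + (n + n)))) (1\<^sub>m (m + (m + (n + n))))"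
    using *[OF u(2), of "n + n"] by (simp only: e(1))
  moreover have "upath (m + (m + (n + n))) (dsm v (1\<^sub>m (n + (m + m)))) (1\<^sub>m (m + (m + (n + n))))"
    using *[OF v(2), of "m + m"] by (simp only: e(1,3))
  ultimately have "upath (m + (m + (n + n))) (dsm u (1\<^sub>m (m + (n + n)))) (dsm v (1\<^sub>m (n + (m + m))))"
    by (blast intro: upath_trans upath_sym)
  from upath_F[OF this] obtain \<gamma> where "unitary_path X (m + (m + (n + n))) \<gamma>"
    "\<gamma> 0 = dsum X p (mat_id X (m + (n + n)))" "\<gamma> 1 = dsum X q (mat_id X (n + (m + m)))"
    by (auto simp: u v mat_id_F dsum_F)
  then show "(p, q) \<in> K1_rel X"
    unfolding K1_rel_def mem_Collect_eq prod.case using pq e(2) by blast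
qed

end

section \<open>Ranks\<close>

text \<open>The index \<open>None\<close> stands for the character that vanishes on all three projections.\<close>

definition rank :: "refl_gen option \<Rightarrow> refl_algebra mat \<Rightarrow> int" where
  "rank i P = \<lfloor>Re (rank_at (set_option i) P)\<rfloor>"

text \<open>Characters send projections to complex projections, whose traces are natural numbers, so
  the floor in \<open>rank\<close> returns the trace itself.\<close>

lemma rank_at_rank: assumes "proj n P" shows "rank_at (set_option i) P = of_int (rank i P)"
proof -
  obtain k where "rank_at (set_option i) P = of_nat k"
    using complex_proj_rank[OF star_morphism.map_mat_proj[OF character(1) assms]] by blast
  then show ?thesis by (simp add: rank_def)
qed

lemma rank_eqI: "proj n P \<Longrightarrow> rank_at (set_option i) P = of_int k \<Longrightarrow> rank i P = k"
  using rank_at_rank by (metis of_int_eq_iff)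

lemma rank_dsm: assumes "proj m P" "proj n Q" shows "rank i (dsm P Q) = rank i P + rank i Q"
proof (rule rank_eqI[OF proj_dsm[OF assms]])
  have "rank_at S (dsm P Q) = rank_at S P + rank_at S Q" for S
    using assms by (subst dsm_map) (auto simp: proj_def star_morphism.zero[OF character(1)] intro!: mtr_dsm)
  then show "rank_at (set_option i) (dsm P Q) = of_int (rank i P + rank i Q)"
    using assms by (simp add: rank_at_rank)
qed

lemma rank_mvn: "mvn P Q \<Longrightarrow> rank i P = rank i Q"
  unfolding rank_def using mtr_mvn star_morphism.map_mat_mvn[OF character(1)] by metis

lemma rank_stable:
  assumes "proj m P" "proj n Q" "\<And>i. rank i P = rank i Q"
  shows "\<exists>k E. proj k E \<and> mvn (dsm P E) (dsm Q E)"
proof (rule stably_equivalent[OF assms(1,2)])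
  have *: "rank_at (set_option i) P = rank_at (set_option i) Q" for i
    using assms by (simp add: rank_at_rank)
  show "rank_at {} P = rank_at {} Q" "rank_at {i} P = rank_at {i} Q" for i
    using *[of None] *[of "Some i"] by simp_all
qed

text \<open>The rank vectors of formal differences, a subgroup of Z^4 that turns out to be
  everything.\<close>

definition attained :: "(refl_gen option \<Rightarrow> int) \<Rightarrow> bool" where
  "attained z \<longleftrightarrow> (\<exists>m n P Q. proj m P \<and> proj n Q \<and> (\<forall>i. rank i P = z i + rank i Q))"

lemma attained_add: assumes "attained x" "attained y" shows "attained (\<lambda>i. x i + y i)"
proof -
  obtain m n P Q where 1: "proj m P" "proj n Q" "\<And>i. rank i P = x i + rank i Q"
    using assms(1) by (auto simp: attained_def)
  obtain m' n' P' Q' where 2: "proj m' P'" "proj n' Q'" "\<And>i. rank i P' = y i + rank i Q'"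
    using assms(2) by (auto simp: attained_def)
  show ?thesis unfolding attained_def
    by (intro exI[of _ "m + m'"] exI[of _ "n + n'"] exI[of _ "dsm P P'"] exI[of _ "dsm Q Q'"])
      (simp add: proj_dsm 1 2 rank_dsm[OF 1(1) 2(1)] rank_dsm[OF 1(2) 2(2)])
qed

lemma attained_minus: assumes "attained x" shows "attained (\<lambda>i. - x i)"
proof -
  obtain m n P Q where "proj m P" "proj n Q" "\<And>i. rank i P = x i + rank i Q"
    using assms(1) by (auto simp: attained_def)
  then show ?thesis unfolding attained_def
    by (intro exI[of _ n] exI[of _ m] exI[of _ Q] exI[of _ P]) simp
qed

lemma attained_zero: "attained (\<lambda>i. 0)"
  unfolding attained_def
  by (rule exI[of _ 0], rule exI[of _ 0], rule exI[of _ "1\<^sub>m 0"], rule exI[of _ "1\<^sub>m 0"]) (simp add: proj_one)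

lemma attained_mult: assumes "attained x" shows "attained (\<lambda>i. k * x i)"
proof (induction k rule: int_induct[where k = 0])
  case base then show ?case by (simp add: attained_zero)
next
  case (step1 k)
  then show ?case using attained_add[OF _ assms] by (simp add: distrib_right)
next
  case (step2 k)
  then show ?case using attained_add[OF _ attained_minus[OF assms]] by (simp add: left_diff_distrib)
qed

lemma attained_rank: "proj n P \<Longrightarrow> (\<And>i. rank i P = z i) \<Longrightarrow> attained z"
proof -
  assume P: "proj n P" "\<And>i. rank i P = z i"
  have "rank i (1\<^sub>m 0) = 0" for i
    by (rule rank_eqI[OF proj_one]) (simp add: mtr_def)
  then show ?thesis unfolding attained_def using P proj_one[of 0] by (metis add.right_neutral)
qed

lemma attained_one: "attained (\<lambda>i. 1)"
proof (rule attained_rank[OF proj_one[of 1]])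
  show "rank i (1\<^sub>m 1) = 1" for i
    by (rule rank_eqI[OF proj_one]) (simp add: mtr_def star_morphism.one[OF character(1)])
qed

lemma attained_pr: "attained (\<lambda>i. if i = Some g then 1 else 0)"
proof -
  let ?P = "mat 1 1 (\<lambda>_. pr g)"
  have P: "proj 1 ?P"
    using isp_pr[of g] by (auto simp: proj_def isp_def scalar_prod_def intro!: eq_matI)
  show ?thesis
  proof (rule attained_rank[OF P])
    show "rank i ?P = (if i = Some g then 1 else 0)" for i
      by (rule rank_eqI[OF P], cases i) (auto simp: mtr_def character)
  qed
qed

text \<open>The unit has rank vector (1, 1, 1, 1) and \<open>pr g\<close> has the basis vector at
  \<open>Some g\<close>. These four form a basis of Z^4, so the coefficient of the unit is read off
  at \<open>None\<close>.\<close>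

lemma attained_all: "attained z"
proof -
  let ?b = "\<lambda>g. \<lambda>i. (z (Some g) - z None) * (if i = Some g then 1 else 0)"
  have "attained (\<lambda>i. z None * 1 + (?b W1 i + (?b W2 i + ?b W3 i)))"
    by (intro attained_add attained_mult attained_one attained_pr)
  moreover have "z None * 1 + (?b W1 i + (?b W2 i + ?b W3 i)) = z i" for i
  proof (cases i)
    case (Some g)
    then show ?thesis by (cases g) auto
  qed simp
  ultimately show ?thesis by simp
qed

lemma comm_group_int4:
  "comm_group (integer_group \<times>\<times> integer_group \<times>\<times> integer_group \<times>\<times> integer_group)"
proof (rule group.group_comm_groupI)
  show "Group.group (integer_group \<times>\<times> integer_group \<times>\<times> integer_group \<times>\<times> integer_group)"
    by (intro DirProd_group group_integer_group)
qed (auto simp: DirProd_def)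

theorem proposition3p5:
  fixes \<alpha> :: "(nat \<Rightarrow> f2_gen free_star) set \<Rightarrow> (nat \<Rightarrow> f2_gen free_star) set"
  assumes "\<alpha> \<in> star_aut CstarF2"
    and "\<alpha> F2_U = star CstarF2 F2_U" and "\<alpha> F2_V = star CstarF2 F2_V"
  shows "comm_group (K0 (crossed_product CstarF2 \<alpha>)) \<and>
      K0 (crossed_product CstarF2 \<alpha>)
        \<cong> integer_group \<times>\<times> integer_group \<times>\<times> integer_group \<times>\<times> integer_group \<and>
      trivial_group (K1 (crossed_product CstarF2 \<alpha>))"
proof -
  interpret inversion_action \<alpha> by unfold_locales (rule assms)+
  obtain \<Phi> :: "refl_algebra \<Rightarrow> _" where \<Phi>: "star_rep X \<Phi>" "bij_betw \<Phi> UNIV (carrier X)"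
    using crossed_product_iso by blast
  interpret \<Phi>: star_iso X \<Phi> using \<Phi> by (simp add: star_iso_def star_iso_axioms_def)
  let ?Z = "integer_group \<times>\<times> integer_group \<times>\<times> integer_group \<times>\<times> integer_group"
  interpret Z: comm_group ?Z by (rule comm_group_int4)
  \<comment> \<open>Single-valued on the range of \<open>\<Phi>.F\<close> because that map is
    injective.\<close>
  define mat_of where "mat_of p = (THE P. \<Phi>.F P = p)" for p
  have mat_of: "mat_of (\<Phi>.F P) = P" for P unfolding mat_of_def by (simp add: \<Phi>.F_inject)
  define \<rho> where "\<rho> p = (rank None (mat_of p), rank (Some W1) (mat_of p), rank (Some W2) (mat_of p), rank (Some W3) (mat_of p))" for p
  have \<rho>_eq: "\<rho> (\<Phi>.F P) = \<rho> (\<Phi>.F Q) \<longleftrightarrow> (\<forall>i. rank i P = rank i Q)" for P Q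
  proof -
    have "(\<forall>i. rank i P = rank i Q) \<longleftrightarrow> (\<forall>i\<in>{None, Some W1, Some W2, Some W3}. rank i P = rank i Q)"
      by (metis (full_types) insertCI option.exhaust refl_gen.exhaust)
    then show ?thesis by (simp add: \<rho>_def mat_of)
  qed
  have "comm_group (K0 X) \<and> K0 X \<cong> ?Z"
  proof (rule Z.K0_classification[of _ \<rho>])
    show "mat_id X 0 \<in> projections X" unfolding \<Phi>.projections_F \<Phi>.mat_id_F using proj_one by blast
  next
    fix p q assume "p \<in> projections X" "q \<in> projections X"
    then obtain m n P Q where P: "p = \<Phi>.F P" "proj m P" and Q: "q = \<Phi>.F Q" "proj n Q"
      unfolding \<Phi>.projections_F by blast
    have "dsum X p q \<in> projections X"
      unfolding P Q \<Phi>.dsum_F \<Phi>.projections_F using proj_dsm[OF P(2) Q(2)] by blast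
    then show "dsum X p q \<in> projections X \<and> \<rho> (dsum X p q) = \<rho> p \<otimes>\<^bsub>?Z\<^esub> \<rho> q"
      by (simp add: P Q \<Phi>.dsum_F \<rho>_def mat_of rank_dsm[OF P(2) Q(2)] DirProd_def)
    show "\<rho> p = \<rho> q" if "mvn_equiv X p q"
      using that unfolding P Q \<Phi>.mvn_equiv_F \<rho>_eq by (blast intro: rank_mvn)
    show "\<exists>r\<in>projections X. mvn_equiv X (dsum X p r) (dsum X q r)" if eq: "\<rho> p = \<rho> q"
    proof -
      obtain k E where "proj k E" "mvn (dsm P E) (dsm Q E)"
        using rank_stable[OF P(2) Q(2)] eq unfolding P Q \<rho>_eq by blast
      then show ?thesis unfolding P Q
        by (intro bexI[of _ "\<Phi>.F E"]) (auto simp: \<Phi>.dsum_F \<Phi>.mvn_equiv_F \<Phi>.projections_F)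
    qed
  next
    fix z assume "z \<in> carrier ?Z"
    obtain a b c d where z: "z = (a, b, c, d)" by (cases z) auto
    define y where "y i = (case i of None \<Rightarrow> a | Some g \<Rightarrow> case g of W1 \<Rightarrow> b | W2 \<Rightarrow> c | W3 \<Rightarrow> d)" for i
    obtain m n P Q where PQ: "proj m P" "proj n Q" "\<And>i. rank i P = y i + rank i Q"
      using attained_all[of y] unfolding attained_def by blast
    then have "\<Phi>.F P \<in> projections X" "\<Phi>.F Q \<in> projections X" unfolding \<Phi>.projections_F by blast+
    moreover have "\<rho> (\<Phi>.F P) = z \<otimes>\<^bsub>?Z\<^esub> \<rho> (\<Phi>.F Q)"
      by (simp add: \<rho>_def mat_of z PQ(3) y_def DirProd_def)
    ultimately show "\<exists>p\<in>projections X. \<exists>q\<in>projections X. \<rho> p = z \<otimes>\<^bsub>?Z\<^esub> \<rho> q" by blast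
  qed (simp add: \<rho>_def)
  moreover have "trivial_group (K1 X)"
    by (rule \<Phi>.trivial_K1_if_stably_trivial[OF stably_trivial])
  ultimately show ?thesis by blast
qed

end
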